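(* Let $g \colon \mathbb{R}^{+} \to \mathbb{R}^{+}$ be a continuous function such that $g(0)=0$, $g(s)>0$ for all $s>0$, $\lim_{s\to0^{+}} g(s)/s = 0$ and $\lim_{s\to+\infty} g(s)/s = 0$. Let $T>0$ and let $a\colon[0,T]\to\mathbb{R}$ be an integrable function with $\int_{0}^{T}a^{-}(t)\,dt\neq0$ for which there exist $2m+2$ points (with $m\geq1$) $$0=\tau_{0}\leq\sigma_{1}<\tau_{1}<\ldots<\sigma_{i}<\tau_{i}<\ldots<\sigma_{m}<\tau_{m}\leq\sigma_{m+1}=T$$ such that $a\succ0$ on $[\sigma_{i},\tau_{i}]$ for $i=1,\ldots,m$, and $a\prec0$ on $[\tau_{i},\sigma_{i+1}]$ for each $i\in\{0,\ldots,m\}$ with $\tau_{i}<\sigma_{i+1}$. Then there exists $\lambda^{*}>0$ such that for each $\lambda>\lambda^{*}$ there exists $\mu^{*}(\lambda)>0$ such that for each $\mu>\mu^{*}(\lambda)$ the Neumann problem $$u''+\bigl(\lambda a^{+}(t)-\mu a^{-}(t)\bigr)g(u)=0,\qquad u'(0)=u'(T)=0,$$ has at least $3^{m}-1$ positive solutions. The same result holds for the Dirichlet problem $$u''+\bigl(\lambda a^{+}(t)-\mu a^{-}(t)\bigr)g(u)=0,\qquad u(0)=u(T)=0.$$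
   Context: $\mathbb{R}^{+}:=[0,+\infty)$; $a^{+}=\max\{a,0\}$ and $a^{-}=\max\{-a,0\}$. On a given interval, $w\succ0$ means that $w(t)\geq0$ for almost every $t$ and $w$ is not almost everywhere zero on that interval; $w\prec0$ means $-w\succ0$. Solutions are meant in the Carathéodory sense ($u$ is $C^{1}$ with $u'$ absolutely continuous and the equation holds almost everywhere). A positive solution of the Neumann problem satisfies $u(t)>0$ for all $t\in[0,T]$; a positive solution of the Dirichlet problem satisfies $u(t)>0$ for all $t\in(0,T)$. *)

theory Defs
  imports "HOL-Analysis.Analysis"
begin

definition pos_part :: "real \<Rightarrow> real" where
  "pos_part x = max x 0"

definition neg_part :: "real \<Rightarrow> real" where
  "neg_part x = max (- x) 0"

definition succ_zero_on :: "(real \<Rightarrow> real) \<Rightarrow> real set \<Rightarrow> bool" where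
  "succ_zero_on w I \<longleftrightarrow>
     (AE t in lebesgue_on I. 0 \<le> w t) \<and> \<not> (AE t in lebesgue_on I. w t = 0)"

definition prec_zero_on :: "(real \<Rightarrow> real) \<Rightarrow> real set \<Rightarrow> bool" where
  "prec_zero_on w I \<longleftrightarrow> succ_zero_on (\<lambda>t. - w t) I"

text \<open>Absolute continuity of a function on a set of reals. (The library constant
  \<^const>\<open>absolutely_continuous\<close> is about measures.) A pair \<open>(x, y)\<close> in \<open>P\<close> stands for the
  interval from \<open>x\<close> to \<open>y\<close>; distinct intervals may share endpoints only.\<close>

definition absolutely_continuous_fun_on :: "real set \<Rightarrow> (real \<Rightarrow> real) \<Rightarrow> bool" where
  "absolutely_continuous_fun_on I f \<longleftrightarrow>
     (\<forall>\<epsilon>>0. \<exists>\<delta>>0. \<forall>P :: (real \<times> real) set.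
        finite P \<longrightarrow>
        (\<forall>(x, y)\<in>P. x \<le> y \<and> {x..y} \<subseteq> I) \<longrightarrow>
        disjoint_family_on (\<lambda>(x, y). {x<..<y}) P \<longrightarrow>
        (\<Sum>(x, y)\<in>P. y - x) < \<delta> \<longrightarrow>
        (\<Sum>(x, y)\<in>P. \<bar>f y - f x\<bar>) < \<epsilon>)"

text \<open>\<open>u\<close> is a Caratheodory solution, with derivative \<open>u'\<close>, of \<open>u'' + h(t) g(u) = 0\<close> on
  \<open>[0,T]\<close>. Continuity of \<open>u'\<close> is part of its absolute continuity. The values of \<open>u\<close> have to
  lie in the domain \<open>[0,\<infinity>)\<close> of the nonlinearity, outside of which the HOL function \<open>g\<close> is
  arbitrary.\<close>

definition caratheodory_solution ::
  "real \<Rightarrow> (real \<Rightarrow> real) \<Rightarrow> (real \<Rightarrow> real) \<Rightarrow> (real \<Rightarrow> real) \<Rightarrow> (real \<Rightarrow> real) \<Rightarrow> bool" where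
  "caratheodory_solution T h g u u' \<longleftrightarrow>
     (\<forall>t\<in>{0..T}. 0 \<le> u t) \<and>
     (\<forall>t\<in>{0..T}. (u has_real_derivative u' t) (at t within {0..T})) \<and>
     absolutely_continuous_fun_on {0..T} u' \<and>
     (AE t in lebesgue_on {0..T}. \<exists>u2.
        (u' has_real_derivative u2) (at t within {0..T}) \<and> u2 + h t * g (u t) = 0)"

definition positive_neumann_solution ::
  "real \<Rightarrow> (real \<Rightarrow> real) \<Rightarrow> (real \<Rightarrow> real) \<Rightarrow> (real \<Rightarrow> real) \<Rightarrow> bool" where
  "positive_neumann_solution T h g u \<longleftrightarrow>
     (\<exists>u'. caratheodory_solution T h g u u' \<and> u' 0 = 0 \<and> u' T = 0) \<and>
     (\<forall>t\<in>{0..T}. 0 < u t)"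

definition positive_dirichlet_solution ::
  "real \<Rightarrow> (real \<Rightarrow> real) \<Rightarrow> (real \<Rightarrow> real) \<Rightarrow> (real \<Rightarrow> real) \<Rightarrow> bool" where
  "positive_dirichlet_solution T h g u \<longleftrightarrow>
     (\<exists>u'. caratheodory_solution T h g u u') \<and> u 0 = 0 \<and> u T = 0 \<and>
     (\<forall>t\<in>{0<..<T}. 0 < u t)"

text \<open>Solutions are total HOL functions, so they are counted through their restrictions
  to \<open>[0,T]\<close>.\<close>

definition at_least_solutions :: "nat \<Rightarrow> real \<Rightarrow> ((real \<Rightarrow> real) \<Rightarrow> bool) \<Rightarrow> bool" where
  "at_least_solutions n T S \<longleftrightarrow>
     (\<exists>U. finite U \<and> n \<le> card U \<and> (\<forall>u\<in>U. S u) \<and> inj_on (\<lambda>u. restrict u {0..T}) U)"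

end

theory Submission
  imports Defs "HOL-Complex_Analysis.Great_Picard"
begin

text \<open>Idea. Shoot from \<open>(c, 0)\<close> (Neumann) or \<open>(0, c)\<close> (Dirichlet), with \<open>g\<close> extended by \<open>0\<close> to
  the negative numbers, and follow the maximum \<open>M\<^sub>i\<close> of \<open>u\<close> on the \<open>i\<close>-th positivity interval as \<open>c\<close>
  varies. Fix levels \<open>r1 < r2 < 1 < 2 < R\<close> such that \<open>g \<le> \<epsilon> x\<close> on \<open>[0,x]\<close> with a small \<open>\<epsilon>\<close> for
  \<open>x = r1, r2, R\<close>.
  If \<open>M\<^sub>i\<close> is \<open>r1\<close>, \<open>r2\<close> or \<open>R\<close>, then \<open>u\<close> is almost linear there and, for large \<open>\<mu>\<close>, leaves the next
  negativity interval so steeply that \<open>M\<close> exceeds \<open>R\<close> on the next positivity interval (or the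
  final boundary value is positive). If \<open>M\<^sub>i\<close> is \<open>1\<close> or \<open>2\<close>, then for large \<open>\<lambda>\<close> the concave hump
  falls below \<open>0\<close>, where \<open>u\<close> stays from then on. By the intermediate value theorem a segment of
  starting values with one end of each kind contains a segment of the same sort on which \<open>M\<close>
  stays in any prescribed one of \<open>[0,r1]\<close>, \<open>[r2,1]\<close>, \<open>[2,R]\<close>; iterating gives a solution for every
  nonzero pattern.

  Since \<open>g\<close> is only continuous, the initial value problem has no unique solution. Therefore the
  weight is first concentrated on a finite grid: at each node the slope is kicked by
  \<open>- h\<^sub>k g(u)\<close> and \<open>u\<close> is affine in between. Concavity, convexity and the absorption below \<open>0\<close>
  survive exactly, and the orbit depends continuously on \<open>c\<close> for trivial reasons. Arzela-Ascoli
  then yields a solution in the limit of refined grids.\<close>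

section \<open>Orbits of kicked systems\<close>

text \<open>All constants are fixed before the grid: the threshold for \<lambda> depends on
  \<open>g\<close> and \<open>a\<close>, the levels also on \<lambda>, the threshold for \<mu> on
  the levels, and beyond some \<open>N0\<close> the same values serve every refinement. Without this
  uniformity the limit could lose the patterns. The three ranges are closed and separated by the
  gaps between \<open>r1\<close> and \<open>r2\<close> and between 1 and 2. Hence the pattern
  survives the limit, and different patterns still give different solutions. The zero pattern is
  discarded because its orbits may tend to the trivial solution; this is the 1 in
  \<open>3 ^ m - 1\<close>. The limit is a priori only nonnegative, and initial values need not
  determine a solution in general. At 0 they do: \<open>g s / s\<close> is bounded on bounded sets,
  so a solution with value and slope 0 at one point vanishes identically. This turns a nontrivial
  nonnegative limit into a positive one.\<close>

lemma first_crossing: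
  fixes f :: "real \<Rightarrow> real"
  assumes f: "continuous_on UNIV f" and x: "f x \<le> b" and y: "b \<le> f y"
  shows "\<exists>y'\<in>closed_segment x y. f y' = b \<and> (\<forall>z\<in>closed_segment x y'. f z \<le> b)"
proof -
  \<comment> \<open>The crossing is the point of this compact set nearest to
    \<open>x\<close>.\<close>
  let ?S = "closed_segment x y \<inter> f -` {b..}"
  have "compact ?S"
    by (intro compact_Int_closed compact_segment closed_vimage f) auto
  moreover have "y \<in> ?S" using y by auto
  ultimately obtain y' where y': "y' \<in> ?S" and min: "\<And>z. z \<in> ?S \<Longrightarrow> dist x y' \<le> dist x z"
    using continuous_attains_inf[of ?S "dist x"] by (fastforce intro: continuous_intros)
  have lt: "f z < b" if z: "z \<in> closed_segment x y'" "z \<noteq> y'" for z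
  proof (rule ccontr)
    assume "\<not> f z < b"
    moreover have "z \<in> closed_segment x y"
      using z y' subset_closed_segment[of x y' x y] by auto
    ultimately have "dist x y' \<le> dist x z" by (intro min) auto
    with z show False
      by (auto simp: closed_segment_eq_real_ivl dist_real_def split: if_splits)
  qed
  have "f y' = b"
  proof (rule ccontr)
    assume ne: "f y' \<noteq> b"
    with y' have "b < f y'" by auto
    have "connected (f ` closed_segment x y')"
      by (intro connected_continuous_image continuous_on_subset[OF f]) auto
    moreover have "f x \<in> f ` closed_segment x y'" "f y' \<in> f ` closed_segment x y'" by auto
    ultimately have "b \<in> f ` closed_segment x y'"
      using x \<open>b < f y'\<close> connectedD_interval[of _ "f x" "f y'" b] by auto
    then obtain z where "z \<in> closed_segment x y'" "f z = b" by auto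
    with lt[of z] ne show False by auto
  qed
  moreover have "\<forall>z\<in>closed_segment x y'. f z \<le> b"
    using lt \<open>f y' = b\<close> by (metis less_eq_real_def)
  ultimately show ?thesis using y' by auto
qed

text \<open>From \<open>x\<close> to the first crossing of \<open>b\<close>, then from there back
  towards \<open>x\<close> to the first crossing of \<open>a\<close>, which is
  \<open>first_crossing\<close> for \<open>- f\<close>. Segments are unordered because either end of
  a segment of starting values may be the larger one.\<close>

lemma crossing_segment:
  fixes f :: "real \<Rightarrow> real"
  assumes f: "continuous_on UNIV f" and x: "f x \<le> a" and ab: "a \<le> b" and y: "b \<le> f y"
  obtains x' y' where "closed_segment x' y' \<subseteq> closed_segment x y" "f x' = a" "f y' = b"
    "\<And>z. z \<in> closed_segment x' y' \<Longrightarrow> a \<le> f z \<and> f z \<le> b"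
proof -
  obtain y' where y': "y' \<in> closed_segment x y" "f y' = b" "\<And>z. z \<in> closed_segment x y' \<Longrightarrow> f z \<le> b"
    using first_crossing[OF f, of x b y] x ab y by auto
  have "continuous_on UNIV (\<lambda>z. - f z)" by (intro continuous_intros f)
  from first_crossing[OF this, of y' "- a" x] obtain x' where x': "x' \<in> closed_segment y' x" "f x' = a"
    "\<And>z. z \<in> closed_segment y' x' \<Longrightarrow> a \<le> f z"
    using x ab y' by auto
  have "closed_segment x' y' \<subseteq> closed_segment x y'"
    using x'(1) by (simp add: subset_closed_segment closed_segment_commute)
  moreover have "closed_segment x y' \<subseteq> closed_segment x y"
    using y'(1) by (simp add: subset_closed_segment)
  ultimately show ?thesis
    using that[of x' y'] x' y'(2,3) closed_segment_commute[of x' y'] by blast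
qed

text \<open>Later \<open>h k\<close> is the integral of the weight over the cell between the nodes
  \<open>k\<close> and \<open>Suc k\<close>. Nodes may coincide, since the negativity intervals at
  the ends may be degenerate, so \<open>t\<close> is only monotone.\<close>

locale kicks =
  fixes g :: "real \<Rightarrow> real" and t h :: "nat \<Rightarrow> real"
  assumes g_nonneg: "\<And>x. 0 \<le> g x" and g_nonpos: "\<And>x. x \<le> 0 \<Longrightarrow> g x = 0" and t_mono: "mono t"
begin

text \<open>A semi-implicit Euler scheme: the kick at node \<open>k\<close> comes before the move,
  so \<open>v (Suc k)\<close> is the slope between the nodes \<open>k\<close> and
  \<open>Suc k\<close>. The broken line through the points \<open>(t k, u k)\<close> is thus exactly
  concave or convex according to the sign of \<open>h\<close>.\<close>

definition orbit :: "(nat \<Rightarrow> real) \<Rightarrow> (nat \<Rightarrow> real) \<Rightarrow> bool" where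
  "orbit u v \<longleftrightarrow>
     (\<forall>k. v (Suc k) = v k - h k * g (u k) \<and> u (Suc k) = u k + (t (Suc k) - t k) * v (Suc k))"

lemma t_le: "k \<le> l \<Longrightarrow> t k \<le> t l"
  using t_mono by (rule monoD)

lemma slope_change: "orbit u v \<Longrightarrow> l \<le> k \<Longrightarrow> v k = v l - (\<Sum>j\<in>{l..<k}. h j * g (u j))"
  by (rotate_tac, induction k rule: dec_induct) (auto simp: orbit_def)

lemma rise_le:
  assumes "orbit u v" "l \<le> k" "\<And>j. l < j \<Longrightarrow> j \<le> k \<Longrightarrow> v j \<le> B"
  shows "u k \<le> u l + B * (t k - t l)"
  using assms(2,3)
proof (induction k rule: dec_induct)
  case (step n)
  have "u (Suc n) = u n + (t (Suc n) - t n) * v (Suc n)" using assms(1) by (simp add: orbit_def)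
  moreover have "(t (Suc n) - t n) * v (Suc n) \<le> (t (Suc n) - t n) * B"
    using step t_le[of n "Suc n"] by (intro mult_left_mono) auto
  moreover have "u n \<le> u l + B * (t n - t l)" using step by auto
  ultimately show ?case by (simp add: algebra_simps)
qed simp

lemma rise_ge:
  assumes "orbit u v" "l \<le> k" "\<And>j. l < j \<Longrightarrow> j \<le> k \<Longrightarrow> B \<le> v j"
  shows "u l + B * (t k - t l) \<le> u k"
  using assms(2,3)
proof (induction k rule: dec_induct)
  case (step n)
  have "u (Suc n) = u n + (t (Suc n) - t n) * v (Suc n)" using assms(1) by (simp add: orbit_def)
  moreover have "(t (Suc n) - t n) * B \<le> (t (Suc n) - t n) * v (Suc n)"
    using step t_le[of n "Suc n"] by (intro mult_left_mono) auto
  moreover have "u l + B * (t n - t l) \<le> u n" using step by auto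
  ultimately show ?case by (simp add: algebra_simps)
qed simp

lemma slope_antimono:
  assumes "orbit u v" "\<And>j. l \<le> j \<Longrightarrow> j < k \<Longrightarrow> 0 \<le> h j" "l \<le> i" "i \<le> j" "j \<le> k"
  shows "v j \<le> v i"
proof -
  have "0 \<le> (\<Sum>n\<in>{i..<j}. h n * g (u n))" using assms by (intro sum_nonneg mult_nonneg_nonneg g_nonneg) auto
  with slope_change[OF assms(1,4)] show ?thesis by simp
qed

lemma slope_mono:
  assumes "orbit u v" "\<And>j. l \<le> j \<Longrightarrow> j < k \<Longrightarrow> h j \<le> 0" "l \<le> i" "i \<le> j" "j \<le> k"
  shows "v i \<le> v j"
proof -
  have "(\<Sum>n\<in>{i..<j}. h n * g (u n)) \<le> 0"
    using assms g_nonneg by (intro sum_nonpos mult_nonpos_nonneg) auto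
  with slope_change[OF assms(1,4)] show ?thesis by simp
qed

text \<open>Where \<open>u\<close> is nonpositive \<open>g\<close> vanishes, so no kick can ever
  turn a nonpositive slope.\<close>

lemma sink:
  assumes "orbit u v" "u k \<le> 0" "v k \<le> 0" "k \<le> l"
  shows "u l \<le> u k \<and> v l = v k"
  using assms(4)
proof (induction l rule: dec_induct)
  case (step n)
  have "g (u n) = 0" using step assms by (intro g_nonpos) auto
  moreover have "(t (Suc n) - t n) * v k \<le> 0"
    using t_le[of n "Suc n"] assms by (intro mult_nonneg_nonpos) auto
  ultimately show ?case using assms(1) step by (auto simp: orbit_def)
qed simp

text \<open>The first node below 0 is reached from a nonnegative value, hence with a negative slope,
  and \<open>sink\<close> preserves that slope.\<close>

lemma slope_neg_below:
  assumes o: "orbit u v" "0 \<le> u 0" "u k < 0"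
  shows "v k < 0"
proof -
  define l where "l = (LEAST l. u l < 0)"
  have l: "u l < 0" "l \<le> k" unfolding l_def using assms(3) by (auto intro: LeastI Least_le)
  with o have "l \<noteq> 0" by (metis not_le)
  then obtain j where j: "l = Suc j" by (cases l) auto
  have "\<not> u j < 0" unfolding l_def by (rule not_less_Least) (simp add: l_def[symmetric] j)
  moreover have "u l = u j + (t l - t j) * v l" using o(1) j by (simp add: orbit_def)
  ultimately have "(t l - t j) * v l < 0" using l by auto
  then have "v l < 0" using t_le[of j l] j by (auto simp: mult_less_0_iff)
  with sink[OF o(1), of l k] l show ?thesis by auto
qed

lemma below_stays:
  assumes "orbit u v" "0 \<le> u 0" "u k < 0" "k \<le> l"
  shows "u l < 0" "v l < 0"
  using sink[OF assms(1), of k l] slope_neg_below[OF assms(1-3)] assms by auto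

text \<open>The sign of \<open>v j\<close> decides: slopes are nondecreasing along the block, so
  either \<open>u\<close> has been falling up to \<open>j\<close> or it is rising from
  \<open>j\<close> on.\<close>

lemma convex_le_max:
  assumes "orbit u v" "\<And>j. l \<le> j \<Longrightarrow> j < k \<Longrightarrow> h j \<le> 0" "l \<le> j" "j \<le> k"
  shows "u j \<le> max (u l) (u k)"
proof (cases "v j \<le> 0")
  case True
  have "v i \<le> 0" if "l < i" "i \<le> j" for i
    using slope_mono[OF assms(1,2), of l k i j] that assms True by auto
  from rise_le[OF assms(1,3) this] show ?thesis by auto
next
  case False
  have "0 \<le> v i" if "j < i" "i \<le> k" for i
    using slope_mono[OF assms(1,2), of l k j i] that assms False by auto
  from rise_ge[OF assms(1,4) this] show ?thesis by auto
qed

text \<open>\<open>v j\<close> bounds the slopes before \<open>j\<close> from below and those after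
  it from above. The chord inequality is multiplied out, which keeps it meaningful when nodes
  coincide.\<close>

lemma concave_chord:
  assumes "orbit u v" "\<And>j. l \<le> j \<Longrightarrow> j < k \<Longrightarrow> 0 \<le> h j" "l \<le> j" "j \<le> k"
  shows "u k * (t j - t l) + u l * (t k - t j) \<le> u j * (t k - t l)"
proof (cases "j = l")
  case False
  have a: "u l + v j * (t j - t l) \<le> u j"
    using slope_antimono[OF assms(1,2)] assms by (intro rise_ge[OF assms(1,3)]) auto
  have b: "u k \<le> u j + v j * (t k - t j)"
    using slope_antimono[OF assms(1,2)] assms by (intro rise_le[OF assms(1,4)]) auto
  have "(u l + v j * (t j - t l)) * (t k - t j) \<le> u j * (t k - t j)"
    using a t_le[of j k] assms by (intro mult_right_mono) auto
  moreover have "u k * (t j - t l) \<le> (u j + v j * (t k - t j)) * (t j - t l)"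
    using b t_le[of l j] assms by (intro mult_right_mono) auto
  ultimately show ?thesis by (simp add: algebra_simps)
qed simp

text \<open>A concave hump of height \<open>\<rho>\<close> has slopes at most \<open>\<rho> / \<theta>\<close> in modulus at distance
  \<open>\<theta>\<close> from the end points, which bounds the total kick received in between.\<close>

lemma hump_kick_le:
  assumes o: "orbit u v" and h: "\<And>j. s \<le> j \<Longrightarrow> j < q \<Longrightarrow> 0 \<le> h j"
    and u: "\<And>j. s \<le> j \<Longrightarrow> j \<le> q \<Longrightarrow> 0 \<le> u j \<and> u j \<le> \<rho>"
    and p: "s \<le> p" "p \<le> q" "u p = \<rho>"
    and k: "s \<le> k1" "k1 \<le> k2" "k2 < q" and th: "0 < \<theta>" "\<theta> \<le> t k1 - t s" "\<theta> \<le> t q - t k2"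
    and gm: "\<And>y. \<rho> * \<theta> / (t q - t s) \<le> y \<Longrightarrow> y \<le> \<rho> \<Longrightarrow> \<gamma> \<le> g y"
  shows "\<gamma> * (\<Sum>j\<in>{k1..k2}. h j) \<le> 2 * \<rho> / \<theta>"
proof -
  have rho: "0 \<le> \<rho>" using u[of p] p by auto
  have ts: "0 < t q - t s" using th t_le[of k1 q] k by auto
  \<comment> \<open>Concavity puts the orbit above the chords from the peak at \<open>p\<close> to
    the two ends, where it is nonnegative; at distance \<open>\<theta>\<close> from the ends these
    chords are at least this high.\<close>
  have low: "\<rho> * \<theta> / (t q - t s) \<le> u j" if j: "k1 \<le> j" "j \<le> k2" for j
  proof -
    have "\<rho> * \<theta> \<le> u j * (t q - t s)"
    proof (cases "j \<le> p")
      case True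
      have "\<rho> * \<theta> \<le> \<rho> * (t j - t s)"
        using th t_le[of k1 j] j rho by (intro mult_left_mono) auto
      also have "\<dots> \<le> u p * (t j - t s) + u s * (t p - t j)"
        using u[of s] p k t_le[of j p] True by auto
      also have "\<dots> \<le> u j * (t p - t s)"
        using k j p True by (intro concave_chord[OF o] h) auto
      also have "\<dots> \<le> u j * (t q - t s)"
        using u[of j] k j t_le[of p q] p by (intro mult_left_mono) auto
      finally show ?thesis .
    next
      case False
      have "\<rho> * \<theta> \<le> \<rho> * (t q - t j)"
        using th t_le[of j k2] j rho by (intro mult_left_mono) auto
      also have "\<dots> \<le> u q * (t j - t p) + u p * (t q - t j)"
        using u[of q] p k t_le[of p j] False by auto
      also have "\<dots> \<le> u j * (t q - t p)"
        using k j p False by (intro concave_chord[OF o] h) auto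
      also have "\<dots> \<le> u j * (t q - t s)"
        using u[of j] k j t_le[of s p] p by (intro mult_left_mono) auto
      finally show ?thesis .
    qed
    with ts show ?thesis by (simp add: divide_le_eq)
  qed
  have "u s + v k1 * (t k1 - t s) \<le> u k1"
    using k by (intro rise_ge[OF o] slope_antimono[OF o h]) auto
  then have "v k1 * (t k1 - t s) \<le> \<rho>" using u[of s] u[of k1] k by auto
  moreover have "v k1 * \<theta> \<le> v k1 * (t k1 - t s)" if "0 \<le> v k1"
    using that th by (intro mult_left_mono) auto
  moreover have "v k1 * \<theta> \<le> 0" if "v k1 \<le> 0" using that th by (simp add: mult_nonpos_nonneg)
  ultimately have a: "v k1 * \<theta> \<le> \<rho>" using rho by linarith
  \<comment> \<open>\<open>v (Suc k2)\<close> is the slope after the last kick of the sum, so the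
    difference of the two slopes is the full sum over \<open>{k1..k2}\<close>.\<close>
  have "u q \<le> u k2 + v (Suc k2) * (t q - t k2)"
    using k by (intro rise_le[OF o] slope_antimono[OF o h]) auto
  then have "- \<rho> \<le> v (Suc k2) * (t q - t k2)" using u[of q] u[of k2] k by auto
  moreover have "v (Suc k2) * (t q - t k2) \<le> v (Suc k2) * \<theta>" if "v (Suc k2) \<le> 0"
    using that th by (intro mult_left_mono_neg) auto
  moreover have "0 \<le> v (Suc k2) * \<theta>" if "0 \<le> v (Suc k2)" using that th by simp
  ultimately have b: "- \<rho> \<le> v (Suc k2) * \<theta>" using rho by linarith
  have "\<gamma> * (\<Sum>j\<in>{k1..k2}. h j) = (\<Sum>j\<in>{k1..<Suc k2}. h j * \<gamma>)"
    by (simp add: sum_distrib_left atLeastLessThanSuc_atLeastAtMost mult.commute)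
  also have "\<dots> \<le> (\<Sum>j\<in>{k1..<Suc k2}. h j * g (u j))"
    using k u low by (intro sum_mono mult_left_mono gm h) auto
  also have "\<dots> = v k1 - v (Suc k2)" using slope_change[OF o, of k1 "Suc k2"] k by simp
  also have "\<dots> \<le> 2 * \<rho> / \<theta>" using a b th by (simp add: field_simps)
  finally show ?thesis .
qed

end

section \<open>Shooting through the intervals\<close>

text \<open>The weight is nonnegative from node \<open>s i\<close> to node \<open>q i\<close> and nonpositive from \<open>q i\<close> to
  \<open>s (Suc i)\<close>; only the first and the last of the latter intervals may be degenerate.\<close>

locale kicked_shooting = kicks g t h for g :: "real \<Rightarrow> real" and t h :: "nat \<Rightarrow> real" +
  fixes m :: nat and s q :: "nat \<Rightarrow> nat" and neumann :: bool
    and T H r1 r2 R L \<gamma> :: real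
  assumes g_cont: "continuous_on UNIV g"
    and m: "1 \<le> m" and T: "0 < T" and H: "0 < H" and q_0: "q 0 = 0"
    and s_le_q: "\<And>i. i \<in> {1..m} \<Longrightarrow> s i \<le> q i" and q_le_s: "\<And>i. i \<le> m \<Longrightarrow> q i \<le> s (Suc i)"
    and t_0: "t 0 = 0" and t_end: "t (s (Suc m)) = T"
    and t_pos: "\<And>i. i \<in> {1..m} \<Longrightarrow> t (s i) < t (q i)"
    and h_pos: "\<And>i k. i \<in> {1..m} \<Longrightarrow> s i \<le> k \<Longrightarrow> k < q i \<Longrightarrow> 0 \<le> h k"
    and h_le: "\<And>i. i \<in> {1..m} \<Longrightarrow> (\<Sum>k\<in>{s i..<q i}. h k) \<le> H"
    and h_neg: "\<And>i k. i \<le> m \<Longrightarrow> q i \<le> k \<Longrightarrow> k < s (Suc i) \<Longrightarrow> h k \<le> 0"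
    and h_flat: "\<And>i k. i \<le> m \<Longrightarrow> t (q i) = t (s (Suc i)) \<Longrightarrow> q i \<le> k \<Longrightarrow> k < s (Suc i) \<Longrightarrow> h k = 0"
    and h_steep: "\<And>i. i \<le> m \<Longrightarrow> t (q i) < t (s (Suc i)) \<Longrightarrow>
                   2 * L < \<gamma> * (\<Sum>k\<in>{q i..<s (Suc i)}. - h k)"
    and inner: "\<And>i. 1 \<le> i \<Longrightarrow> i < m \<Longrightarrow> t (q i) < t (s (Suc i))"
    and some: "\<exists>i\<le>m. t (q i) < t (s (Suc i))"
    and levels: "0 < r1" "r1 < r2" "r2 < 1" "2 < R"
    and g_small: "\<And>x y. x \<in> {r1, r2, R} \<Longrightarrow> y \<le> x \<Longrightarrow> H * g y \<le> x / (8 * T)"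
    and g_large: "\<And>y. r1 / 4 \<le> y \<Longrightarrow> y \<le> R \<Longrightarrow> \<gamma> \<le> g y"
    and L: "\<And>i. i \<in> {1..m} \<Longrightarrow> R / (8 * T) + R / (t (q i) - t (s i)) < L"
    and no_hump: "\<And>u v i \<rho>. orbit u v \<Longrightarrow> i \<in> {1..m} \<Longrightarrow> \<rho> \<in> {1, 2} \<Longrightarrow>
       (\<And>k. k \<in> {s i..q i} \<Longrightarrow> 0 \<le> u k \<and> u k \<le> \<rho>) \<Longrightarrow> \<forall>k\<in>{s i..q i}. u k \<noteq> \<rho>"
begin

abbreviation top_on :: "nat \<Rightarrow> (nat \<Rightarrow> real) \<Rightarrow> real" where
  "top_on i u \<equiv> Max (u ` {s i..q i})"

definition initial :: "(nat \<Rightarrow> real) \<Rightarrow> (nat \<Rightarrow> real) \<Rightarrow> bool" where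
  "initial u v \<longleftrightarrow> 0 \<le> u 0 \<and> 0 \<le> v 0 \<and> (if neumann then v 0 = 0 else u 0 = 0)"

text \<open>The quantity that has to vanish at \<open>T\<close>; shooting looks for a sign change of
  it.\<close>

definition final :: "(nat \<Rightarrow> real) \<Rightarrow> (nat \<Rightarrow> real) \<Rightarrow> real" where
  "final u v = (if neumann then v (s (Suc m)) else u (s (Suc m)))"

lemma top_on_le_iff: "i \<in> {1..m} \<Longrightarrow> top_on i u \<le> x \<longleftrightarrow> (\<forall>k\<in>{s i..q i}. u k \<le> x)"
  using s_le_q[of i] by (subst Max_le_iff) auto

lemma le_top_on: "k \<in> {s i..q i} \<Longrightarrow> u k \<le> top_on i u"
  by (rule Max_ge) auto

lemma top_on_attained:
  assumes "i \<in> {1..m}"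
  obtains k where "k \<in> {s i..q i}" "u k = top_on i u"
proof -
  have "top_on i u \<in> u ` {s i..q i}" using s_le_q[OF assms] by (intro Max_in) auto
  with that show ?thesis by auto
qed

lemma nodes_mono: "1 \<le> i \<Longrightarrow> i \<le> j \<Longrightarrow> j \<le> Suc m \<Longrightarrow> s i \<le> s j"
proof (rotate_tac, induction j rule: dec_induct)
  case (step n)
  with s_le_q[of n] q_le_s[of n] show ?case by auto
qed simp

lemma q_mono: "i \<le> j \<Longrightarrow> j \<le> m \<Longrightarrow> q i \<le> q j"
proof (induction j rule: dec_induct)
  case (step n)
  with s_le_q[of "Suc n"] q_le_s[of n] show ?case by auto
qed simp

lemma q_le_end: "i \<le> m \<Longrightarrow> q i \<le> s (Suc m)"
  using q_mono[of i m] q_le_s[of m] by auto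

lemma t_bounds: "k \<le> s (Suc m) \<Longrightarrow> 0 \<le> t k \<and> t k \<le> T"
  using t_le[of 0 k] t_le[of k "s (Suc m)"] t_0 t_end by auto

text \<open>The budget behind the factor 8 in \<open>g_small\<close>: each passage with slopes of
  size \<open>x / (8 * T)\<close> costs at most an eighth of the level \<open>x\<close>, whatever
  its length within \<open>[0,T]\<close>.\<close>

lemma scaled_le:
  assumes "0 \<le> x" "k \<le> l" "l \<le> s (Suc m)"
  shows "x / (8 * T) * (t l - t k) \<le> x / 8"
proof -
  have "x / (8 * T) * (t l - t k) \<le> x / (8 * T) * T"
    using t_bounds[of l] t_bounds[of k] assms T by (intro mult_left_mono) auto
  then show ?thesis using T by simp
qed

lemma pos_levels: "x \<in> {r1, r2, R} \<Longrightarrow> r1 \<le> x \<and> x \<le> R \<and> 0 < x"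
  using levels by auto

lemma L_gt: "R / (8 * T) < L"
proof -
  have "0 < R / (t (q 1) - t (s 1))" using levels t_pos[of 1] m by auto
  with L[of 1] m show ?thesis by auto
qed

lemma R_pos: "0 < R" and L_pos: "0 < L"
proof -
  show "0 < R" using levels by simp
  then have "0 < R / (8 * T)" using T by simp
  with L_gt show "0 < L" by linarith
qed

lemma slope_mono_block:
  assumes "orbit u v" "i \<le> m" "q i \<le> j" "j \<le> k" "k \<le> s (Suc i)"
  shows "v j \<le> v k"
  using slope_mono[OF assms(1), of "q i" "s (Suc i)" j k] h_neg[OF assms(2)] assms by auto

lemma convex_block:
  assumes "orbit u v" "i \<le> m" "k \<in> {q i..s (Suc i)}"
  shows "u k \<le> max (u (q i)) (u (s (Suc i)))"
  using convex_le_max[OF assms(1), of "q i" "s (Suc i)" k] h_neg[OF assms(2)] assms by auto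

text \<open>Below a level \<open>x\<close>, \<open>g\<close> is at most
  \<open>x / (8 * T * H)\<close> and the total weight is at most \<open>H\<close>, so the kicks of
  the whole positivity interval barely bend the orbit.\<close>

lemma slope_drop_le:
  assumes o: "orbit u v" and i: "i \<in> {1..m}" and x: "x \<in> {r1, r2, R}"
    and u: "\<And>k. k \<in> {s i..q i} \<Longrightarrow> u k \<le> x" and kl: "s i \<le> k" "k \<le> l" "l \<le> q i"
  shows "v k - x / (8 * T) \<le> v l"
proof -
  define B where "B = x / (8 * T) / H"
  have B: "0 \<le> B" using pos_levels[OF x] T H by (simp add: B_def)
  have gB: "g (u j) \<le> B" if "j \<in> {k..<l}" for j
  proof -
    have "H * g (u j) \<le> x / (8 * T)" using that kl by (intro g_small[OF x u]) auto
    then show ?thesis unfolding B_def using H by (subst pos_le_divide_eq) (auto simp: mult.commute)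
  qed
  have "(\<Sum>j\<in>{k..<l}. h j * g (u j)) \<le> (\<Sum>j\<in>{k..<l}. h j * B)"
    using kl by (intro sum_mono mult_left_mono gB h_pos[OF i]) auto
  also have "\<dots> \<le> (\<Sum>j\<in>{s i..<q i}. h j * B)"
    using kl B by (intro sum_mono2 mult_nonneg_nonneg h_pos[OF i]) auto
  also have "\<dots> \<le> H * B"
    using h_le[OF i] B by (simp add: sum_distrib_right[symmetric] mult_right_mono)
  also have "\<dots> = x / (8 * T)" using H by (simp add: B_def)
  finally show ?thesis using slope_change[OF o kl(2)] by simp
qed

text \<open>If the orbit stayed below \<open>R\<close>, its slope would stay above
  \<open>L - R / (8 * T)\<close>, which by the choice of \<open>L\<close> lifts it by more than
  \<open>R\<close> within the interval.\<close>

lemma steep_start_exceeds: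
  assumes o: "orbit u v" and i: "i \<in> {1..m}" and u: "0 \<le> u (s i)" and v: "L \<le> v (s i)"
  shows "R < top_on i u"
proof (rule ccontr)
  assume "\<not> R < top_on i u"
  then have le: "\<And>k. k \<in> {s i..q i} \<Longrightarrow> u k \<le> R" using top_on_le_iff[OF i, of u R] by (simp add: not_less)
  have "L - R / (8 * T) \<le> v j" if "s i \<le> j" "j \<le> q i" for j
    using slope_drop_le[OF o i _ le, of "s i" j] v that by auto
  then have "u (s i) + (L - R / (8 * T)) * (t (q i) - t (s i)) \<le> u (q i)"
    by (intro rise_ge[OF o s_le_q[OF i]]) auto
  moreover have "R < (L - R / (8 * T)) * (t (q i) - t (s i))"
    using L[OF i] t_pos[OF i] by (simp add: field_simps)
  ultimately show False using le[of "q i"] s_le_q[OF i] u by auto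
qed

text \<open>The largest slope inside the interval cannot be very negative, or the orbit would fall
  by more than \<open>R\<close>; the kicks then take off at most \<open>R / (8 * T)\<close>.\<close>

lemma slope_after_hump:
  assumes o: "orbit u v" and i: "i \<in> {1..m}" and u: "\<And>k. k \<in> {s i..q i} \<Longrightarrow> 0 \<le> u k \<and> u k \<le> R"
  shows "- L \<le> v (q i)"
proof -
  \<comment> \<open>The slopes inside the interval begin with \<open>v (Suc (s i))\<close>, after
    the kick at node \<open>s i\<close>; strictness makes this index admissible.\<close>
  have sq: "s i < q i" using s_le_q[OF i] t_pos[OF i] by (cases "s i = q i") auto
  have "u (q i) \<le> u (s i) + v (Suc (s i)) * (t (q i) - t (s i))"
    by (intro rise_le[OF o s_le_q[OF i]] slope_antimono[OF o, of "s i" "q i"] h_pos[OF i]) auto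
  then have "- R \<le> v (Suc (s i)) * (t (q i) - t (s i))" using u[of "q i"] u[of "s i"] s_le_q[OF i] by auto
  then have "- (R / (t (q i) - t (s i))) \<le> v (Suc (s i))"
    using t_pos[OF i] by (simp add: field_simps)
  moreover have "v (Suc (s i)) - R / (8 * T) \<le> v (q i)"
    using sq u by (intro slope_drop_le[OF o i]) auto
  ultimately show ?thesis using L[OF i] by auto
qed

text \<open>On the range \<open>[r1 / 4, R]\<close> the kicks add more than \<open>2 * L\<close> to
  the slope, by the choice of \<mu> behind \<open>h_steep\<close>: enough to turn a slope
  \<open>- L\<close> into \<open>L\<close>.\<close>

lemma steep_climb:
  assumes o: "orbit u v" and i: "i \<le> m" "t (q i) < t (s (Suc i))" and v: "- L \<le> v (q i)"
    and u: "\<And>k. k \<in> {q i..s (Suc i)} \<Longrightarrow> r1 / 4 \<le> u k \<and> u k \<le> R"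
  shows "L < v (s (Suc i))"
proof -
  have "\<gamma> * (\<Sum>k\<in>{q i..<s (Suc i)}. - h k) = (\<Sum>k\<in>{q i..<s (Suc i)}. - h k * \<gamma>)"
    by (simp add: sum_distrib_left mult.commute)
  also have "\<dots> \<le> (\<Sum>k\<in>{q i..<s (Suc i)}. - h k * g (u k))"
    using u h_neg[OF i(1)] by (intro sum_mono mult_left_mono g_large) auto
  also have "\<dots> = v (s (Suc i)) - v (q i)"
    using slope_change[OF o q_le_s[OF i(1)]] by (simp add: sum_negf)
  finally show ?thesis using h_steep[OF i] v by auto
qed

lemma flat_block:
  assumes o: "orbit u v" and i: "i \<le> m" "t (q i) = t (s (Suc i))"
  shows "u (s (Suc i)) = u (q i)" "v (s (Suc i)) = v (q i)"
proof -
  have "(\<Sum>j\<in>{q i..<s (Suc i)}. h j * g (u j)) = 0"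
    using h_flat[OF i] by (intro sum.neutral) auto
  with slope_change[OF o q_le_s[OF i(1)]] show "v (s (Suc i)) = v (q i)" by simp
  \<comment> \<open>Any bound for the slopes will do, since it gets multiplied by the length 0 of
    the block.\<close>
  have "bdd_above ((\<lambda>j. \<bar>v j\<bar>) ` {q i..s (Suc i)})" by simp
  then obtain B where B: "\<And>j. j \<in> {q i..s (Suc i)} \<Longrightarrow> \<bar>v j\<bar> \<le> B"
    unfolding bdd_above_def by (metis image_eqI)
  have B': "v j \<le> B" "- B \<le> v j" if "q i < j" "j \<le> s (Suc i)" for j
    using B[of j] that by (auto simp: abs_le_iff)
  have "u (s (Suc i)) \<le> u (q i) + B * (t (s (Suc i)) - t (q i))"
    using B' by (intro rise_le[OF o q_le_s[OF i(1)]]) auto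
  moreover have "u (q i) + - B * (t (s (Suc i)) - t (q i)) \<le> u (s (Suc i))"
    using B' by (intro rise_ge[OF o q_le_s[OF i(1)]]) auto
  ultimately show "u (s (Suc i)) = u (q i)" using i by simp
qed

text \<open>As \<open>q 0 = 0\<close>, the nodes up to \<open>s 1\<close> form a (possibly
  degenerate) negativity interval, on which the nonnegative initial slope cannot decrease.\<close>

lemma initial_block:
  assumes o: "orbit u v" and "initial u v" and k: "k \<le> s 1"
  shows "v 0 \<le> v k" "u k \<le> u (s 1)" "u 0 \<le> u k"
proof -
  have v: "v i \<le> v j" if "i \<le> j" "j \<le> s 1" for i j
    using slope_mono[OF o, of 0 "s 1" i j] h_neg[of 0] that q_0 by auto
  have v0: "0 \<le> v j" if "j \<le> s 1" for j
    using v[of 0 j] that assms(2) by (auto simp: initial_def)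
  show "v 0 \<le> v k" using v k by auto
  show "u k \<le> u (s 1)" using rise_ge[OF o k, of 0] v0 by auto
  show "u 0 \<le> u k" using rise_ge[OF o, of 0 k 0] v0 k by auto
qed

text \<open>If the orbit enters the interval with slope above \<open>x / (8 * T)\<close>, the slope
  remains positive and the maximum is at the right end. If it entered with a smaller slope, it would
  have been at height at least \<open>3 * x / 4\<close> throughout the preceding negativity
  interval, where a steep climb makes the entry slope exceed \<open>L\<close>. Only a degenerate
  first negativity interval escapes this contradiction, and then only under the Neumann condition,
  with entry slope 0.\<close>

lemma level_crossing:
  assumes o: "orbit u v" and init: "initial u v" and i: "i < m" and x: "x \<in> {r1, r2, R}"
    and top: "top_on (Suc i) u = x" and prev: "1 \<le> i \<Longrightarrow> top_on i u \<le> R"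
  shows "x / 2 \<le> u (q (Suc i))" "- (x / (8 * T)) \<le> v (q (Suc i))"
    "0 < v (q (Suc i)) \<or> i = 0 \<and> neumann \<and> t (q 0) = t (s 1)"
proof -
  let ?s = "s (Suc i)" and ?q = "q (Suc i)"
  have I: "Suc i \<in> {1..m}" using i by auto
  have sq: "?s \<le> ?q" using s_le_q[OF I] .
  have qe: "?q \<le> s (Suc m)" using q_le_end[of "Suc i"] i by auto
  have qs: "q i \<le> ?s" using q_le_s[of i] i by auto
  have xx: "r1 \<le> x" "x \<le> R" "0 < x" using pos_levels[OF x] by auto
  obtain p where p: "p \<in> {?s..?q}" "u p = x" using top_on_attained[OF I, of u] top by metis
  have le: "\<And>k. k \<in> {?s..?q} \<Longrightarrow> u k \<le> x" using top_on_le_iff[OF I, of u x] top by auto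
  have u0: "0 \<le> u 0" using init by (simp add: initial_def)
  have nonneg: "0 \<le> u k" if "k \<le> p" for k
    using below_stays(1)[OF o u0 _ that] p xx by (meson not_less order_less_asym)
  have drop: "v k - x / (8 * T) \<le> v l" if "?s \<le> k" "k \<le> l" "l \<le> ?q" for k l
    using slope_drop_le[OF o I x le] that by auto
  have anti: "v l \<le> v k" if "?s \<le> k" "k \<le> l" "l \<le> ?q" for k l
    by (rule slope_antimono[OF o h_pos[OF I] that])
  have "x / 2 \<le> u ?q \<and> - (x / (8 * T)) \<le> v ?q \<and> (0 < v ?q \<or> i = 0 \<and> neumann \<and> t (q 0) = t (s 1))"
  proof (cases "x / (8 * T) < v ?s")
    case True
    have pos: "0 < v k" if "k \<in> {?s..?q}" for k using drop[of ?s k] that True by auto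
    have "u p \<le> u ?q"
      using rise_ge[OF o, of p ?q 0] pos p by (auto simp: less_imp_le)
    moreover have "0 \<le> x / (8 * T)" using xx T by auto
    ultimately show ?thesis using pos[of ?q] sq p xx by auto
  next
    case False
    have "v j \<le> x / (8 * T)" if "?s \<le> j" "j \<le> ?q" for j
      using False anti[of ?s j] that by auto
    then have "u p \<le> u ?s + x / (8 * T) * (t p - t ?s)"
      using p by (intro rise_le[OF o]) auto
    \<comment> \<open>From the maximum back to the entry at most \<open>x / 8\<close> is lost; the
      preceding negativity interval will cost another \<open>x / 8\<close>.\<close>
    with scaled_le[of x ?s p] p xx qe have us: "7 * x / 8 \<le> u ?s" by auto
    have neg: "v j \<le> v k" if "q i \<le> j" "j \<le> k" "k \<le> ?s" for j k
      using slope_mono_block[OF o, of i j k] that i by auto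
    have low: "3 * x / 4 \<le> u k" if "k \<in> {q i..?s}" for k
    proof -
      have "v j \<le> x / (8 * T)" if "q i \<le> j" "j \<le> ?s" for j
        using False neg[of j ?s] that by auto
      then have "u ?s \<le> u k + x / (8 * T) * (t ?s - t k)"
        using that by (intro rise_le[OF o]) auto
      moreover have "x / (8 * T) * (t ?s - t k) \<le> x / 8"
        using that xx qe sq by (intro scaled_le) auto
      ultimately show ?thesis using us by linarith
    qed
    show ?thesis
    proof (cases "t (q i) < t ?s")
      case True
      have uq: "u (q i) \<le> R" and vq: "- L \<le> v (q i)"
      proof -
        show "u (q i) \<le> R"
        proof (cases "i = 0")
          case True
          with initial_block(3)[OF o init, of "s 1"] le[of ?s] sq xx q_0 show ?thesis by auto
        next
          case False
          with prev le_top_on[of "q i" i u] s_le_q[of i] i show ?thesis by auto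
        qed
        show "- L \<le> v (q i)"
        proof (cases "i = 0")
          case True
          with init L_pos q_0 show ?thesis unfolding initial_def by auto
        next
          case False
          have "i \<in> {1..m}" using False i by auto
          moreover have "0 \<le> u k \<and> u k \<le> R" if "k \<in> {s i..q i}" for k
            using that nonneg[of k] p qs prev le_top_on[OF that, of u] False by auto
          ultimately show ?thesis by (rule slope_after_hump[OF o])
        qed
      qed
      \<comment> \<open>Contradicts the present case, in which \<open>v ?s\<close> is at most
        \<open>x / (8 * T)\<close> and hence below \<open>L\<close>.\<close>
      have "L < v ?s"
      proof (rule steep_climb[OF o _ True vq])
        fix k assume k: "k \<in> {q i..?s}"
        have "u k \<le> max (u (q i)) (u ?s)"
          using k i by (intro convex_block[OF o]) auto
        then show "r1 / 4 \<le> u k \<and> u k \<le> R" using low[OF k] uq le[of ?s] sq xx by auto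
      qed (use i in auto)
      moreover have "x / (8 * T) \<le> R / (8 * T)" using xx T by (intro divide_right_mono) auto
      ultimately show ?thesis using False L_gt by auto
    next
      case flat: False
      have t_eq: "t (q i) = t ?s" using flat t_le[OF qs] by auto
      have i0: "i = 0" using flat inner[of i] i by (cases "i = 0") auto
      have uv: "u ?s = u 0" "v ?s = v 0" using flat_block[OF o _ t_eq] i i0 q_0 by auto
      \<comment> \<open>A Dirichlet orbit would still be at height 0 at the entry, against the bound
        \<open>7 * x / 8\<close>.\<close>
      have nd: neumann
        using init uv us xx by (auto simp: initial_def split: if_splits)
      have v: "v ?s = 0" using init nd uv unfolding initial_def by auto
      have "u ?s + - (x / (8 * T)) * (t ?q - t ?s) \<le> u ?q"
        using drop[of ?s] v by (intro rise_ge[OF o sq]) force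
      moreover have "x / (8 * T) * (t ?q - t ?s) \<le> x / 8" using scaled_le[of x ?s ?q] sq qe xx by auto
      ultimately have "x / 2 \<le> u ?q" using us xx by auto
      then show ?thesis using drop[of ?s ?q] sq v nd i0 t_eq by auto
    qed
  qed
  then show "x / 2 \<le> u ?q" "- (x / (8 * T)) \<le> v ?q" "0 < v ?q \<or> i = 0 \<and> neumann \<and> t (q 0) = t (s 1)"
    by auto
qed

text \<open>The slope is nondecreasing on the negativity interval, so \<open>u\<close> stays above
  \<open>x / 2 - x / 8\<close> there and, unless it ends beyond \<open>R\<close>, climbs steeply.
  Either way the next positivity interval is entered above \<open>R\<close> or with slope above
  \<open>L\<close>, and at \<open>T\<close> both \<open>u\<close> and \<open>v\<close> are positive.
  A degenerate last interval leaves \<open>u\<close> and \<open>v\<close> unchanged, whence the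
  hypothesis \<open>last\<close> for the Neumann case.\<close>

lemma after_level_crossing:
  assumes o: "orbit u v" and i: "1 \<le> i" "i \<le> m" and x: "x \<in> {r1, r2, R}"
    and u: "x / 2 \<le> u (q i)" "u (q i) \<le> R" and v: "- (x / (8 * T)) \<le> v (q i)"
    and last: "i = m \<Longrightarrow> t (q m) = t (s (Suc m)) \<Longrightarrow> neumann \<Longrightarrow> 0 < v (q m)"
  shows "if i < m then R < top_on (Suc i) u else 0 < final u v"
proof -
  let ?s = "s (Suc i)"
  have qs: "q i \<le> ?s" using q_le_s i by auto
  have se: "?s \<le> s (Suc m)" using nodes_mono[of "Suc i" "Suc m"] i by auto
  have xx: "r1 \<le> x" "x \<le> R" "0 < x" using pos_levels[OF x] by auto
  have mono: "v j \<le> v k" if "q i \<le> j" "j \<le> k" "k \<le> ?s" for j k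
    using slope_mono_block[OF o, of i j k] that i by auto
  have low: "r1 / 4 \<le> u k" if "k \<in> {q i..?s}" for k
  proof -
    have "- (x / (8 * T)) \<le> v j" if "q i \<le> j" "j \<le> ?s" for j
      using v mono[of "q i" j] that by auto
    then have "u (q i) + - (x / (8 * T)) * (t k - t (q i)) \<le> u k"
      using that by (intro rise_ge[OF o]) auto
    moreover have "x / (8 * T) * (t k - t (q i)) \<le> x / 8"
      using that se xx by (intro scaled_le) auto
    ultimately show ?thesis using xx u by linarith
  qed
  have top: "u ?s \<le> top_on (Suc i) u" if "i < m"
    using s_le_q[of "Suc i"] that by (intro le_top_on) auto
  show ?thesis
  proof (cases "t (q i) < t ?s")
    case False
    then have t_eq: "t (q i) = t ?s" using t_le[OF qs] by auto
    then have "i = m" using inner[of i] i by (cases "i = m") auto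
    with flat_block[OF o _ t_eq] low[of ?s] last t_eq levels qs show ?thesis by (auto simp: final_def)
  next
    case steep: True
    show ?thesis
    proof (cases "u ?s \<le> R")
      case True
      have "L < v ?s"
      proof (rule steep_climb[OF o i(2) steep])
        have "x / (8 * T) \<le> R / (8 * T)" using xx T by (intro divide_right_mono) auto
        then show "- L \<le> v (q i)" using v L_gt by auto
        fix k assume k: "k \<in> {q i..?s}"
        have "u k \<le> max (u (q i)) (u ?s)"
          using k i by (intro convex_block[OF o]) auto
        then show "r1 / 4 \<le> u k \<and> u k \<le> R" using low[OF k] u True by auto
      qed
      moreover have "0 < L" by (rule L_pos)
      moreover have "0 < u ?s" using low[of ?s] qs levels by auto
      ultimately show ?thesis using steep_start_exceeds[OF o, of "Suc i"] i by (auto simp: final_def)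
    next
      case False
      \<comment> \<open>A nonpositive slope at the end would mean a falling orbit all along, from a
        value of at most \<open>R\<close>.\<close>
      have "0 < v ?s"
      proof (rule ccontr)
        assume "\<not> 0 < v ?s"
        then have "v j \<le> 0" if "q i \<le> j" "j \<le> ?s" for j using mono[of j ?s] that by auto
        then have "u ?s \<le> u (q i)" using rise_le[OF o qs, of 0] by auto
        with False u show False by auto
      qed
      with False top levels i show ?thesis by (auto simp: final_def)
    qed
  qed
qed

lemma block_cover:
  assumes "k \<le> s (Suc m)"
  shows "(\<exists>i\<in>{1..m}. k \<in> {s i..q i}) \<or> (\<exists>i\<le>m. k \<in> {q i..s (Suc i)})"
proof -
  have "n \<le> m \<Longrightarrow> k \<le> s (Suc n) \<Longrightarrow> (\<exists>i\<in>{1..m}. k \<in> {s i..q i}) \<or> (\<exists>i\<le>m. k \<in> {q i..s (Suc i)})" for n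
  proof (induction n)
    case 0
    then show ?case using q_0 by auto
  next
    case (Suc n)
    then show ?case by (cases "k \<le> s (Suc n)"; cases "k \<le> q (Suc n)") force+
  qed
  with assms show ?thesis by blast
qed

text \<open>A negative value would make \<open>u\<close> and \<open>v\<close> negative from then on,
  and hence \<open>final\<close> too. Between the humps the orbit is convex, so only the boundary
  blocks need care: on the first one \<open>u\<close> does not decrease, and the last one either
  ends at 0 (Dirichlet) or falls until the slope is 0 (Neumann).\<close>

lemma bounds_of_final_zero:
  assumes o: "orbit u v" and init: "initial u v" and fin: "final u v = 0"
    and top: "\<And>i. i \<in> {1..m} \<Longrightarrow> top_on i u \<le> R" and k: "k \<le> s (Suc m)"
  shows "0 \<le> u k" "u k \<le> R"
proof -
  have u0: "0 \<le> u 0" using init by (simp add: initial_def)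
  show "0 \<le> u k"
    using below_stays[OF o u0 _ k] fin unfolding final_def by (metis less_irrefl not_less)
  have s: "u (s i) \<le> R" "u (q i) \<le> R" if "i \<in> {1..m}" for i
    using le_top_on[of "s i" i u] le_top_on[of "q i" i u] s_le_q[OF that] top[OF that] by auto
  from block_cover[OF k] show "u k \<le> R"
  proof (elim disjE bexE exE conjE)
    fix i assume "i \<in> {1..m}" "k \<in> {s i..q i}"
    then show ?thesis using le_top_on[of k i u] top[of i] by auto
  next
    fix i assume i: "i \<le> m" "k \<in> {q i..s (Suc i)}"
    then have conv: "u k \<le> max (u (q i)) (u (s (Suc i)))" by (intro convex_block[OF o]) auto
    consider "i = 0" | "1 \<le> i" "i < m" | "1 \<le> i" "i = m" using i by linarith
    then show ?thesis
    proof cases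
      case 1
      then show ?thesis using initial_block(2)[OF o init, of k] s(1)[of 1] m i by auto
    next
      case 2
      then show ?thesis using conv s[of i] s[of "Suc i"] by auto
    next
      case 3
      show ?thesis
      proof (cases neumann)
        case True
        with fin have "v (s (Suc m)) = 0" unfolding final_def by simp
        then have "v j \<le> 0" if "q i \<le> j" "j \<le> s (Suc i)" for j
          using slope_mono_block[OF o, of i j "s (Suc i)"] that 3 by auto
        then have "u k \<le> u (q i)" using rise_le[OF o, of "q i" k 0] i by auto
        then show ?thesis using s[of i] 3 m by auto
      next
        case False
        with fin have "u (s (Suc m)) = 0" unfolding final_def by simp
        then show ?thesis using conv s[of i] 3 m levels by auto
      qed
    qed
  qed
qed

end

text \<open>The lowest range is unbounded below, since orbits at the sinking end of a segment have
  nonpositive maxima. Every code other than 0 and 1 stands for the highest range.\<close>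

definition pattern_range :: "real \<Rightarrow> real \<Rightarrow> real \<Rightarrow> nat \<Rightarrow> real set" where
  "pattern_range r1 r2 R j = (if j = 0 then {..r1} else if j = 1 then {r2..1} else {2..R})"

section \<open>Dependence on the starting value, and its choice\<close>

context kicks
begin

primrec shoot :: "real \<times> real \<Rightarrow> nat \<Rightarrow> real \<times> real" where
  "shoot z 0 = z"
| "shoot z (Suc k) = (let (u, v) = shoot z k; v' = v - h k * g u in (u + (t (Suc k) - t k) * v', v'))"

lemma orbit_shoot: "orbit (\<lambda>k. fst (shoot z k)) (\<lambda>k. snd (shoot z k))"
  by (auto simp: orbit_def Let_def case_prod_unfold)

lemma continuous_shoot:
  assumes g: "continuous_on UNIV g" and z: "continuous_on UNIV z"
  shows "continuous_on UNIV (\<lambda>c. shoot (z c) k)"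
proof (induction k)
  case (Suc k)
  have "continuous_on UNIV (\<lambda>c. g (fst (shoot (z c) k)))"
    by (rule continuous_on_compose2[OF g]) (intro continuous_intros Suc, simp)
  with Suc show ?case by (auto simp: Let_def case_prod_unfold intro!: continuous_intros)
qed (simp add: z)

end

lemma continuous_on_Max_image:
  fixes f :: "'i \<Rightarrow> 'a::topological_space \<Rightarrow> real"
  assumes "finite A" "A \<noteq> {}" "\<And>i. i \<in> A \<Longrightarrow> continuous_on S (f i)"
  shows "continuous_on S (\<lambda>x. Max ((\<lambda>i. f i x) ` A))"
  using assms
proof (induction A rule: finite_ne_induct)
  case (insert a A)
  then have "continuous_on S (\<lambda>x. max (f a x) (Max ((\<lambda>i. f i x) ` A)))"
    by (intro continuous_intros) auto
  with insert show ?case by simp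
qed simp

context kicked_shooting
begin

definition start :: "real \<Rightarrow> real \<times> real" where
  "start c = (if neumann then (c, 0) else (0, c))"

abbreviation U :: "real \<Rightarrow> nat \<Rightarrow> real" where "U c \<equiv> \<lambda>k. fst (shoot (start c) k)"
abbreviation V :: "real \<Rightarrow> nat \<Rightarrow> real" where "V c \<equiv> \<lambda>k. snd (shoot (start c) k)"

lemma orbit_UV: "orbit (U c) (V c)"
  by (rule orbit_shoot)

lemma initial_UV: "0 \<le> c \<Longrightarrow> initial (U c) (V c)"
  by (auto simp: initial_def start_def)

lemma continuous_UV: "continuous_on UNIV (\<lambda>c. U c k)" "continuous_on UNIV (\<lambda>c. V c k)"
proof -
  have "continuous_on UNIV start"
    unfolding start_def by (cases neumann) (auto intro!: continuous_intros)
  from continuous_shoot[OF g_cont this, of k]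
  show "continuous_on UNIV (\<lambda>c. U c k)" "continuous_on UNIV (\<lambda>c. V c k)"
    by (auto intro!: continuous_intros)
qed

lemma continuous_top_on: "i \<in> {1..m} \<Longrightarrow> continuous_on UNIV (\<lambda>c. top_on i (U c))"
  using s_le_q[of i] by (intro continuous_on_Max_image continuous_UV) auto

lemma continuous_final: "continuous_on UNIV (\<lambda>c. final (U c) (V c))"
  using continuous_UV unfolding final_def by (cases neumann) auto

text \<open>The two kinds of end points after \<open>i\<close> humps: \<open>sunk\<close> concerns
  the whole remaining orbit, \<open>overshoots\<close> only the next hump, or \<open>final\<close>
  when none is left. As \<open>q 0 = 0\<close>, \<open>sunk 0\<close> covers the orbit from its
  start.\<close>

definition sunk :: "nat \<Rightarrow> real \<Rightarrow> bool" where
  "sunk i c \<longleftrightarrow> (\<forall>k\<ge>q i. U c k \<le> 0 \<and> V c k \<le> 0)"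

definition overshoots :: "nat \<Rightarrow> real \<Rightarrow> bool" where
  "overshoots i c \<longleftrightarrow> (if i < m then R < top_on (Suc i) (U c) else 0 < final (U c) (V c))"

lemma sunk_mono: "sunk i c \<Longrightarrow> i < m \<Longrightarrow> sunk (Suc i) c"
  using q_mono[of i "Suc i"] by (auto simp: sunk_def)

lemma sunk_top_on:
  assumes "sunk i c" "i < m" shows "top_on (Suc i) (U c) \<le> 0"
  using assms q_le_s[of i] by (subst top_on_le_iff) (auto simp: sunk_def)

text \<open>By \<open>no_hump\<close> a hump of height 1 or 2 cannot stay nonnegative up to
  \<open>q (Suc i)\<close>, and an orbit below 0 never returns.\<close>

lemma sunk_of_hump:
  assumes i: "Suc i \<le> m" and c: "0 \<le> c" and top: "top_on (Suc i) (U c) = \<rho>" and rho: "\<rho> \<in> {1, 2}"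
  shows "sunk (Suc i) c"
proof -
  have I: "Suc i \<in> {1..m}" using i by auto
  obtain p where p: "p \<in> {s (Suc i)..q (Suc i)}" "U c p = \<rho>" using top_on_attained[OF I, of "U c"] top by metis
  have "\<exists>k\<in>{s (Suc i)..q (Suc i)}. U c k < 0"
  proof (rule ccontr)
    assume "\<not> ?thesis"
    then have "0 \<le> U c k \<and> U c k \<le> \<rho>" if "k \<in> {s (Suc i)..q (Suc i)}" for k
      using le_top_on[OF that, of "U c"] top that by (auto simp: not_less)
    from no_hump[OF orbit_UV I rho this] p show False by blast
  qed
  then obtain k where "k \<le> q (Suc i)" "U c k < 0" by auto
  moreover have "0 \<le> U c 0" using c by (auto simp: start_def)
  ultimately show ?thesis
    unfolding sunk_def using below_stays[OF orbit_UV] by (meson le_trans less_imp_le)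
qed

lemma overshoots_of_level:
  assumes i: "i < m" and c: "0 \<le> c" and x: "x \<in> {r1, r2, R}"
    and top: "top_on (Suc i) (U c) = x" and prev: "1 \<le> i \<Longrightarrow> top_on i (U c) \<le> R"
  shows "overshoots (Suc i) c"
proof -
  note lc = level_crossing[OF orbit_UV initial_UV[OF c] i x top prev]
  have "U c (q (Suc i)) \<le> R"
    using le_top_on[of "q (Suc i)" "Suc i" "U c"] s_le_q[of "Suc i"] i top pos_levels[OF x] by auto
  moreover have "0 < V c (q m)" if "Suc i = m" "t (q m) = t (s (Suc m))"
  proof -
    \<comment> \<open>The exceptional case of \<open>level_crossing\<close> together with a
      degenerate last interval would leave no negativity interval at all when \<open>m = 1\<close>,
      against \<open>some\<close>.\<close>
    have "\<not> (i = 0 \<and> t (q 0) = t (s 1))"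
    proof
      assume "i = 0 \<and> t (q 0) = t (s 1)"
      then have "m = Suc 0" "t (q 0) = t (s 1)" using that by auto
      with some that show False by (auto simp: le_Suc_eq)
    qed
    with lc(3) that show ?thesis by auto
  qed
  ultimately show ?thesis
    unfolding overshoots_def using i by (intro after_level_crossing[OF orbit_UV _ _ x lc(1) _ lc(2)]) simp_all
qed

text \<open>One bound serves both problems: a Neumann orbit starts above \<open>R\<close>, a
  Dirichlet orbit with a slope above \<open>L\<close>. Neither loses anything on the first
  negativity interval.\<close>

lemma overshoots_at_end: "overshoots 0 (R + L + 1)"
proof -
  let ?c = "R + L + 1"
  have pos: "0 < L" "0 < R" using L_pos R_pos by auto
  then have c: "0 \<le> ?c" by auto
  have o1: "1 \<in> {1..m}" using m by auto
  have "R < top_on 1 (U ?c)"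
  proof (cases neumann)
    case True
    with pos have "R < U ?c 0" unfolding start_def by simp
    also have "\<dots> \<le> U ?c (s 1)" using initial_block(3)[OF orbit_UV initial_UV[OF c], of "s 1"] by simp
    also have "\<dots> \<le> top_on 1 (U ?c)" using s_le_q[OF o1] by (intro le_top_on) auto
    finally show ?thesis .
  next
    case False
    with pos have "L \<le> V ?c 0" unfolding start_def by simp
    also have "\<dots> \<le> V ?c (s 1)" using initial_block(1)[OF orbit_UV initial_UV[OF c], of "s 1"] by simp
    finally show ?thesis
      using initial_block(3)[OF orbit_UV initial_UV[OF c], of "s 1"] c
      by (intro steep_start_exceeds[OF orbit_UV o1]) (auto simp: start_def split: if_splits)
  qed
  then show ?thesis using m by (auto simp: overshoots_def)
qed

text \<open>At \<open>r1, r2, R\<close> the orbits overshoot and at \<open>0, 1, 2\<close> they sink, so each of the three ranges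
  is crossed between one end of each kind.\<close>

lemma pattern_segment:
  assumes "i \<le> m"
  shows "\<exists>x y. closed_segment x y \<subseteq> {0..R + L + 1} \<and>
     (\<forall>c\<in>closed_segment x y. \<forall>j\<in>{1..i}. top_on j (U c) \<in> pattern_range r1 r2 R (p j)) \<and>
     sunk i x \<and> overshoots i y"
  using assms
proof (induction i)
  case 0
  have "0 < L" "0 < R" using L_pos R_pos by auto
  then have "closed_segment 0 (R + L + 1) \<subseteq> {0..R + L + 1}" by (auto simp: closed_segment_eq_real_ivl)
  moreover have "sunk 0 0"
    using sink[OF orbit_UV, of 0 0] unfolding sunk_def by (auto simp: start_def)
  ultimately show ?case using overshoots_at_end by force
next
  case (Suc i)
  then obtain x y where seg: "closed_segment x y \<subseteq> {0..R + L + 1}"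
    and pat: "\<And>c j. c \<in> closed_segment x y \<Longrightarrow> j \<in> {1..i} \<Longrightarrow> top_on j (U c) \<in> pattern_range r1 r2 R (p j)"
    and x: "sunk i x" and y: "overshoots i y" by fastforce
  let ?f = "\<lambda>c. top_on (Suc i) (U c)"
  have im: "i < m" using Suc.prems by auto
  have f: "continuous_on UNIV ?f" using im by (intro continuous_top_on) auto
  have fx: "?f x \<le> 0" using sunk_top_on[OF x im] .
  have fy: "R < ?f y" using y im by (simp add: overshoots_def)
  have prev: "top_on i (U c) \<le> R" if "c \<in> closed_segment x y" "1 \<le> i" for c
    using pat[OF that(1), of i] that(2) levels by (auto simp: pattern_range_def split: if_splits)
  have over: "overshoots (Suc i) c" if "c \<in> closed_segment x y" "?f c \<in> {r1, r2, R}" for c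
    using overshoots_of_level[OF im _ that(2) refl prev[OF that(1)]] seg that(1) by auto
  have sunk: "sunk (Suc i) c" if "c \<in> closed_segment x y" "?f c \<in> {1, 2}" for c
    using sunk_of_hump[OF _ _ refl that(2)] im seg that(1) by auto
  have "\<exists>x' y'. closed_segment x' y' \<subseteq> closed_segment x y \<and> sunk (Suc i) x' \<and> overshoots (Suc i) y' \<and>
     (\<forall>c\<in>closed_segment x' y'. ?f c \<in> pattern_range r1 r2 R (p (Suc i)))"
  proof -
    consider "p (Suc i) = 0" | "p (Suc i) = 1" | "p (Suc i) \<noteq> 0" "p (Suc i) \<noteq> 1" by blast
    then show ?thesis
    proof cases
      case 1
      \<comment> \<open>The sinking end is kept; up to the first crossing of \<open>r1\<close> the
        maximum stays in the lowest range.\<close>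
      obtain y' where y': "y' \<in> closed_segment x y" "?f y' = r1" "\<And>c. c \<in> closed_segment x y' \<Longrightarrow> ?f c \<le> r1"
        using first_crossing[OF f, of x r1 y] fx fy levels by auto
      have "closed_segment x y' \<subseteq> closed_segment x y" using y'(1) by (simp add: subset_closed_segment)
      then show ?thesis
        using sunk_mono[OF x im] over[OF y'(1)] y' 1 by (intro exI[of _ x] exI[of _ y']) (auto simp: pattern_range_def)
    next
      case 2
      \<comment> \<open>The orientation is reversed here: the end at the lower value
        \<open>r2\<close> overshoots and the end at 1 sinks.\<close>
      obtain y' x' where yx: "closed_segment y' x' \<subseteq> closed_segment x y" "?f y' = r2" "?f x' = 1"
        "\<And>c. c \<in> closed_segment y' x' \<Longrightarrow> r2 \<le> ?f c \<and> ?f c \<le> 1"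
        using crossing_segment[OF f, of x r2 1 y] fx fy levels by auto
      have "x' \<in> closed_segment x y" "y' \<in> closed_segment x y" using yx(1) by auto
      then show ?thesis
        using sunk[of x'] over[of y'] yx 2
        by (intro exI[of _ x'] exI[of _ y']) (auto simp: pattern_range_def closed_segment_commute[of x' y'])
    next
      case 3
      obtain x' y' where xy: "closed_segment x' y' \<subseteq> closed_segment x y" "?f x' = 2" "?f y' = R"
        "\<And>c. c \<in> closed_segment x' y' \<Longrightarrow> 2 \<le> ?f c \<and> ?f c \<le> R"
        using crossing_segment[OF f, of x 2 R y] fx fy levels by auto
      have "x' \<in> closed_segment x y" "y' \<in> closed_segment x y" using xy(1) by auto
      then show ?thesis
        using sunk[of x'] over[of y'] xy 3
        by (intro exI[of _ x'] exI[of _ y']) (auto simp: pattern_range_def)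
    qed
  qed
  then obtain x' y' where xy: "closed_segment x' y' \<subseteq> closed_segment x y" "sunk (Suc i) x'" "overshoots (Suc i) y'"
     "\<And>c. c \<in> closed_segment x' y' \<Longrightarrow> ?f c \<in> pattern_range r1 r2 R (p (Suc i))" by blast
  have "top_on j (U c) \<in> pattern_range r1 r2 R (p j)" if "c \<in> closed_segment x' y'" "j \<in> {1..Suc i}" for c j
    using that xy(1,4) pat[of c j] by (cases "j = Suc i") auto
  with xy seg show ?case by blast
qed

text \<open>After the last hump \<open>final\<close> is nonpositive at the sinking end and positive
  at the overshooting end; a zero in between meets the condition at \<open>T\<close>.\<close>

lemma kicked_pattern:
  "\<exists>c u v. 0 \<le> c \<and> c \<le> R + L + 1 \<and> orbit u v \<and> (u 0, v 0) = start c \<and> final u v = 0 \<and>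
     (\<forall>i\<in>{1..m}. top_on i u \<in> pattern_range r1 r2 R (p i)) \<and> (\<forall>k\<le>s (Suc m). 0 \<le> u k \<and> u k \<le> R)"
proof -
  obtain x y where xy: "closed_segment x y \<subseteq> {0..R + L + 1}"
    "\<And>c j. c \<in> closed_segment x y \<Longrightarrow> j \<in> {1..m} \<Longrightarrow> top_on j (U c) \<in> pattern_range r1 r2 R (p j)"
    "sunk m x" "overshoots m y"
    using pattern_segment[of m p] by blast
  have "final (U x) (V x) \<le> 0" "0 \<le> final (U y) (V y)"
    using xy(3,4) q_le_s[of m] by (auto simp: sunk_def overshoots_def final_def)
  from first_crossing[OF continuous_final this] obtain c
    where c: "c \<in> closed_segment x y" "final (U c) (V c) = 0" by auto
  have c0: "0 \<le> c" "c \<le> R + L + 1" using c xy(1) by auto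
  have top: "top_on i (U c) \<le> R" if "i \<in> {1..m}" for i
    using xy(2)[OF c(1) that] levels by (auto simp: pattern_range_def split: if_splits)
  show ?thesis
    using c0 c xy(2) bounds_of_final_zero[OF orbit_UV initial_UV[OF c0(1)] c(2) top] orbit_UV[of c]
    by (intro exI[of _ c] exI[of _ "U c"] exI[of _ "V c"]) (auto simp del: shoot.simps(2))
qed

end

section \<open>Indefinite integrals\<close>

lemma integral_between:
  fixes f :: "real \<Rightarrow> real"
  assumes "f integrable_on {a..b}" "x \<in> {a..b}" "y \<in> {a..b}" "x \<le> y"
  shows "integral {a..y} f - integral {a..x} f = integral {x..y} f"
proof -
  have "integral {a..x} f + integral {x..y} f = integral {a..y} f"
    using assms by (intro Henstock_Kurzweil_Integration.integral_combine) (auto intro: integrable_subinterval_real)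
  then show ?thesis by simp
qed

text \<open>The core of Lebesgue's differentiation theorem: by Henstock's lemma the intervals on which
  \<open>f x * (y - x)\<close> is a bad approximation of the integral have small total length as soon as
  they are disjoint, and Vitali's covering theorem reduces to disjoint intervals.\<close>

lemma negligible_bad_points:
  fixes f :: "real \<Rightarrow> real"
  assumes f: "f integrable_on {a..b}" and c: "0 < c"
  defines "F \<equiv> \<lambda>x. integral {a..x} f"
  shows "negligible {x\<in>{a..b}. \<forall>d>0. \<exists>y\<in>{a..b}. 0 < \<bar>y - x\<bar> \<and> \<bar>y - x\<bar> < d \<and>
           c * \<bar>y - x\<bar> < \<bar>F y - F x - f x * (y - x)\<bar>}" (is "negligible ?S")
  unfolding negligible_outer_le
proof (intro allI impI)
  fix e :: real assume e: "0 < e"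
  then have ce: "0 < c * e" using c by simp
  from f have "f integrable_on cbox a b" by simp
  from Henstock_lemma[OF this ce] obtain \<gamma> where \<gamma>: "gauge \<gamma>" and hen:
    "\<And>p. p tagged_partial_division_of cbox a b \<Longrightarrow> \<gamma> fine p \<Longrightarrow>
       (\<Sum>(x, k)\<in>p. norm (measure lborel k *\<^sub>R f x - integral k f)) < c * e" by blast
  \<comment> \<open>\<open>y\<close> may lie on either side of the tag \<open>x\<close>, so the
    interval is formed from an unordered pair.\<close>
  define I where "I = (\<lambda>(x, y). {min x y..max x (y::real)})"
  define K where "K = {(x, y). x \<in> ?S \<and> y \<in> {a..b} \<and> 0 < \<bar>y - x\<bar> \<and> I (x, y) \<subseteq> \<gamma> x \<and>
      c * \<bar>y - x\<bar> < \<bar>F y - F x - f x * (y - x)\<bar>}"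
  \<comment> \<open>The covering theorem is about balls, so an interval is viewed as the ball around
    its midpoint.\<close>
  have I_cball: "cball ((fst p + snd p) / 2) (\<bar>snd p - fst p\<bar> / 2) = I p" for p
    by (cases p) (auto simp: I_def cball_eq_atLeastAtMost field_simps min_def max_def abs_if)
  have cover: "\<exists>p. p \<in> K \<and> x \<in> cball ((fst p + snd p) / 2) (\<bar>snd p - fst p\<bar> / 2) \<and> \<bar>snd p - fst p\<bar> / 2 < d"
    if x: "x \<in> ?S" and d: "0 < d" for x d
  proof -
    have "open (\<gamma> x)" "x \<in> \<gamma> x" using \<gamma> by (auto simp: gauge_def)
    then obtain r where r: "0 < r" "ball x r \<subseteq> \<gamma> x" by (meson openE)
    have "0 < min r d" using r d by auto
    with x obtain y where y: "y \<in> {a..b}" "0 < \<bar>y - x\<bar>" "\<bar>y - x\<bar> < min r d"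
      "c * \<bar>y - x\<bar> < \<bar>F y - F x - f x * (y - x)\<bar>" by blast
    have "I (x, y) \<subseteq> ball x r" using y by (auto simp: I_def dist_real_def)
    then have "(x, y) \<in> K" using x y r unfolding K_def by auto
    moreover have "x \<in> I (x, y)" by (auto simp: I_def)
    ultimately show ?thesis using y by (intro exI[of _ "(x, y)"]) (auto simp: I_cball[of "(x, y)", simplified])
  qed
  have K_pos: "\<And>p. p \<in> K \<Longrightarrow> 0 < \<bar>snd p - fst p\<bar> / 2" by (auto simp: K_def)
  obtain C where C: "countable C" "C \<subseteq> K" "pairwise (\<lambda>i j. disjnt (I i) (I j)) C"
    "negligible (?S - (\<Union>i\<in>C. I i))"
    by (rule Vitali_covering_theorem_cballs[where a = "\<lambda>p. (fst p + snd p) / 2"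
          and r = "\<lambda>p. \<bar>snd p - fst p\<bar> / 2" and S = ?S, OF K_pos cover]) (auto simp: I_cball)
  \<comment> \<open>Henstock's bound \<open>c * e\<close> applies to every finite disjoint
    subfamily; as each bad interval contributes at least \<open>c\<close> times its length, the
    total length is at most \<open>e\<close>.\<close>
  have bound: "measure lebesgue (\<Union>i\<in>D. I i) \<le> e" if D: "D \<subseteq> C" "finite D" for D
  proof -
    define p where "p = (\<lambda>z. (fst z, I z)) ` D"
    have DK: "\<And>x y. (x, y) \<in> D \<Longrightarrow> (x, y) \<in> K" using D C by auto
    have inj: "inj_on (\<lambda>z. (fst z, I z)) D"
    proof (rule inj_onI)
      fix z w assume z: "z \<in> D" "w \<in> D" "(fst z, I z) = (fst w, I w)"
      then have "\<not> disjnt (I z) (I w)" by (cases w) (auto simp: disjnt_def I_def)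
      with z C(3) D show "z = w" unfolding pairwise_def by blast
    qed
    have "p tagged_partial_division_of cbox a b"
      unfolding tagged_partial_division_of_def
    proof (intro conjI allI impI)
      show "finite p" using D by (simp add: p_def)
    next
      fix x k assume "(x, k) \<in> p"
      then obtain y where xy: "(x, y) \<in> D" "k = I (x, y)" by (auto simp: p_def)
      show "x \<in> k" "k \<subseteq> cbox a b" "\<exists>u v. k = cbox u v"
        using DK[OF xy(1)] xy(2) by (auto simp: K_def I_def)
    next
      fix x k x' k' assume h: "(x, k) \<in> p \<and> (x', k') \<in> p \<and> (x, k) \<noteq> (x', k')"
      then obtain z w where zw: "z \<in> D" "w \<in> D" "k = I z" "k' = I w" "z \<noteq> w" by (auto simp: p_def)
      then have "k \<inter> k' = {}" using C(3) D by (auto simp: pairwise_def disjnt_def)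
      then show "interior k \<inter> interior k' = {}" using interior_subset by blast
    qed
    moreover have "\<gamma> fine p" using DK by (fastforce simp: fine_def p_def K_def)
    ultimately have lt: "(\<Sum>(x, k)\<in>p. norm (measure lborel k *\<^sub>R f x - integral k f)) < c * e" by (rule hen)
    have "c * measure lebesgue (I z) \<le> norm (measure lborel (I z) *\<^sub>R f (fst z) - integral (I z) f)" if z: "z \<in> D" for z
    proof -
      obtain x y where xy: "z = (x, y)" by (cases z)
      with DK z have k: "(x, y) \<in> K" by auto
      show ?thesis
      proof (cases "x \<le> y")
        case True
        then have I: "I z = {x..y}" by (auto simp: I_def xy)
        have "F y - F x = integral {x..y} f" unfolding F_def
          using k True by (intro integral_between[OF f]) (auto simp: K_def)
        then have "F y - F x - f x * (y - x) = - (measure lborel {x..y} *\<^sub>R f x - integral {x..y} f)"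
          using True by (simp add: algebra_simps)
        moreover have "c * \<bar>y - x\<bar> < \<bar>F y - F x - f x * (y - x)\<bar>" using k by (simp add: K_def)
        ultimately have "c * \<bar>y - x\<bar> < \<bar>measure lborel {x..y} *\<^sub>R f x - integral {x..y} f\<bar>"
          by (metis abs_minus_cancel)
        then show ?thesis using True unfolding I by (simp add: xy)
      next
        case False
        then have I: "I z = {y..x}" by (auto simp: I_def xy)
        have "F x - F y = integral {y..x} f" unfolding F_def
          using k False by (intro integral_between[OF f]) (auto simp: K_def)
        then have "F y - F x - f x * (y - x) = measure lborel {y..x} *\<^sub>R f x - integral {y..x} f"
          using False by (simp add: algebra_simps)
        moreover have "c * \<bar>y - x\<bar> < \<bar>F y - F x - f x * (y - x)\<bar>" using k by (simp add: K_def)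
        ultimately have "c * \<bar>y - x\<bar> < \<bar>measure lborel {y..x} *\<^sub>R f x - integral {y..x} f\<bar>" by metis
        then show ?thesis using False unfolding I by (simp add: xy)
      qed
    qed
    then have "c * (\<Sum>z\<in>D. measure lebesgue (I z)) \<le> (\<Sum>z\<in>D. norm (measure lborel (I z) *\<^sub>R f (fst z) - integral (I z) f))"
      unfolding sum_distrib_left by (rule sum_mono)
    also have "\<dots> = (\<Sum>(x, k)\<in>p. norm (measure lborel k *\<^sub>R f x - integral k f))"
      unfolding p_def by (subst sum.reindex[OF inj]) simp
    finally have "c * (\<Sum>z\<in>D. measure lebesgue (I z)) < c * e" using lt by simp
    then have "(\<Sum>z\<in>D. measure lebesgue (I z)) \<le> e" using c by simp
    moreover have "measure lebesgue (\<Union>i\<in>D. I i) \<le> (\<Sum>z\<in>D. measure lebesgue (I z))"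
      by (rule measure_UNION_le) (use D in \<open>auto simp: I_def\<close>)
    ultimately show ?thesis by simp
  qed
  have meas: "I i \<in> lmeasurable" for i by (cases i) (auto simp: I_def)
  let ?N = "?S - (\<Union>i\<in>C. I i)" and ?U = "\<Union>i\<in>C. I i"
  have U: "?U \<in> lmeasurable" "measure lebesgue ?U \<le> e"
    using fmeasurable_UN_bound[OF C(1) meas bound] measure_UN_bound[OF C(1) meas bound] by auto
  have N: "?N \<in> lmeasurable" "measure lebesgue ?N = 0"
    using C(4) by (auto intro: negligible_imp_measurable negligible_imp_measure0)
  have "measure lebesgue (?N \<union> ?U) \<le> measure lebesgue ?N + measure lebesgue ?U"
    using U N by (intro measure_Un_le) auto
  moreover have "?N \<union> ?U \<in> lmeasurable" using U N by (intro fmeasurable.Un)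
  ultimately show "\<exists>T. ?S \<subseteq> T \<and> T \<in> lmeasurable \<and> measure lebesgue T \<le> e"
    using U(2) N(2) by (intro exI[of _ "?N \<union> ?U"] conjI) (blast, assumption, linarith)
qed

text \<open>Outside the bad points for all the constants \<open>c = 1 / (n + 1)\<close> the
  difference quotients converge to \<open>f x\<close>, and a countable union of negligible sets is
  negligible.\<close>

lemma indefinite_integral_has_derivative_ae:
  fixes f :: "real \<Rightarrow> real"
  assumes f: "f integrable_on {a..b}"
  shows "AE x in lebesgue_on {a..b}.
    ((\<lambda>x. integral {a..x} f) has_real_derivative f x) (at x within {a..b})"
proof -
  define F where "F = (\<lambda>x. integral {a..x} f)"
  define S where "S n = {x\<in>{a..b}. \<forall>d>0. \<exists>y\<in>{a..b}. 0 < \<bar>y - x\<bar> \<and> \<bar>y - x\<bar> < d \<and>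
           inverse (real (Suc n)) * \<bar>y - x\<bar> < \<bar>F y - F x - f x * (y - x)\<bar>}" for n
  have "negligible (\<Union>n. S n)"
    unfolding S_def F_def by (intro negligible_Union_nat negligible_bad_points[OF f]) auto
  then have ae: "AE x in lebesgue. x \<notin> (\<Union>n. S n)"
    unfolding negligible_iff_null_sets by (rule AE_not_in)
  have der: "(F has_real_derivative f x) (at x within {a..b})" if x: "x \<in> {a..b}" "x \<notin> (\<Union>n. S n)" for x
    unfolding has_field_derivative_def has_derivative_within_alt2
  proof (intro conjI allI impI)
    show "bounded_linear ((*) (f x))" by (rule bounded_linear_mult_right)
    fix e :: real assume "0 < e"
    then obtain n where n: "inverse (real (Suc n)) < e" using reals_Archimedean by blast
    from x have "x \<notin> S n" by auto
    with x(1) obtain d where d: "0 < d" "\<And>y. y \<in> {a..b} \<Longrightarrow> 0 < \<bar>y - x\<bar> \<Longrightarrow> \<bar>y - x\<bar> < d \<Longrightarrow>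
       \<bar>F y - F x - f x * (y - x)\<bar> \<le> inverse (real (Suc n)) * \<bar>y - x\<bar>"
      unfolding S_def by (force simp: not_less)
    have "norm (F y - F x - f x * (y - x)) \<le> e * norm (y - x)" if "y \<in> {a..b}" "norm (y - x) < d" for y
    proof (cases "y = x")
      case False
      have "\<bar>F y - F x - f x * (y - x)\<bar> \<le> inverse (real (Suc n)) * \<bar>y - x\<bar>"
        using d(2)[of y] that False by auto
      also have "\<dots> \<le> e * \<bar>y - x\<bar>" using n by (intro mult_right_mono) auto
      finally show ?thesis by simp
    qed simp
    then show "\<forall>\<^sub>F y in at x within {a..b}. norm (F y - F x - f x * (y - x)) \<le> e * norm (y - x)"
      using d(1) unfolding eventually_at by (auto simp: dist_norm)
  qed
  show ?thesis
    unfolding F_def[symmetric]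
  proof (subst AE_restrict_space_iff)
    show "AE x in lebesgue. x \<in> {a..b} \<longrightarrow> (F has_real_derivative f x) (at x within {a..b})"
      using ae by eventually_elim (use der in blast)
  qed auto
qed

text \<open>Truncation: \<open>\<bar>f x\<bar>\<close> is at most \<open>h n x + n\<close>, where
  \<open>h n\<close> is the excess over \<open>n\<close>. Dominated convergence makes the integral
  of \<open>h n\<close> small, which bounds its share on every family of disjoint intervals; the
  bounded part contributes at most \<open>n\<close> times their total length.\<close>

lemma absolutely_continuous_indefinite_integral:
  fixes f :: "real \<Rightarrow> real"
  assumes f: "f absolutely_integrable_on {a..b}"
  shows "absolutely_continuous_fun_on {a..b} (\<lambda>x. integral {a..x} f)"
  unfolding absolutely_continuous_fun_on_def
proof (intro allI impI)
  fix e :: real assume e: "0 < e"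
  define h where "h n x = max (\<bar>f x\<bar> - real n) 0" for n x
  have fi: "f integrable_on {a..b}" "(\<lambda>x. \<bar>f x\<bar>) integrable_on {a..b}"
    using f by (auto simp: absolutely_integrable_on_def)
  have h_abs: "h n absolutely_integrable_on {a..b}" for n
  proof -
    have "(\<lambda>x. \<bar>f x\<bar> - real n) absolutely_integrable_on {a..b}"
      using absolutely_integrable_norm[OF f] by (intro set_integral_diff(1)) (auto simp: o_def)
    then show ?thesis unfolding h_def
      by (intro absolutely_integrable_max_1) auto
  qed
  have hi: "h n integrable_on {a..b}" for n using h_abs set_lebesgue_integral_eq_integral(1) by blast
  have "(\<lambda>n. integral {a..b} (h n)) \<longlonglongrightarrow> integral {a..b} (\<lambda>x. 0)"
  proof (rule dominated_convergence(2)[OF hi fi(2)])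
    fix x
    show "(\<lambda>n. h n x) \<longlonglongrightarrow> 0"
    proof (rule tendsto_eventually)
      obtain N where "\<bar>f x\<bar> \<le> real N" using real_arch_simple by blast
      then show "\<forall>\<^sub>F n in sequentially. h n x = 0"
        unfolding h_def by (intro eventually_sequentiallyI[of N]) auto
    qed
  qed (auto simp: h_def)
  then have "\<forall>\<^sub>F n in sequentially. integral {a..b} (h n) < e / 2"
    using e by (intro order_tendstoD(2)[where y = "integral {a..b} (\<lambda>x. 0)"]) auto
  then obtain n where n: "integral {a..b} (h n) < e / 2" by (auto simp: eventually_sequentially)
  have h0: "0 \<le> h n x" for x by (simp add: h_def)
  show "\<exists>\<delta>>0. \<forall>P. finite P \<longrightarrow> (\<forall>(x, y)\<in>P. x \<le> y \<and> {x..y} \<subseteq> {a..b}) \<longrightarrow>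
     disjoint_family_on (\<lambda>(x, y). {x<..<y}) P \<longrightarrow> (\<Sum>(x, y)\<in>P. y - x) < \<delta> \<longrightarrow>
     (\<Sum>(x, y)\<in>P. \<bar>integral {a..y} f - integral {a..x} f\<bar>) < e"
  proof (intro exI[of _ "e / (2 * (real n + 1))"] conjI allI impI)
    show "0 < e / (2 * (real n + 1))" using e by (simp add: add_nonneg_pos)
    fix P :: "(real \<times> real) set"
    assume P: "finite P" "\<forall>(x, y)\<in>P. x \<le> y \<and> {x..y} \<subseteq> {a..b}" "disjoint_family_on (\<lambda>(x, y). {x<..<y}) P"
      "(\<Sum>(x, y)\<in>P. y - x) < e / (2 * (real n + 1))"
    \<comment> \<open>The given intervals may share end points; only their interiors are disjoint,
      so indicators of open intervals are summed.\<close>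
    have ind: "(\<lambda>t. indicator {x<..<y} t * h n t) integrable_on {a..b}"
       "integral {x..y} (h n) = integral {a..b} (\<lambda>t. indicator {x<..<y} t * h n t)" if "(x, y) \<in> P" for x y
    proof -
      have sub: "{x<..<y} \<subseteq> {a..b}" using P(2) that by fastforce
      have "((\<lambda>t. indicator {x<..<y} t * h n t) has_integral integral {x..y} (h n)) {a..b}"
      proof -
        have "h n integrable_on {x..y}" using P(2) that by (intro integrable_subinterval_real[OF hi]) auto
        then have "(h n has_integral integral {x..y} (h n)) {x<..<y}"
          using has_integral_open_interval[of "h n" _ x y] by (simp add: integrable_integral)
        then have "((\<lambda>t. if t \<in> {x<..<y} then h n t else 0) has_integral integral {x..y} (h n)) {a..b}"
          using sub by (subst has_integral_restrict) auto
        then show ?thesis by (rule has_integral_eq[rotated]) auto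
      qed
      then show "(\<lambda>t. indicator {x<..<y} t * h n t) integrable_on {a..b}"
       "integral {x..y} (h n) = integral {a..b} (\<lambda>t. indicator {x<..<y} t * h n t)"
        by (auto simp: integral_unique)
    qed
    have bound: "\<bar>integral {a..y} f - integral {a..x} f\<bar> \<le>
       integral {a..b} (\<lambda>t. indicator {x<..<y} t * h n t) + real n * (y - x)" if xy: "(x, y) \<in> P" for x y
    proof -
      have sub: "x \<le> y" "{x..y} \<subseteq> {a..b}" using P(2) xy by auto
      have i: "f integrable_on {x..y}" "h n integrable_on {x..y}"
        using sub integrable_subinterval_real[OF fi(1)] integrable_subinterval_real[OF hi] by auto
      have "integral {a..y} f - integral {a..x} f = integral {x..y} f"
        using sub by (intro integral_between[OF fi(1)]) auto
      also have "\<bar>\<dots>\<bar> \<le> integral {x..y} (\<lambda>t. h n t + real n)"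
        using integral_norm_bound_integral[OF i(1), of "\<lambda>t. h n t + real n"]
          integrable_add[OF i(2) integrable_const_ivl[of "real n"]]
        by (auto simp: h_def)
      also have "\<dots> = integral {x..y} (h n) + real n * (y - x)"
        using i(2) sub by (subst integral_add) auto
      finally show ?thesis using ind(2)[OF xy] by simp
    qed
    have "(\<Sum>(x, y)\<in>P. \<bar>integral {a..y} f - integral {a..x} f\<bar>) \<le>
        (\<Sum>(x, y)\<in>P. integral {a..b} (\<lambda>t. indicator {x<..<y} t * h n t) + real n * (y - x))"
      using bound by (intro sum_mono) auto
    also have "\<dots> = (\<Sum>(x, y)\<in>P. integral {a..b} (\<lambda>t. indicator {x<..<y} t * h n t)) + real n * (\<Sum>(x, y)\<in>P. y - x)"
      by (simp add: sum.distrib sum_distrib_left case_prod_unfold)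
    also have "(\<Sum>(x, y)\<in>P. integral {a..b} (\<lambda>t. indicator {x<..<y} t * h n t)) =
        integral {a..b} (\<lambda>t. \<Sum>(x, y)\<in>P. indicator {x<..<y} t * h n t)"
      using ind(1) P(1) by (subst integral_sum) (auto simp: case_prod_unfold)
    also have "\<dots> \<le> integral {a..b} (h n)"
    proof (rule integral_le)
      show "(\<lambda>t. \<Sum>(x, y)\<in>P. indicator {x<..<y} t * h n t) integrable_on {a..b}"
        using ind(1) P(1) by (intro integrable_sum) (auto simp: case_prod_unfold)
      fix t
      have "(\<Sum>(x, y)\<in>P. indicator {x<..<y} t * h n t) = (\<Sum>z\<in>P. indicator ((\<lambda>(x, y). {x<..<y}) z) t) * h n t"
        by (simp add: sum_distrib_right case_prod_unfold)
      also have "\<dots> = indicator (\<Union>z\<in>P. (\<lambda>(x, y). {x<..<y}) z) t * h n t"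
        by (subst indicator_UN_disjoint[OF P(1,3)]) simp
      also have "\<dots> \<le> h n t" using h0 by (simp add: indicator_def)
      finally show "(\<Sum>(x, y)\<in>P. indicator {x<..<y} t * h n t) \<le> h n t" .
    qed (rule hi)
    also have "real n * (\<Sum>(x, y)\<in>P. y - x) \<le> real n * (e / (2 * (real n + 1)))"
      using P(4) by (intro mult_left_mono) auto
    also have "\<dots> \<le> e / 2" using e by (simp add: field_simps)
    finally show "(\<Sum>(x, y)\<in>P. \<bar>integral {a..y} f - integral {a..x} f\<bar>) < e" using n by simp
  qed
qed

section \<open>The limit of refined grids\<close>

text \<open>The common error estimate of the limit passage: it is applied to \<open>v\<close>, to
  \<open>v - w\<close> and to \<open>u\<close> minus the integral of \<open>w\<close>, each time
  with the local error of one cell as \<open>step\<close>.\<close>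

lemma telescope_integral_bound:
  fixes r t :: "nat \<Rightarrow> real" and p :: "real \<Rightarrow> real"
  assumes t: "mono t" "t 0 = 0" "t K = T" and p: "p integrable_on {0..T}"
    and step: "\<And>k. k < K \<Longrightarrow> \<bar>r (Suc k) - r k\<bar> \<le> integral {t k..t (Suc k)} p"
  shows "k \<le> K \<Longrightarrow> \<bar>r k - r 0\<bar> \<le> integral {0..t k} p"
proof (induction k)
  case (Suc k)
  have "0 \<le> t k" "t k \<le> t (Suc k)" "t (Suc k) \<le> T"
    using monoD[OF t(1), of 0 k] monoD[OF t(1), of k "Suc k"] monoD[OF t(1) Suc.prems] t by auto
  then have "integral {0..t (Suc k)} p - integral {0..t k} p = integral {t k..t (Suc k)} p"
    by (intro integral_between[OF p]) auto
  with Suc step[of k] show ?case by auto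
qed (simp add: t)

text \<open>The last node up to \<open>x\<close> will do: its successor, if there is one, lies
  beyond \<open>x\<close>, so it is within one cell of \<open>x\<close>.\<close>

lemma nodes_near:
  fixes t :: "nat \<Rightarrow> nat \<Rightarrow> real"
  assumes t: "\<And>n. mono (t n)" "\<And>n. t n 0 = 0" "\<And>n. t n (K n) = T"
    and mesh: "\<And>e. 0 < e \<Longrightarrow> \<forall>\<^sub>F n in sequentially. \<forall>k<K n. t n (Suc k) - t n k < e"
    and x: "x \<in> {0..T}"
  shows "\<exists>k. (\<forall>n. k n \<le> K n \<and> t n (k n) \<le> x) \<and> (\<lambda>n. t n (k n)) \<longlonglongrightarrow> x"
proof -
  define k where "k n = (GREATEST k. k \<le> K n \<and> t n k \<le> x)" for n
  have k: "k n \<le> K n \<and> t n (k n) \<le> x" for n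
    unfolding k_def by (rule GreatestI_nat[where k = 0 and b = "K n"]) (use x t in auto)
  have gt: "k n < K n \<Longrightarrow> x < t n (Suc (k n))" for n
    using Greatest_le_nat[of "\<lambda>k. k \<le> K n \<and> t n k \<le> x" "Suc (k n)" "K n"]
    by (auto simp: k_def[symmetric] not_le[symmetric])
  have "(\<lambda>n. t n (k n)) \<longlonglongrightarrow> x"
  proof (rule tendstoI)
    fix e :: real assume "0 < e"
    from mesh[OF this] show "\<forall>\<^sub>F n in sequentially. dist (t n (k n)) x < e"
    proof eventually_elim
      case (elim n)
      show ?case
      proof (cases "k n < K n")
        case True
        with elim gt[of n] k[of n] show ?thesis by (force simp: dist_real_def)
      next
        case False
        with k[of n] t(3)[of n] x have "t n (k n) = x" by (metis atLeastAtMost_iff antisym not_less)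
        with \<open>0 < e\<close> show ?thesis by simp
      qed
    qed
  qed
  with k show ?thesis by blast
qed

text \<open>Arzela-Ascoli needs functions on one fixed interval, whereas the orbits live on grids
  that change with \<open>n\<close>. Repeated nodes do no harm, as the Lipschitz condition forces
  equal values there.\<close>

lemma lipschitz_extension_nodes:
  fixes x y :: "nat \<Rightarrow> real"
  assumes L: "0 \<le> L" and lip: "\<And>j k. j \<le> K \<Longrightarrow> k \<le> K \<Longrightarrow> \<bar>y j - y k\<bar> \<le> L * \<bar>x j - x k\<bar>"
  obtains F :: "real \<Rightarrow> real" where "\<And>k. k \<le> K \<Longrightarrow> F (x k) = y k" "\<And>a b. \<bar>F a - F b\<bar> \<le> L * \<bar>a - b\<bar>"
proof
  \<comment> \<open>McShane's extension\<close>
  define F where "F a = Min ((\<lambda>k. y k + L * \<bar>a - x k\<bar>) ` {..K})" for a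
  show "F (x k) = y k" if "k \<le> K" for k
    unfolding F_def
  proof (rule Min_eqI)
    fix z assume "z \<in> (\<lambda>j. y j + L * \<bar>x k - x j\<bar>) ` {..K}"
    then obtain j where "j \<le> K" "z = y j + L * \<bar>x k - x j\<bar>" by auto
    with lip[OF that, of j] show "y k \<le> z" by (auto simp: abs_le_iff)
  next
    show "y k \<in> (\<lambda>j. y j + L * \<bar>x k - x j\<bar>) ` {..K}" using that by (auto intro!: image_eqI[of _ _ k])
  qed simp
  have le: "F a \<le> F b + L * \<bar>a - b\<bar>" for a b
  proof -
    have "F b \<in> (\<lambda>k. y k + L * \<bar>b - x k\<bar>) ` {..K}" unfolding F_def by (intro Min_in) auto
    then obtain k where k: "k \<le> K" "F b = y k + L * \<bar>b - x k\<bar>" by auto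
    have "F a \<le> y k + L * \<bar>a - x k\<bar>" unfolding F_def using k by (intro Min_le) auto
    also have "\<dots> \<le> y k + L * (\<bar>a - b\<bar> + \<bar>b - x k\<bar>)" using L by (intro add_left_mono mult_left_mono) auto
    finally show ?thesis using k by (simp add: algebra_simps)
  qed
  show "\<bar>F a - F b\<bar> \<le> L * \<bar>a - b\<bar>" for a b
    using le[of a b] le[of b a] by (simp add: abs_minus_commute)
qed

lemma abs_integral_le:
  fixes f p :: "real \<Rightarrow> real"
  assumes "f integrable_on {a..b}" "p integrable_on {a..b}" "\<And>x. x \<in> {a..b} \<Longrightarrow> \<bar>f x\<bar> \<le> p x"
  shows "\<bar>integral {a..b} f\<bar> \<le> integral {a..b} p"
  using integral_norm_bound_integral[OF assms(1,2)] assms(3) by simp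

text \<open>Compactness is applied to \<open>u\<close>: the slopes are bounded by \<open>C\<close>
  plus the total kick, so the orbits are equi-Lipschitz. Of the slopes only the initial values are
  extracted; \<open>w\<close> is defined by the integrated equation for the limit \<open>f\<close>,
  and \<open>v\<close> converges to it because the local errors add up to something small.\<close>

lemma kicked_limit:
  fixes h G :: "real \<Rightarrow> real" and t u v :: "nat \<Rightarrow> nat \<Rightarrow> real"
  assumes T: "0 < T" and h: "h absolutely_integrable_on {0..T}" and G: "continuous_on UNIV G"
    and t: "\<And>n. mono (t n)" "\<And>n. t n 0 = 0" "\<And>n. t n (K n) = T"
    and mesh: "\<And>e. 0 < e \<Longrightarrow> \<forall>\<^sub>F n in sequentially. \<forall>k<K n. t n (Suc k) - t n k < e"
    and v_Suc: "\<And>n k. k < K n \<Longrightarrow> v n (Suc k) = v n k - integral {t n k..t n (Suc k)} h * G (u n k)"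
    and u_Suc: "\<And>n k. k < K n \<Longrightarrow> u n (Suc k) = u n k + (t n (Suc k) - t n k) * v n (Suc k)"
    and u: "\<And>n k. k \<le> K n \<Longrightarrow> 0 \<le> u n k \<and> u n k \<le> R" and v_0: "\<And>n. \<bar>v n 0\<bar> \<le> C"
  obtains \<phi> f w where "strict_mono \<phi>" "continuous_on {0..T} f" "continuous_on {0..T} w"
    "\<And>x. x \<in> {0..T} \<Longrightarrow> w x = w 0 - integral {0..x} (\<lambda>s. h s * G (f s))"
    "\<And>x. x \<in> {0..T} \<Longrightarrow> f x = f 0 + integral {0..x} w"
    "\<And>e. 0 < e \<Longrightarrow> \<forall>\<^sub>F n in sequentially. \<forall>k\<le>K (\<phi> n).
       \<bar>u (\<phi> n) k - f (t (\<phi> n) k)\<bar> < e \<and> \<bar>v (\<phi> n) k - w (t (\<phi> n) k)\<bar> < e"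
proof -
  have R: "0 \<le> R" using u[of 0 0] by auto
  have hi: "h integrable_on {0..T}" "(\<lambda>s. \<bar>h s\<bar>) integrable_on {0..T}"
    using h by (auto simp: absolutely_integrable_on_def)
  have tT: "0 \<le> t n k" "t n k \<le> T" if "k \<le> K n" for n k
    using monoD[OF t(1)[of n], of 0 k] monoD[OF t(1)[of n] that] t(2,3)[of n] by auto
  have tS: "t n k \<le> t n (Suc k)" for n k using monoD[OF t(1)[of n], of k "Suc k"] by simp
  have sub: "p integrable_on {t n k..t n (Suc k)}" if "p integrable_on {0..T}" "k < K n" for p :: "real \<Rightarrow> real" and n k
    using that tT[of k n] tT[of "Suc k" n] by (intro integrable_subinterval_real[OF that(1)]) auto
  obtain B where B: "\<And>y. 0 \<le> y \<Longrightarrow> y \<le> R \<Longrightarrow> \<bar>G y\<bar> \<le> B"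
  proof -
    have "compact (G ` {0..R})" by (intro compact_continuous_image continuous_on_subset[OF G]) auto
    then obtain B where "\<forall>z\<in>G ` {0..R}. norm z \<le> B" by (metis bounded_iff compact_imp_bounded)
    then show ?thesis by (intro that[of B]) auto
  qed
  have B0: "0 \<le> B" using B[of 0] R by auto
  define S where "S = integral {0..T} (\<lambda>s. \<bar>h s\<bar>)"
  have S_le: "integral {0..x} (\<lambda>s. \<bar>h s\<bar>) \<le> S" if "0 \<le> x" "x \<le> T" for x
    unfolding S_def using that by (intro integral_subset_le integrable_subinterval_real[OF hi(2)] hi(2)) auto
  have S0: "0 \<le> S" unfolding S_def by (rule integral_nonneg[OF hi(2)]) auto
  define \<Lambda> where "\<Lambda> = C + B * S"
  have v_le: "\<bar>v n k\<bar> \<le> \<Lambda>" if "k \<le> K n" for n k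
  proof -
    have "\<bar>v n k - v n 0\<bar> \<le> integral {0..t n k} (\<lambda>s. B * \<bar>h s\<bar>)"
    proof (rule telescope_integral_bound[OF t(1,2,3) _ _ that])
      show "(\<lambda>s. B * \<bar>h s\<bar>) integrable_on {0..T}" using hi by (intro integrable_on_mult_right) auto
      fix k assume k: "k < K n"
      have "\<bar>integral {t n k..t n (Suc k)} h\<bar> \<le> integral {t n k..t n (Suc k)} (\<lambda>s. \<bar>h s\<bar>)"
        using k hi by (intro abs_integral_le sub) auto
      then have "\<bar>integral {t n k..t n (Suc k)} h\<bar> * \<bar>G (u n k)\<bar> \<le> integral {t n k..t n (Suc k)} (\<lambda>s. \<bar>h s\<bar>) * B"
        using B u[of k n] k by (intro mult_mono) (auto simp: integral_nonneg[OF sub[OF hi(2)]])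
      then show "\<bar>v n (Suc k) - v n k\<bar> \<le> integral {t n k..t n (Suc k)} (\<lambda>s. B * \<bar>h s\<bar>)"
        using v_Suc[OF k] by (simp add: abs_mult mult.commute)
    qed
    also have "\<dots> = B * integral {0..t n k} (\<lambda>s. \<bar>h s\<bar>)" by simp
    also have "\<dots> \<le> B * S" using S_le tT[OF that] B0 by (intro mult_left_mono) auto
    finally show ?thesis using v_0[of n] by (auto simp: \<Lambda>_def)
  qed
  have \<Lambda>: "0 \<le> \<Lambda>" using v_le[of 0 0] by auto
  have lip: "\<bar>u n k - u n j\<bar> \<le> \<Lambda> * (t n k - t n j)" if "j \<le> k" "k \<le> K n" for n j k
    using that
  proof (induction k rule: dec_induct)
    case (step k)
    have "\<bar>u n (Suc k) - u n k\<bar> = (t n (Suc k) - t n k) * \<bar>v n (Suc k)\<bar>"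
      using u_Suc[of k n] tS[of n k] step by (simp add: abs_mult)
    also have "\<dots> \<le> (t n (Suc k) - t n k) * \<Lambda>" using tS[of n k] step by (intro mult_left_mono v_le) auto
    finally show ?case using step by (auto simp: algebra_simps)
  qed simp
  have "\<exists>F. (\<forall>k\<le>K n. F (t n k) = u n k) \<and> (\<forall>a b. \<bar>F a - F b\<bar> \<le> \<Lambda> * \<bar>a - b\<bar>)" for n
  proof (rule lipschitz_extension_nodes[OF \<Lambda>])
    fix j k assume "j \<le> K n" "k \<le> K n"
    then show "\<bar>u n j - u n k\<bar> \<le> \<Lambda> * \<bar>t n j - t n k\<bar>"
      using lip[of j k n] lip[of k j n] monoD[OF t(1)[of n], of j k] monoD[OF t(1)[of n], of k j]
      by (cases "j \<le> k") (auto simp: abs_minus_commute)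
  qed blast
  then obtain F where F: "\<And>n k. k \<le> K n \<Longrightarrow> F n (t n k) = u n k"
    and F_lip: "\<And>n a b. \<bar>F n a - F n b\<bar> \<le> \<Lambda> * \<bar>a - b\<bar>" by metis
  define D where "D = R + \<Lambda> * T"
  have F_bd: "\<bar>F n x\<bar> \<le> D" if "x \<in> {0..T}" for n x
  proof -
    have "\<bar>F n x - F n 0\<bar> \<le> \<Lambda> * T" using F_lip[of n x 0] that \<Lambda> by (auto intro: order_trans mult_left_mono)
    then show ?thesis using F[of 0 n] t(2)[of n] u[of 0 n] by (auto simp: D_def)
  qed
  obtain f \<phi>1 where f: "continuous_on {0..T} f" and \<phi>1: "strict_mono (\<phi>1 :: nat \<Rightarrow> nat)"
    and unif1: "\<And>e. 0 < e \<Longrightarrow> \<exists>N. \<forall>n x. n \<ge> N \<and> x \<in> {0..T} \<longrightarrow> norm (F (\<phi>1 n) x - f x) < e"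
  proof (rule Arzela_Ascoli[of "{0..T}" F D])
    fix x e :: real assume e: "0 < e"
    have "\<bar>F n x - F n y\<bar> < e" if "\<bar>x - y\<bar> < e / (\<Lambda> + 1)" for n y
    proof -
      note F_lip[of n x y]
      also have "\<Lambda> * \<bar>x - y\<bar> \<le> (\<Lambda> + 1) * \<bar>x - y\<bar>" by (simp add: mult_right_mono)
      also have "\<dots> < e" using that \<Lambda> by (simp add: field_simps)
      finally show ?thesis .
    qed
    then show "\<exists>d>0. \<forall>n y. y \<in> {0..T} \<and> norm (x - y) < d \<longrightarrow> norm (F n x - F n y) < e"
      using e \<Lambda> by (intro exI[of _ "e / (\<Lambda> + 1)"]) auto
  qed (use F_bd in auto)
  \<comment> \<open>A second extraction makes the initial slopes converge as well.\<close>
  have "\<forall>n. v (\<phi>1 n) 0 \<in> {- C..C}" using v_0 by (auto simp: abs_le_iff minus_le_iff)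
  then obtain v0 \<phi>2 where \<phi>2: "strict_mono (\<phi>2 :: nat \<Rightarrow> nat)" and v0: "((\<lambda>n. v (\<phi>1 n) 0) \<circ> \<phi>2) \<longlonglongrightarrow> v0"
    using compact_Icc[of "- C" C] unfolding compact_def by meson
  define \<phi> where "\<phi> = \<phi>1 \<circ> \<phi>2"
  have \<phi>: "strict_mono \<phi>" unfolding \<phi>_def using \<phi>1 \<phi>2 by (rule strict_mono_o)
  have v0: "(\<lambda>n. v (\<phi> n) 0) \<longlonglongrightarrow> v0" using v0 by (simp add: \<phi>_def o_def)
  have unif: "\<forall>\<^sub>F n in sequentially. \<forall>x\<in>{0..T}. \<bar>F (\<phi> n) x - f x\<bar> < e" if e: "0 < e" for e
  proof -
    obtain N where N: "\<And>n x. N \<le> n \<Longrightarrow> x \<in> {0..T} \<Longrightarrow> norm (F (\<phi>1 n) x - f x) < e" using unif1[OF e] by blast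
    have "N \<le> \<phi>2 n" if "N \<le> n" for n using seq_suble[OF \<phi>2, of n] that by auto
    then show ?thesis using N by (intro eventually_sequentiallyI[of N]) (auto simp: \<phi>_def)
  qed
  have mesh': "\<forall>\<^sub>F n in sequentially. \<forall>k<K (\<phi> n). t (\<phi> n) (Suc k) - t (\<phi> n) k < e" if "0 < e" for e
    using eventually_subseq[OF \<phi> mesh[OF that]] .
  have f_bd: "\<bar>f x\<bar> \<le> D + 1" if x: "x \<in> {0..T}" for x
  proof -
    obtain n where "\<forall>x\<in>{0..T}. \<bar>F (\<phi> n) x - f x\<bar> < 1"
      using unif[of 1] by (auto simp: eventually_sequentially)
    with F_bd[OF x, of "\<phi> n"] x show ?thesis by fastforce
  qed
  have Gf: "continuous_on {0..T} (\<lambda>s. G (f s))" by (rule continuous_on_compose2[OF G f]) auto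
  have hGf: "(\<lambda>s. h s * G (f s)) absolutely_integrable_on {0..T}"
  proof -
    have "(\<lambda>s. G (f s) * h s) absolutely_integrable_on {0..T}"
    proof (rule absolutely_integrable_bounded_measurable_product_real[OF _ _ _ h])
      show "(\<lambda>s. G (f s)) \<in> borel_measurable (lebesgue_on {0..T})"
        by (rule continuous_imp_measurable_on_sets_lebesgue[OF Gf]) auto
      show "bounded ((\<lambda>s. G (f s)) ` {0..T})"
        by (intro compact_imp_bounded compact_continuous_image Gf) auto
    qed auto
    then show ?thesis by (simp add: mult.commute)
  qed
  then have hGfi: "(\<lambda>s. h s * G (f s)) integrable_on {0..T}" by (rule set_lebesgue_integral_eq_integral(1))
  define w where "w x = v0 - integral {0..x} (\<lambda>s. h s * G (f s))" for x
  have w: "continuous_on {0..T} w"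
    unfolding w_def by (intro continuous_intros indefinite_integral_continuous_1 hGfi)
  have wi: "w integrable_on {0..T}" using w by (rule integrable_continuous_real)
  have w_step: "w (t n (Suc k)) - w (t n k) = - integral {t n k..t n (Suc k)} (\<lambda>s. h s * G (f s))" if "k < K n" for n k
    using integral_between[OF hGfi, of "t n k" "t n (Suc k)"] tT[of k n] tT[of "Suc k" n] tS[of n k] that
    by (simp add: w_def)
  have v_unif: "\<forall>\<^sub>F n in sequentially. \<forall>k\<le>K (\<phi> n). \<bar>v (\<phi> n) k - w (t (\<phi> n) k)\<bar> < e" if e: "0 < e" for e
  proof -
    \<comment> \<open>The summand 1 guards against \<open>S = 0\<close>.\<close>
    define \<epsilon> where "\<epsilon> = e / (2 * (S + 1))"
    have eps: "0 < \<epsilon>" "\<epsilon> * S < e / 2" using e S0 by (auto simp: \<epsilon>_def field_simps add_nonneg_pos)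
    have "uniformly_continuous_on {- (D + 1)..D + 1} G"
      by (intro compact_uniformly_continuous continuous_on_subset[OF G]) auto
    then obtain d where d: "0 < d" "\<And>y z. \<bar>y\<bar> \<le> D + 1 \<Longrightarrow> \<bar>z\<bar> \<le> D + 1 \<Longrightarrow> \<bar>y - z\<bar> < d \<Longrightarrow> \<bar>G y - G z\<bar> < \<epsilon>"
      unfolding uniformly_continuous_on_def using eps(1)
      by (metis abs_le_iff atLeastAtMost_iff dist_real_def minus_le_iff)
    \<comment> \<open>Half of \<open>d\<close> bounds the variation of \<open>F (\<phi> n)\<close>
      within one cell, the other half its distance from \<open>f\<close>.\<close>
    have d': "0 < d / 2 / (\<Lambda> + 1)" using d \<Lambda> by auto
    have "\<forall>\<^sub>F n in sequentially. \<bar>v (\<phi> n) 0 - v0\<bar> < e / 2"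
      using tendstoD[OF v0, of "e / 2"] e by (simp add: dist_real_def)
    then show ?thesis using unif[OF half_gt_zero[OF d(1)]] mesh'[OF d']
    proof (eventually_elim, intro allI impI)
      fix n k assume a: "\<bar>v (\<phi> n) 0 - v0\<bar> < e / 2" and b: "\<forall>x\<in>{0..T}. \<bar>F (\<phi> n) x - f x\<bar> < d / 2"
        and c: "\<forall>k<K (\<phi> n). t (\<phi> n) (Suc k) - t (\<phi> n) k < d / 2 / (\<Lambda> + 1)" and k: "k \<le> K (\<phi> n)"
      let ?t = "t (\<phi> n)"
      have "\<bar>(v (\<phi> n) k - w (?t k)) - (v (\<phi> n) 0 - w (?t 0))\<bar> \<le> integral {0..?t k} (\<lambda>s. \<epsilon> * \<bar>h s\<bar>)"
      proof (rule telescope_integral_bound[OF t(1,2,3) _ _ k])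
        show "(\<lambda>s. \<epsilon> * \<bar>h s\<bar>) integrable_on {0..T}" using hi by (intro integrable_on_mult_right) auto
        fix j assume j: "j < K (\<phi> n)"
        let ?I = "{?t j..?t (Suc j)}"
        have I: "?I \<subseteq> {0..T}" using j tT[of j "\<phi> n"] tT[of "Suc j" "\<phi> n"] by auto
        have close: "\<bar>G (f s) - G (u (\<phi> n) j)\<bar> < \<epsilon>" if s: "s \<in> ?I" for s
        proof (rule d(2))
          show "\<bar>f s\<bar> \<le> D + 1" using s I by (intro f_bd) auto
          show "\<bar>u (\<phi> n) j\<bar> \<le> D + 1" using u[of j "\<phi> n"] j \<Lambda> T by (auto simp: D_def add_nonneg_nonneg add_increasing2)
          have "\<bar>F (\<phi> n) s - u (\<phi> n) j\<bar> \<le> \<Lambda> * \<bar>s - ?t j\<bar>"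
            using F_lip[of "\<phi> n" s "?t j"] F[of j "\<phi> n"] j by simp
          also have "\<dots> \<le> (\<Lambda> + 1) * (?t (Suc j) - ?t j)" using s \<Lambda> by (intro mult_mono) auto
          also have "\<dots> < (\<Lambda> + 1) * (d / 2 / (\<Lambda> + 1))" using c j \<Lambda> by (intro mult_strict_left_mono) auto
          also have "\<dots> = d / 2" using \<Lambda> by (simp add: field_simps)
          finally have "\<bar>F (\<phi> n) s - u (\<phi> n) j\<bar> < d / 2" .
          moreover have "\<bar>F (\<phi> n) s - f s\<bar> < d / 2" using b s I by blast
          ultimately show "\<bar>f s - u (\<phi> n) j\<bar> < d" by linarith
        qed
        have i1: "(\<lambda>s. h s * G (f s)) integrable_on ?I" "h integrable_on ?I" "(\<lambda>s. \<bar>h s\<bar>) integrable_on ?I"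
          using j by (auto intro: sub hGfi hi)
        have i2: "(\<lambda>s. h s * G (u (\<phi> n) j)) integrable_on ?I" using i1(2) by (rule integrable_on_mult_left)
        have "integral ?I (\<lambda>s. h s * (G (f s) - G (u (\<phi> n) j))) =
            integral ?I (\<lambda>s. h s * G (f s)) - integral ?I h * G (u (\<phi> n) j)"
          using integral_diff[OF i1(1) i2] by (simp add: algebra_simps)
        then have "(v (\<phi> n) (Suc j) - w (?t (Suc j))) - (v (\<phi> n) j - w (?t j)) =
            integral ?I (\<lambda>s. h s * (G (f s) - G (u (\<phi> n) j)))"
          using v_Suc[OF j] w_step[OF j] by simp
        also have "\<bar>\<dots>\<bar> \<le> integral ?I (\<lambda>s. \<epsilon> * \<bar>h s\<bar>)"
        proof (rule abs_integral_le)
          show "(\<lambda>s. h s * (G (f s) - G (u (\<phi> n) j))) integrable_on ?I"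
            using integrable_diff[OF i1(1) i2] by (simp add: algebra_simps)
          show "(\<lambda>s. \<epsilon> * \<bar>h s\<bar>) integrable_on ?I" using i1(3) by (intro integrable_on_mult_right) auto
          show "\<bar>h s * (G (f s) - G (u (\<phi> n) j))\<bar> \<le> \<epsilon> * \<bar>h s\<bar>" if "s \<in> ?I" for s
            using mult_left_mono[OF less_imp_le[OF close[OF that]], of "\<bar>h s\<bar>"] by (simp add: abs_mult mult.commute)
        qed
        finally show "\<bar>(v (\<phi> n) (Suc j) - w (?t (Suc j))) - (v (\<phi> n) j - w (?t j))\<bar> \<le> integral ?I (\<lambda>s. \<epsilon> * \<bar>h s\<bar>)" .
      qed
      also have "\<dots> = \<epsilon> * integral {0..?t k} (\<lambda>s. \<bar>h s\<bar>)" by simp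
      also have "\<dots> \<le> \<epsilon> * S" using eps S_le tT[OF k] by (intro mult_left_mono) auto
      finally have "\<bar>(v (\<phi> n) k - w (?t k)) - (v (\<phi> n) 0 - v0)\<bar> < e / 2" using eps t(2) by (simp add: w_def)
      with a show "\<bar>v (\<phi> n) k - w (?t k)\<bar> < e" by linarith
    qed
  qed
  have u_unif: "\<forall>\<^sub>F n in sequentially. \<forall>k\<le>K (\<phi> n). \<bar>u (\<phi> n) k - f (t (\<phi> n) k)\<bar> < e" if e: "0 < e" for e
    using unif[OF e]
  proof (eventually_elim, intro allI impI)
    fix n k assume a: "\<forall>x\<in>{0..T}. \<bar>F (\<phi> n) x - f x\<bar> < e" and k: "k \<le> K (\<phi> n)"
    have "t (\<phi> n) k \<in> {0..T}" using tT[OF k] by simp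
    with a have "\<bar>F (\<phi> n) (t (\<phi> n) k) - f (t (\<phi> n) k)\<bar> < e" by blast
    then show "\<bar>u (\<phi> n) k - f (t (\<phi> n) k)\<bar> < e" by (simp add: F[OF k])
  qed
  have conv: "(\<lambda>n. u (\<phi> n) (k n)) \<longlonglongrightarrow> f x"
    if k: "\<And>n. k n \<le> K (\<phi> n)" and x: "(\<lambda>n. t (\<phi> n) (k n)) \<longlonglongrightarrow> x" for k x
  proof -
    have tk: "t (\<phi> n) (k n) \<in> {0..T}" for n using tT[OF k] by auto
    have xT: "x \<in> {0..T}" by (rule closed_sequentially[OF closed_atLeastAtMost _ x]) (use tk in auto)
    have lim: "(\<lambda>n. f (t (\<phi> n) (k n))) \<longlonglongrightarrow> f x"
      by (rule continuous_on_tendsto_compose[OF f x xT]) (use tk in auto)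
    have "(\<lambda>n. u (\<phi> n) (k n) - f (t (\<phi> n) (k n))) \<longlonglongrightarrow> 0"
    proof (rule tendstoI)
      fix e :: real assume "0 < e"
      from u_unif[OF this] show "\<forall>\<^sub>F n in sequentially. dist (u (\<phi> n) (k n) - f (t (\<phi> n) (k n))) 0 < e"
        by eventually_elim (use k in auto)
    qed
    from tendsto_add[OF this lim] show ?thesis by simp
  qed
  have f_int: "f x = f 0 + integral {0..x} w" if x: "x \<in> {0..T}" for x
  proof -
    have "\<exists>k. (\<forall>n. k n \<le> K (\<phi> n) \<and> t (\<phi> n) (k n) \<le> x) \<and> (\<lambda>n. t (\<phi> n) (k n)) \<longlonglongrightarrow> x"
      by (rule nodes_near[of "\<lambda>n. t (\<phi> n)" "\<lambda>n. K (\<phi> n)"]) (use t mesh' x in auto)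
    then obtain k where k: "\<And>n. k n \<le> K (\<phi> n)" "(\<lambda>n. t (\<phi> n) (k n)) \<longlonglongrightarrow> x" by blast
    define W where "W y = integral {0..y} w" for y
    have W: "continuous_on {0..T} W" unfolding W_def by (intro indefinite_integral_continuous_1 wi)
    \<comment> \<open>The accumulated error of the scheme tends to 0, but also to
      \<open>f x - f 0 - W x\<close>.\<close>
    have "(\<lambda>n. u (\<phi> n) (k n) - u (\<phi> n) 0 - W (t (\<phi> n) (k n))) \<longlonglongrightarrow> 0"
    proof (rule tendstoI)
      fix e :: real assume e: "0 < e"
      define \<epsilon> where "\<epsilon> = e / (2 * T)"
      have eps: "0 < \<epsilon>" "\<epsilon> * T < e" using e T by (auto simp: \<epsilon>_def)
      have "uniformly_continuous_on {0..T} w" by (intro compact_uniformly_continuous w) auto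
      then obtain d where d: "0 < d" "\<And>y z. y \<in> {0..T} \<Longrightarrow> z \<in> {0..T} \<Longrightarrow> \<bar>y - z\<bar> < d \<Longrightarrow> \<bar>w y - w z\<bar> < \<epsilon> / 2"
        unfolding uniformly_continuous_on_def using half_gt_zero[OF eps(1)] by (metis dist_real_def)
      have e2: "0 < \<epsilon> / 2" using eps by simp
      from v_unif[OF e2] mesh'[OF d(1)]
      show "\<forall>\<^sub>F n in sequentially. dist (u (\<phi> n) (k n) - u (\<phi> n) 0 - W (t (\<phi> n) (k n))) 0 < e"
      proof eventually_elim
        case (elim n)
        let ?t = "t (\<phi> n)" and ?u = "u (\<phi> n)" and ?v = "v (\<phi> n)"
        have "\<bar>(?u (k n) - W (?t (k n))) - (?u 0 - W (?t 0))\<bar> \<le> integral {0..?t (k n)} (\<lambda>_. \<epsilon>)"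
        proof (rule telescope_integral_bound[OF t(1,2,3) _ _ k(1)])
          fix j assume j: "j < K (\<phi> n)"
          let ?I = "{?t j..?t (Suc j)}"
          have I: "?I \<subseteq> {0..T}" using j tT[of j "\<phi> n"] tT[of "Suc j" "\<phi> n"] by auto
          have wI: "w integrable_on ?I" using j wi by (rule sub[rotated])
          have "W (?t (Suc j)) - W (?t j) = integral ?I w"
            unfolding W_def using tT[of j "\<phi> n"] tT[of "Suc j" "\<phi> n"] tS j by (intro integral_between[OF wi]) auto
          moreover have "(?t (Suc j) - ?t j) * ?v (Suc j) = integral ?I (\<lambda>_. ?v (Suc j))" using tS by simp
          ultimately have "(?u (Suc j) - W (?t (Suc j))) - (?u j - W (?t j)) = integral ?I (\<lambda>s. ?v (Suc j) - w s)"
            using u_Suc[OF j] by (subst integral_diff[OF _ wI]) auto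
          also have "\<bar>\<dots>\<bar> \<le> integral ?I (\<lambda>_. \<epsilon>)"
          proof (rule abs_integral_le)
            show "(\<lambda>s. ?v (Suc j) - w s) integrable_on ?I" by (intro integrable_diff wI) auto
            fix s assume s: "s \<in> ?I"
            \<comment> \<open>The cell is crossed with the new slope \<open>?v (Suc j)\<close>, so
              the comparison with \<open>w\<close> is made at its right node.\<close>
            have "\<bar>w (?t (Suc j)) - w s\<bar> < \<epsilon> / 2"
              using elim(2) j s I by (intro d(2)) fastforce+
            moreover have "\<bar>?v (Suc j) - w (?t (Suc j))\<bar> < \<epsilon> / 2" using elim(1) j by auto
            ultimately show "\<bar>?v (Suc j) - w s\<bar> \<le> \<epsilon>" by linarith
          qed auto
          finally show "\<bar>(?u (Suc j) - W (?t (Suc j))) - (?u j - W (?t j))\<bar> \<le> integral ?I (\<lambda>_. \<epsilon>)" .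
        qed auto
        also have "\<dots> = \<epsilon> * ?t (k n)" using tT[OF k(1)] by simp
        also have "\<dots> \<le> \<epsilon> * T" using eps tT[OF k(1)] by (intro mult_left_mono) auto
        finally show ?case using eps t(2) by (simp add: W_def dist_real_def)
      qed
    qed
    moreover have "(\<lambda>n. u (\<phi> n) (k n) - u (\<phi> n) 0 - W (t (\<phi> n) (k n))) \<longlonglongrightarrow> f x - f 0 - W x"
    proof (intro tendsto_diff)
      show "(\<lambda>n. u (\<phi> n) (k n)) \<longlonglongrightarrow> f x" using conv[OF k] by simp
      show "(\<lambda>n. u (\<phi> n) 0) \<longlonglongrightarrow> f 0" using conv[of "\<lambda>_. 0" 0] t(2) by simp
      show "(\<lambda>n. W (t (\<phi> n) (k n))) \<longlonglongrightarrow> W x"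
        by (rule continuous_on_tendsto_compose[OF W k(2) x]) (use tT k(1) in auto)
    qed
    ultimately have "f x - f 0 - W x = 0" by (rule LIMSEQ_unique[rotated])
    then show ?thesis by (simp add: W_def)
  qed
  show ?thesis
  proof (rule that[OF \<phi> f w _ f_int])
    fix e :: real assume "0 < e"
    from u_unif[OF this] v_unif[OF this] show "\<forall>\<^sub>F n in sequentially. \<forall>k\<le>K (\<phi> n).
       \<bar>u (\<phi> n) k - f (t (\<phi> n) k)\<bar> < e \<and> \<bar>v (\<phi> n) k - w (t (\<phi> n) k)\<bar> < e"
      by eventually_elim auto
  qed (auto simp: w_def)
qed

section \<open>The integral equation\<close>

text \<open>\<open>f\<close> is a primitive of a continuous function, hence differentiable
  everywhere, whereas \<open>w\<close> is one of a merely integrable function: it is absolutely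
  continuous and has the expected derivative almost everywhere.\<close>

lemma caratheodory_solution_integral_equation:
  fixes f w g h :: "real \<Rightarrow> real"
  assumes hg: "(\<lambda>s. h s * g (f s)) absolutely_integrable_on {0..T}"
    and w: "\<And>x. x \<in> {0..T} \<Longrightarrow> w x = w 0 - integral {0..x} (\<lambda>s. h s * g (f s))"
    and f: "\<And>x. x \<in> {0..T} \<Longrightarrow> f x = f 0 + integral {0..x} w"
    and w_cont: "continuous_on {0..T} w" and f_nonneg: "\<And>x. x \<in> {0..T} \<Longrightarrow> 0 \<le> f x"
  shows "caratheodory_solution T h g f w"
  unfolding caratheodory_solution_def
proof (intro conjI ballI f_nonneg)
  fix x assume x: "x \<in> {0..T}"
  have "((\<lambda>x. integral {0..x} w) has_real_derivative w x) (at x within {0..T})"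
    using integral_has_vector_derivative[OF w_cont x] by (simp add: has_real_derivative_iff_has_vector_derivative)
  from DERIV_add[OF DERIV_const[of "f 0"] this]
  have "((\<lambda>x. f 0 + integral {0..x} w) has_real_derivative w x) (at x within {0..T})" by simp
  then show "(f has_real_derivative w x) (at x within {0..T})"
    by (rule has_field_derivative_transform_within[where d = 1]) (simp_all only: x f[symmetric] zero_less_one)
next
  let ?I = "\<lambda>x. integral {0..x} (\<lambda>s. h s * g (f s))"
  have "(\<Sum>(x, y)\<in>P. \<bar>w y - w x\<bar>) = (\<Sum>(x, y)\<in>P. \<bar>?I y - ?I x\<bar>)"
    if P: "\<forall>(x, y)\<in>P. x \<le> y \<and> {x..y} \<subseteq> {0..T}" for P
  proof (rule sum.cong[OF refl], clarify)
    fix x y assume "(x, y) \<in> P"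
    with P have "x \<in> {0..T}" "y \<in> {0..T}" by auto
    with w[of x] w[of y] show "\<bar>w y - w x\<bar> = \<bar>?I y - ?I x\<bar>" by simp
  qed
  with absolutely_continuous_indefinite_integral[OF hg] show "absolutely_continuous_fun_on {0..T} w"
    unfolding absolutely_continuous_fun_on_def by (smt (verit, ccfv_SIG))
  have hgi: "(\<lambda>s. h s * g (f s)) integrable_on {0..T}" using hg by (rule set_lebesgue_integral_eq_integral(1))
  have "AE x in lebesgue_on {0..T}. x \<in> {0..T}" by (rule AE_I2) simp
  with indefinite_integral_has_derivative_ae[OF hgi]
  show "AE x in lebesgue_on {0..T}. \<exists>u2. (w has_real_derivative u2) (at x within {0..T}) \<and> u2 + h x * g (f x) = 0"
  proof eventually_elim
    case (elim x)
    have "((\<lambda>x. w 0 - ?I x) has_real_derivative - (h x * g (f x))) (at x within {0..T})"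
      using DERIV_diff[OF DERIV_const[of "w 0"] elim(1)] by simp
    then have "(w has_real_derivative - (h x * g (f x))) (at x within {0..T})"
      by (rule has_field_derivative_transform_within[where d = 1]) (simp_all only: elim(2) w[symmetric] zero_less_one)
    then show ?case by auto
  qed
qed

text \<open>The absolute values on both sides cover integration in either direction, as needed
  around a zero with neighbours on both sides.\<close>

lemma abs_integral_diff_le:
  fixes p q :: "real \<Rightarrow> real"
  assumes p: "p integrable_on {a..b}" and q: "q integrable_on {a..b}" and xy: "x \<in> {a..b}" "y \<in> {a..b}"
    and le: "\<And>s. s \<in> closed_segment x y \<Longrightarrow> \<bar>p s\<bar> \<le> q s"
  shows "\<bar>integral {a..y} p - integral {a..x} p\<bar> \<le> \<bar>integral {a..y} q - integral {a..x} q\<bar>"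
proof -
  have *: "\<bar>integral {a..y} p - integral {a..x} p\<bar> \<le> integral {a..y} q - integral {a..x} q"
    if "x \<in> {a..b}" "y \<in> {a..b}" "x \<le> y" "\<And>s. s \<in> {x..y} \<Longrightarrow> \<bar>p s\<bar> \<le> q s" for x y
    using abs_integral_le[OF _ _ that(4)] integrable_subinterval_real[OF p, of x y] integrable_subinterval_real[OF q, of x y]
      integral_between[OF p that(1-3)] integral_between[OF q that(1-3)] that by auto
  show ?thesis
  proof (cases "x \<le> y")
    case True
    with *[of x y] xy le show ?thesis by (auto simp: closed_segment_eq_real_ivl)
  next
    case False
    then have "\<bar>integral {a..x} p - integral {a..y} p\<bar> \<le> integral {a..x} q - integral {a..y} q"
      using xy le by (intro *) (auto simp: closed_segment_eq_real_ivl)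
    then show ?thesis by linarith
  qed
qed

text \<open>On short intervals the integral equation is a contraction at \<open>0\<close>.\<close>

lemma zero_solution_unique:
  fixes f w g h :: "real \<Rightarrow> real"
  assumes T: "0 < T" and h: "(\<lambda>s. \<bar>h s\<bar>) integrable_on {0..T}"
    and hg: "(\<lambda>s. h s * g (f s)) integrable_on {0..T}"
    and w: "\<And>x. x \<in> {0..T} \<Longrightarrow> w x = w 0 - integral {0..x} (\<lambda>s. h s * g (f s))"
    and f: "\<And>x. x \<in> {0..T} \<Longrightarrow> f x = f 0 + integral {0..x} w"
    and cont: "continuous_on {0..T} f" "continuous_on {0..T} w"
    and lin: "\<And>s. s \<in> {0..T} \<Longrightarrow> \<bar>g (f s)\<bar> \<le> C * \<bar>f s\<bar>" and C: "0 \<le> C"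
    and z: "z \<in> {0..T}" "f z = 0" "w z = 0" and x: "x \<in> {0..T}"
  shows "f x = 0"
proof -
  let ?S = "\<lambda>x. integral {0..x} (\<lambda>s. \<bar>h s\<bar>)"
  have wi: "w integrable_on {0..T}" using cont(2) by (rule integrable_continuous_real)
  have "uniformly_continuous_on {0..T} ?S"
    by (intro compact_uniformly_continuous indefinite_integral_continuous_1 h) auto
  \<comment> \<open>With the mass of \<open>h\<close> bounded by this number, the contraction factor
    is \<open>C * T\<close> times it, at most 1/2.\<close>
  moreover have "0 < 1 / (2 * (C * T + 1))" using C T by (simp add: add_nonneg_pos)
  ultimately obtain d where d: "0 < d" "\<And>x y. x \<in> {0..T} \<Longrightarrow> y \<in> {0..T} \<Longrightarrow> \<bar>x - y\<bar> < d \<Longrightarrow> \<bar>?S x - ?S y\<bar> < 1 / (2 * (C * T + 1))"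
    unfolding uniformly_continuous_on_def dist_real_def by meson
  have local: "f x = 0 \<and> w x = 0" if y: "y \<in> {0..T}" "f y = 0" "w y = 0" and x: "x \<in> {0..T}" "\<bar>x - y\<bar> \<le> d / 2" for x y
  proof -
    let ?J = "{0..T} \<inter> cball y (d / 2)"
    have "compact ?J" "y \<in> ?J" using y d by auto
    moreover have "continuous_on ?J (\<lambda>x. \<bar>f x\<bar>)" by (intro continuous_intros continuous_on_subset[OF cont(1)]) auto
    ultimately obtain p where p: "p \<in> ?J" "\<And>x. x \<in> ?J \<Longrightarrow> \<bar>f x\<bar> \<le> \<bar>f p\<bar>"
      using continuous_attains_sup[of ?J "\<lambda>x. \<bar>f x\<bar>"] by blast
    define M where "M = \<bar>f p\<bar>"
    define \<eta> where "\<eta> = 1 / (2 * (C * T + 1))"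
    have seg: "closed_segment y x \<subseteq> ?J" if "x \<in> ?J" for x
      using that y d by (intro closed_segment_subset convex_Int) auto
    have w_le: "\<bar>w x\<bar> \<le> C * M * \<eta>" if xJ: "x \<in> ?J" for x
    proof -
      have "\<bar>w x\<bar> = \<bar>integral {0..x} (\<lambda>s. h s * g (f s)) - integral {0..y} (\<lambda>s. h s * g (f s))\<bar>"
        using w[of x] w[OF y(1)] y xJ by auto
      also have "\<dots> \<le> \<bar>integral {0..x} (\<lambda>s. C * M * \<bar>h s\<bar>) - integral {0..y} (\<lambda>s. C * M * \<bar>h s\<bar>)\<bar>"
      proof (rule abs_integral_diff_le[OF hg])
        fix s assume "s \<in> closed_segment y x"
        then have s: "s \<in> ?J" using seg[OF xJ] by auto
        have "\<bar>g (f s)\<bar> \<le> C * \<bar>f s\<bar>" using s by (intro lin) auto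
        also have "\<dots> \<le> C * M" using p(2)[OF s] C by (simp add: M_def mult_left_mono)
        finally show "\<bar>h s * g (f s)\<bar> \<le> C * M * \<bar>h s\<bar>"
          by (simp add: abs_mult mult.commute mult_left_mono)
      qed (use h xJ y in \<open>auto intro: integrable_on_mult_right\<close>)
      also have "\<dots> = C * M * \<bar>?S x - ?S y\<bar>"
        using C by (simp add: M_def abs_mult right_diff_distrib[symmetric])
      also have "\<dots> \<le> C * M * \<eta>"
      proof (rule mult_left_mono)
        have "\<bar>x - y\<bar> < d" using xJ d(1) by (simp add: dist_real_def abs_minus_commute)
        then show "\<bar>?S x - ?S y\<bar> \<le> \<eta>" using d(2)[of x y] xJ y by (auto simp: \<eta>_def)
      qed (use C in \<open>simp add: M_def\<close>)
      finally show ?thesis .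
    qed
    have "M = \<bar>integral {0..p} w - integral {0..y} w\<bar>"
      using f[of p] f[OF y(1)] y p(1) by (auto simp: M_def)
    also have "\<dots> \<le> \<bar>integral {0..p} (\<lambda>_. C * M * \<eta>) - integral {0..y} (\<lambda>_. C * M * \<eta>)\<bar>"
      using y p(1) seg[OF p(1)] by (intro abs_integral_diff_le[OF wi] w_le) auto
    also have "\<dots> = C * M * \<eta> * \<bar>p - y\<bar>"
    proof -
      have "0 \<le> C * M * \<eta>" using w_le[OF p(1)] by linarith
      moreover have "integral {0..p} (\<lambda>_. c) - integral {0..y} (\<lambda>_. c) = c * (p - y)" for c :: real
        using y p(1) by (simp add: algebra_simps)
      ultimately show ?thesis by (simp only: abs_mult[of "C * M * \<eta>"] abs_of_nonneg)
    qed
    also have "\<dots> \<le> C * M * \<eta> * T"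
    proof (rule mult_left_mono)
      show "\<bar>p - y\<bar> \<le> T" using p(1) y by auto
      show "0 \<le> C * M * \<eta>" using w_le[OF p(1)] by linarith
    qed
    also have "\<dots> = M * (C * T / (2 * (C * T + 1)))" by (simp add: \<eta>_def)
    also have "\<dots> \<le> M * (1 / 2)"
    proof (rule mult_left_mono)
      have "0 \<le> C * T" using C T by simp
      then show "C * T / (2 * (C * T + 1)) \<le> 1 / 2" by (subst pos_divide_le_eq) auto
    qed (simp add: M_def)
    finally have M: "M = 0" by (simp add: M_def)
    have "x \<in> ?J" using x by (auto simp: dist_real_def abs_minus_commute)
    then show ?thesis using M p(2)[of x] w_le[of x] by (auto simp: M_def)
  qed
  have "\<forall>x\<in>{0..T}. \<bar>x - z\<bar> \<le> real n * (d / 2) \<longrightarrow> f x = 0 \<and> w x = 0" for n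
  proof (induction n)
    case 0
    then show ?case using z by auto
  next
    case (Suc n)
    show ?case
    proof (intro ballI impI)
      fix x assume x: "x \<in> {0..T}" "\<bar>x - z\<bar> \<le> real (Suc n) * (d / 2)"
      \<comment> \<open>One step of length \<open>d / 2\<close> from \<open>x\<close> towards
        \<open>z\<close>, or \<open>z\<close> itself when it is that close.\<close>
      define y where "y = (if \<bar>x - z\<bar> \<le> d / 2 then z else if z < x then x - d / 2 else x + d / 2)"
      have y: "y \<in> {0..T}" "\<bar>x - y\<bar> \<le> d / 2"
        using x(1) z(1) d(1) by (auto simp: y_def split: if_splits)
      have "\<bar>y - z\<bar> \<le> real n * (d / 2)"
        using x(2) d(1) by (auto simp: y_def abs_if algebra_simps split: if_splits)
      with Suc y(1) have "f y = 0" "w y = 0" by auto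
      then show "f x = 0 \<and> w x = 0" using local[OF y(1) _ _ x(1) y(2)] by simp
    qed
  qed
  note vanish = this
  obtain n where "T / (d / 2) \<le> real n" using real_arch_simple by blast
  then have "T \<le> real n * (d / 2)" using d by (simp add: field_simps)
  moreover have "\<bar>x - z\<bar> \<le> T" using x z(1) by (simp add: abs_le_iff)
  ultimately have "\<bar>x - z\<bar> \<le> real n * (d / 2)" by linarith
  then show ?thesis using x vanish by blast
qed

lemma zero_slope_at_interior_zero:
  fixes f :: "real \<Rightarrow> real" and w :: real
  assumes d: "(f has_real_derivative w) (at z within {0..T})" and z: "0 < z" "z < T" "f z = 0"
    and nonneg: "\<And>x. x \<in> {0..T} \<Longrightarrow> 0 \<le> f x"
  shows "w = 0"
proof (rule DERIV_local_min[of f w z "min z (T - z)"])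
  have "at z within {0..T} = at z" using z by (intro at_within_Icc_at) auto
  with d show "DERIV f z :> w" by simp
  show "\<forall>y. \<bar>z - y\<bar> < min z (T - z) \<longrightarrow> f z \<le> f y"
  proof (intro allI impI)
    fix y assume "\<bar>z - y\<bar> < min z (T - z)"
    then have "y \<in> {0..T}" by (auto simp: abs_if min_def split: if_splits)
    with nonneg z show "f z \<le> f y" by simp
  qed
qed (use z in auto)

section \<open>Grids and the choice of constants\<close>

text \<open>The value is constant beyond index \<open>J * N\<close>, so that the refinement of a
  monotone \<open>p\<close> is monotone on all naturals, as \<open>kicks\<close> demands.\<close>

definition refine :: "nat \<Rightarrow> nat \<Rightarrow> (nat \<Rightarrow> real) \<Rightarrow> nat \<Rightarrow> real" where
  "refine J N p k = (if k < J * N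
     then p (k div N) + (p (Suc (k div N)) - p (k div N)) * real (k mod N) / real N else p J)"

text \<open>For the last cell of a block, \<open>Suc (j * N + l)\<close> already belongs to the next
  block, or to the constant tail; the two formulas agree there because both give
  \<open>p (Suc j)\<close>.\<close>

lemma refine_cell:
  assumes "j < J" "l < N"
  shows "refine J N p (j * N + l) = p j + (p (Suc j) - p j) * real l / real N"
    "refine J N p (Suc (j * N + l)) = p j + (p (Suc j) - p j) * real (Suc l) / real N"
proof -
  have lt: "j * N + l < J * N"
    using mult_le_mono1[of "Suc j" J N] assms by auto
  then show "refine J N p (j * N + l) = p j + (p (Suc j) - p j) * real l / real N"
    using assms by (simp add: refine_def)
  show "refine J N p (Suc (j * N + l)) = p j + (p (Suc j) - p j) * real (Suc l) / real N"
  proof (cases "Suc l < N")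
    case True
    then have "j * N + Suc l < J * N" using mult_le_mono1[of "Suc j" J N] assms by auto
    moreover have "(j * N + i) div N = j \<and> (j * N + i) mod N = i" if "i < N" for i using that by simp
    from this[OF True] have "(j * N + Suc l) div N = j" "(j * N + Suc l) mod N = Suc l" by blast+
    ultimately show ?thesis unfolding add_Suc_right[symmetric] refine_def by simp
  next
    case False
    then have N: "N = Suc l" using assms by auto
    then have eq: "Suc (j * N + l) = Suc j * N" by simp
    have "refine J N p (Suc j * N) = p (Suc j)"
    proof (cases "Suc j < J")
      case True
      then have "Suc j * N < J * N" by (rule mult_less_mono1) (use N in simp)
      moreover have "Suc j * N div N = Suc j"
        by (rule nonzero_mult_div_cancel_right) (use N in simp)
      moreover have "Suc j * N mod N = 0" by (rule mod_mult_self2_is_0)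
      ultimately show ?thesis unfolding refine_def by simp
    next
      case False
      then have "Suc j = J" using assms by auto
      then show ?thesis by (simp add: refine_def)
    qed
    moreover have "p j + (p (Suc j) - p j) * real (Suc l) / real N = p (Suc j)" using N by simp
    ultimately show ?thesis using eq by metis
  qed
qed

lemma refine_node:
  assumes "0 < N" "j \<le> J" shows "refine J N p (j * N) = p j"
proof (cases "j < J")
  case True
  from refine_cell(1)[OF True assms(1), of p] show ?thesis by simp
qed (use assms in \<open>simp add: refine_def\<close>)

lemma refine_beyond: "J * N \<le> k \<Longrightarrow> refine J N p k = p J"
  by (simp add: refine_def)

lemma refine_Suc_diff:
  assumes "0 < N" "k < J * N"
  shows "refine J N p (Suc k) - refine J N p k = (p (Suc (k div N)) - p (k div N)) / real N"
proof -
  have j: "k div N < J" "k mod N < N" using assms by (auto simp: less_mult_imp_div_less)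
  from refine_cell[OF this, of p] show ?thesis
    by (simp add: add_divide_distrib diff_divide_distrib algebra_simps)
qed

lemma refine_mono:
  assumes N: "0 < N" and p: "\<And>j. j < J \<Longrightarrow> p j \<le> p (Suc j)"
  shows "mono (refine J N p)"
proof (rule incseq_SucI)
  fix k
  show "refine J N p k \<le> refine J N p (Suc k)"
  proof (cases "k < J * N")
    case True
    then have "0 \<le> (p (Suc (k div N)) - p (k div N)) / real N"
      using p[of "k div N"] by (simp add: less_mult_imp_div_less)
    with refine_Suc_diff[OF N True, of p] show ?thesis by simp
  qed (simp add: refine_beyond)
qed

lemma sum_cell_integrals:
  fixes f :: "real \<Rightarrow> real" and t :: "nat \<Rightarrow> real"
  assumes t: "mono t" and f: "f integrable_on {t a..t b}" and ab: "a \<le> b"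
  shows "(\<Sum>k\<in>{a..<b}. integral {t k..t (Suc k)} f) = integral {t a..t b} f"
proof -
  have "(\<Sum>k\<in>{a..<n}. integral {t k..t (Suc k)} f) = integral {t a..t n} f" if "a \<le> n" "n \<le> b" for n
    using that
  proof (induction n rule: dec_induct)
    case (step n)
    have "t a \<le> t n" "t n \<le> t (Suc n)" "t (Suc n) \<le> t b" using step t by (auto simp: monoD)
    then have "integral {t a..t (Suc n)} f - integral {t a..t n} f = integral {t n..t (Suc n)} f"
      by (intro integral_between[OF f]) auto
    with step show ?case by simp
  qed simp
  with ab show ?thesis by simp
qed

text \<open>Nodes for \<open>hump_kick_le\<close> with \<open>d\<close> as distance to the ends: the
  first node past \<open>x + d\<close> and the last one before \<open>y - d\<close>. The cells
  \<open>k1\<close> to \<open>k2\<close> end at node \<open>Suc k2\<close> and therefore cover all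
  of \<open>[x + 2 * d, y - 2 * d]\<close>.\<close>

lemma inner_nodes:
  fixes t :: "nat \<Rightarrow> real"
  assumes t: "mono t" and st: "s \<le> q" "t s = x" "t q = y" and step: "\<And>k. s \<le> k \<Longrightarrow> k < q \<Longrightarrow> t (Suc k) - t k \<le> d"
    and d: "0 < d" "4 * d < y - x"
  obtains k1 k2 where "s \<le> k1" "k1 \<le> k2" "k2 < q" "d \<le> t k1 - x" "t k1 \<le> x + 2 * d"
    "d \<le> y - t k2" "y - 2 * d \<le> t (Suc k2)"
proof -
  define k1 where "k1 = (LEAST k. x + d \<le> t k)"
  have k1: "x + d \<le> t k1" unfolding k1_def by (rule LeastI[of _ q]) (use st d in auto)
  have k1q: "k1 \<le> q" unfolding k1_def by (rule Least_le) (use st d in auto)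
  have "\<not> k1 \<le> s" using monoD[OF t, of k1 s] k1 st d by auto
  then obtain j where j: "k1 = Suc j" "s \<le> j" by (cases k1) auto
  have "\<not> x + d \<le> t j" using not_less_Least[of j "\<lambda>k. x + d \<le> t k"] j by (auto simp: k1_def[symmetric])
  moreover have "t (Suc j) - t j \<le> d" using j k1q by (intro step) auto
  ultimately have k1_le: "t k1 \<le> x + 2 * d" using j by auto
  define k2 where "k2 = (GREATEST k. k \<le> q \<and> t k \<le> y - d)"
  have k2: "k2 \<le> q \<and> t k2 \<le> y - d"
    unfolding k2_def by (rule GreatestI_nat[where k = k1 and b = q]) (use k1q k1_le d in auto)
  then have "k2 < q" using st d by (cases "k2 = q") auto
  moreover have "y - d < t (Suc k2)"
    using Greatest_le_nat[of "\<lambda>k. k \<le> q \<and> t k \<le> y - d" "Suc k2" q] \<open>k2 < q\<close>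
    by (auto simp: k2_def[symmetric] not_le[symmetric])
  moreover have "k1 \<le> k2" unfolding k2_def
    by (rule Greatest_le_nat[where b = q]) (use k1q k1_le d in auto)
  ultimately show ?thesis using that[of k1 k2] j k1 k1_le k2 d by auto
qed

section \<open>Integrals under almost everywhere sign conditions\<close>

lemma AE_lebesgue_on_negligible:
  assumes "AE x in lebesgue_on S. P x" "S \<in> sets lebesgue"
  obtains N where "negligible N" "\<And>x. x \<in> S - N \<Longrightarrow> P x"
proof -
  have "AE x in lebesgue. x \<in> S \<longrightarrow> P x"
    using assms by (subst (asm) AE_restrict_space_iff) auto
  then obtain N where "{x \<in> space lebesgue. \<not> (x \<in> S \<longrightarrow> P x)} \<subseteq> N" "N \<in> null_sets lebesgue"
    unfolding eventually_ae_filter by auto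
  then show ?thesis by (intro that[of N]) (auto simp: negligible_iff_null_sets)
qed

lemma integral_eq_0_of_AE:
  fixes f :: "real \<Rightarrow> real"
  assumes "AE x in lebesgue_on {a..b}. f x = 0" "{x..y} \<subseteq> {a..b}"
  shows "integral {x..y} f = 0"
proof -
  obtain N where N: "negligible N" "\<And>x. x \<in> {a..b} - N \<Longrightarrow> f x = 0"
    using AE_lebesgue_on_negligible[OF assms(1)] by auto
  have "integral {x..y} f = integral {x..y} (\<lambda>_. 0)"
    by (rule integral_spike[OF N(1)]) (use N(2) assms(2) in auto)
  then show ?thesis by simp
qed

text \<open>A nonnegative function with integral 0 vanishes almost everywhere, which
  \<open>succ_zero_on\<close> excludes.\<close>

lemma integral_pos_of_succ_zero_on:
  fixes f :: "real \<Rightarrow> real"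
  assumes s: "succ_zero_on f {a..b}" and f: "f absolutely_integrable_on {a..b}"
  shows "0 < integral {a..b} f" "AE t in lebesgue_on {a..b}. 0 \<le> f t"
proof -
  show ae: "AE t in lebesgue_on {a..b}. 0 \<le> f t" using s by (simp add: succ_zero_on_def)
  have i: "integrable (lebesgue_on {a..b}) f"
    using f by (simp add: set_integrable_def integrable_restrict_space)
  have eq: "integral {a..b} f = integral\<^sup>L (lebesgue_on {a..b}) f"
    using lebesgue_integral_eq_integral[OF i] by simp
  have "integral\<^sup>L (lebesgue_on {a..b}) f \<noteq> 0"
    using s integral_nonneg_eq_0_iff_AE[OF i ae] by (auto simp: succ_zero_on_def)
  moreover have "0 \<le> integral\<^sup>L (lebesgue_on {a..b}) f" using ae by (rule integral_nonneg_AE)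
  ultimately show "0 < integral {a..b} f" using eq by simp
qed

text \<open>The indefinite integral is continuous, so removing a short piece at an end loses less
  than half of the integral. The hump estimate needs this room, as it controls slopes only away from
  the ends.\<close>

lemma shrink_interval_integral_pos:
  fixes f :: "real \<Rightarrow> real"
  assumes f: "f integrable_on {a..b}" and ab: "a < b" and pos: "0 < integral {a..b} f"
  shows "\<exists>d>0. 4 * d < b - a \<and> 0 < integral {a + 2 * d..b - 2 * d} f"
proof -
  let ?F = "\<lambda>x. integral {a..x} f"
  have cont: "continuous_on {a..b} ?F" by (rule indefinite_integral_continuous_1[OF f])
  define e where "e = integral {a..b} f / 2"
  have e: "0 < e" using pos by (simp add: e_def)
  have "uniformly_continuous_on {a..b} ?F" by (intro compact_uniformly_continuous cont) auto
  then obtain r where r: "0 < r" "\<And>x y. x \<in> {a..b} \<Longrightarrow> y \<in> {a..b} \<Longrightarrow> \<bar>x - y\<bar> < r \<Longrightarrow> \<bar>?F x - ?F y\<bar> < e"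
    unfolding uniformly_continuous_on_def dist_real_def using e by meson
  define d where "d = min (r / 4) ((b - a) / 8)"
  have "d \<le> r / 4" "d \<le> (b - a) / 8" unfolding d_def by (rule min.cobounded1 min.cobounded2)+
  moreover have "0 < d" using r ab by (simp add: d_def)
  ultimately have d: "0 < d" "4 * d \<le> r" "8 * d \<le> b - a" by simp_all
  have "?F (b - 2 * d) - ?F (a + 2 * d) = integral {a + 2 * d..b - 2 * d} f"
    using d by (intro integral_between[OF f]) auto
  moreover have "\<bar>?F (b - 2 * d) - ?F b\<bar> < e" "\<bar>?F (a + 2 * d) - ?F a\<bar> < e"
    by (rule r(2); use d ab in simp)+
  moreover have "?F b - ?F a = 2 * e" by (simp add: e_def)
  ultimately show ?thesis using d by (intro exI[of _ d]) auto
qed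

section \<open>Constants from the growth of \<open>g\<close>\<close>

lemma exists_positive_lower_bound:
  fixes g :: "real \<Rightarrow> real"
  assumes g: "continuous_on {0..} g" and pos: "\<And>s. 0 < s \<Longrightarrow> 0 < g s" and x: "0 < x" "x \<le> y"
  obtains c where "0 < c" "\<And>s. x \<le> s \<Longrightarrow> s \<le> y \<Longrightarrow> c \<le> g s"
proof -
  have "continuous_on {x..y} g" using x by (intro continuous_on_subset[OF g]) auto
  then obtain p where "p \<in> {x..y}" "\<And>s. s \<in> {x..y} \<Longrightarrow> g p \<le> g s"
    using continuous_attains_inf[of "{x..y}" g] x by auto
  with pos[of p] x that[of "g p"] show ?thesis by auto
qed

lemma sublinear_at_0:
  fixes g :: "real \<Rightarrow> real"
  assumes "((\<lambda>s. g s / s) \<longlongrightarrow> 0) (at_right 0)" "0 < e"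
  obtains r where "0 < r" "\<And>s. 0 < s \<Longrightarrow> s < r \<Longrightarrow> \<bar>g s\<bar> \<le> e * s"
proof -
  from tendstoD[OF assms] obtain r where r: "0 < r" "\<And>s. 0 < s \<Longrightarrow> s < r \<Longrightarrow> \<bar>g s / s\<bar> < e"
    by (auto simp: eventually_at_right_field dist_real_def)
  show ?thesis
  proof (rule that[OF r(1)])
    fix s assume s: "0 < s" "s < r"
    with r(2)[OF s] show "\<bar>g s\<bar> \<le> e * s" by (simp add: field_simps)
  qed
qed

text \<open>\<open>R\<close> is so large that \<open>e * R\<close> dominates \<open>g\<close> on the
  compact part where \<open>g s / s\<close> need not be below \<open>e\<close> yet; further out
  \<open>g s\<close> is at most \<open>e * s\<close>.\<close>

lemma sublinear_at_top:
  fixes g :: "real \<Rightarrow> real"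
  assumes g: "continuous_on {0..} g" and lim: "((\<lambda>s. g s / s) \<longlongrightarrow> 0) at_top" and e: "0 < e"
  obtains R where "2 < R" "\<And>s. 0 \<le> s \<Longrightarrow> s \<le> R \<Longrightarrow> g s \<le> e * R"
proof -
  from tendstoD[OF lim e] obtain N where N: "\<And>s. N \<le> s \<Longrightarrow> \<bar>g s / s\<bar> < e"
    by (auto simp: eventually_at_top_linorder dist_real_def)
  define M where "M = max N 1"
  have "compact (g ` {0..M})" by (intro compact_continuous_image continuous_on_subset[OF g]) auto
  then obtain B where B: "\<forall>z\<in>g ` {0..M}. norm z \<le> B" by (metis bounded_iff compact_imp_bounded)
  define R where "R = max 3 (B / e)"
  have "g s \<le> e * R" if s: "0 \<le> s" "s \<le> R" for s
  proof (cases "s \<le> M")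
    case True
    then have "g s \<le> B" using B s by force
    also have "B = e * (B / e)" using e by simp
    also have "\<dots> \<le> e * R" using e by (intro mult_left_mono) (auto simp: R_def)
    finally show ?thesis .
  next
    case False
    then have "N \<le> s" "0 < s" by (auto simp: M_def)
    with N[of s] have "g s \<le> e * s" by (simp add: field_simps abs_less_iff)
    also have "\<dots> \<le> e * R" using e s by (intro mult_left_mono) auto
    finally show ?thesis .
  qed
  then show ?thesis by (intro that[of R]) (auto simp: R_def)
qed

section \<open>The weight on the refined grids\<close>

locale indefinite_weight =
  fixes g a :: "real \<Rightarrow> real" and T :: real and m :: nat and \<sigma> \<tau> :: "nat \<Rightarrow> real"
  assumes g_cont: "continuous_on {0..} g"
    and g_range: "g \<in> {0..} \<rightarrow> {0..}"
    and g_0: "g 0 = 0"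
    and g_pos: "\<And>s. s > 0 \<Longrightarrow> g s > 0"
    and g_lim_0: "((\<lambda>s. g s / s) \<longlongrightarrow> 0) (at_right 0)"
    and g_lim_inf: "((\<lambda>s. g s / s) \<longlongrightarrow> 0) at_top"
    and T_pos: "T > 0"
    and a_int: "a absolutely_integrable_on {0..T}"
    and a_neg: "(LINT t:{0..T}|lebesgue. neg_part (a t)) \<noteq> 0"
    and m: "m \<ge> 1"
    and ends: "\<tau> 0 = 0" "\<sigma> (m + 1) = T" "\<tau> 0 \<le> \<sigma> 1" "\<tau> m \<le> \<sigma> (m + 1)"
    and \<sigma>_less_\<tau>: "\<And>i. i \<in> {1..m} \<Longrightarrow> \<sigma> i < \<tau> i"
    and \<tau>_less_\<sigma>: "\<And>i. i \<in> {1..<m} \<Longrightarrow> \<tau> i < \<sigma> (i + 1)"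
    and a_succ: "\<And>i. i \<in> {1..m} \<Longrightarrow> succ_zero_on a {\<sigma> i..\<tau> i}"
    and a_prec: "\<And>i. i \<in> {0..m} \<Longrightarrow> \<tau> i < \<sigma> (i + 1) \<Longrightarrow> prec_zero_on a {\<tau> i..\<sigma> (i + 1)}"
begin

definition G :: "real \<Rightarrow> real" where "G x = g (max x 0)"

definition weight :: "real \<Rightarrow> real \<Rightarrow> real \<Rightarrow> real" where
  "weight lam mu t = lam * pos_part (a t) - mu * neg_part (a t)"

text \<open>The end points \<open>\<tau> 0, \<sigma> 1, \<tau> 1, \<dots>, \<tau> m, \<sigma> (m + 1)\<close> in one sequence. With \<open>N\<close> cells per
  interval, \<open>\<sigma> i\<close> (for \<open>i \<ge> 1\<close> only) and \<open>\<tau> i\<close> are the nodes \<open>s_index N i\<close> and \<open>q_index N i\<close>.\<close>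

definition breakpoint :: "nat \<Rightarrow> real" where
  "breakpoint j = (if even j then \<tau> (j div 2) else \<sigma> (Suc (j div 2)))"

definition grid :: "nat \<Rightarrow> nat \<Rightarrow> real" where "grid N = refine (2 * m + 1) N breakpoint"
definition s_index :: "nat \<Rightarrow> nat \<Rightarrow> nat" where "s_index N i = (2 * i - 1) * N"
definition q_index :: "nat \<Rightarrow> nat \<Rightarrow> nat" where "q_index N i = 2 * i * N"

definition kick :: "real \<Rightarrow> real \<Rightarrow> nat \<Rightarrow> nat \<Rightarrow> real" where
  "kick lam mu N k = integral {grid N k..grid N (Suc k)} (weight lam mu)"

lemma G_cont: "continuous_on UNIV G"
  unfolding G_def by (intro continuous_on_compose2[OF g_cont] continuous_intros) auto

lemma g_nonneg: "0 \<le> s \<Longrightarrow> 0 \<le> g s" using g_range by auto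

lemma G_nonneg: "0 \<le> G x" and G_nonpos: "x \<le> 0 \<Longrightarrow> G x = 0"
  by (auto simp: G_def g_nonneg g_0 max_def)

lemma G_eq: "0 \<le> x \<Longrightarrow> G x = g x" by (simp add: G_def max_def)

lemma breakpoint_Suc:
  assumes "j < 2 * m + 1" shows "breakpoint j \<le> breakpoint (Suc j)"
proof (cases "even j")
  case True
  then obtain i where i: "j = 2 * i" by (rule evenE)
  then have "i = 0 \<or> i = m \<or> i \<in> {1..<m}" using assms by auto
  then have "\<tau> i \<le> \<sigma> (Suc i)" using ends \<tau>_less_\<sigma>[of i] by auto
  then show ?thesis by (simp add: breakpoint_def i)
next
  case False
  then obtain i where i: "j = 2 * i + 1" by (rule oddE)
  then have "\<sigma> (Suc i) < \<tau> (Suc i)" using assms by (intro \<sigma>_less_\<tau>) auto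
  then show ?thesis by (simp add: breakpoint_def i)
qed

lemma breakpoint_mono: "i \<le> j \<Longrightarrow> j \<le> 2 * m + 1 \<Longrightarrow> breakpoint i \<le> breakpoint j"
proof (induction j rule: dec_induct)
  case (step n)
  with breakpoint_Suc[of n] show ?case by auto
qed simp

lemma breakpoint_simps: "breakpoint (2 * i) = \<tau> i" "breakpoint (2 * i + 1) = \<sigma> (Suc i)"
  by (simp_all add: breakpoint_def)

lemma breakpoint_bounds: "j \<le> 2 * m + 1 \<Longrightarrow> 0 \<le> breakpoint j \<and> breakpoint j \<le> T"
  using breakpoint_mono[of 0 j] breakpoint_mono[of j "2 * m + 1"] ends breakpoint_simps[of 0] breakpoint_simps[of m]
  by auto

lemma interval_bounds:
  "i \<le> m \<Longrightarrow> 0 \<le> \<tau> i \<and> \<tau> i \<le> \<sigma> (Suc i) \<and> \<sigma> (Suc i) \<le> T"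
  "i \<in> {1..m} \<Longrightarrow> 0 \<le> \<sigma> i \<and> \<sigma> i < \<tau> i \<and> \<tau> i \<le> T"
proof -
  show A: "0 \<le> \<tau> i \<and> \<tau> i \<le> \<sigma> (Suc i) \<and> \<sigma> (Suc i) \<le> T" if "i \<le> m" for i
    using breakpoint_bounds[of "2 * i"] breakpoint_bounds[of "2 * i + 1"] breakpoint_Suc[of "2 * i"] breakpoint_simps[of i] that
    by auto
  show "0 \<le> \<sigma> i \<and> \<sigma> i < \<tau> i \<and> \<tau> i \<le> T" if "i \<in> {1..m}"
  proof -
    have "i - 1 \<le> m" "i \<le> m" "Suc (i - 1) = i" using that by auto
    with A[of "i - 1"] A[of i] \<sigma>_less_\<tau>[OF that] show ?thesis by auto
  qed
qed

lemma grid_mono: "0 < N \<Longrightarrow> mono (grid N)"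
  unfolding grid_def by (intro refine_mono breakpoint_Suc) auto

lemma grid_nodes:
  assumes "0 < N" "i \<le> m" shows "grid N (q_index N i) = \<tau> i" "grid N (s_index N (Suc i)) = \<sigma> (Suc i)"
  using refine_node[OF assms(1), of "2 * i" "2 * m + 1" breakpoint] refine_node[OF assms(1), of "2 * i + 1" "2 * m + 1" breakpoint]
    breakpoint_simps[of i] assms(2) by (simp_all add: grid_def s_index_def q_index_def)

lemma grid_s: "0 < N \<Longrightarrow> i \<in> {1..m} \<Longrightarrow> grid N (s_index N i) = \<sigma> i"
  using grid_nodes(2)[of N "i - 1"] by (cases i) auto

lemma grid_0: "0 < N \<Longrightarrow> grid N 0 = 0"
  using grid_nodes(1)[of N 0] ends by (simp add: q_index_def)

lemma grid_end: "0 < N \<Longrightarrow> grid N (s_index N (Suc m)) = T"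
  using grid_nodes(2)[of N m] ends by simp

lemma grid_step:
  assumes N: "0 < N" and k: "k < s_index N (Suc m)"
  shows "grid N (Suc k) - grid N k \<le> T / real N"
proof -
  have k': "k < (2 * m + 1) * N" using k by (simp add: s_index_def)
  then have "k div N < 2 * m + 1" by (rule less_mult_imp_div_less)
  then have "breakpoint (Suc (k div N)) - breakpoint (k div N) \<le> T"
    using breakpoint_bounds[of "k div N"] breakpoint_bounds[of "Suc (k div N)"] by auto
  then show ?thesis
    using refine_Suc_diff[OF N k', of breakpoint] N by (simp add: grid_def divide_right_mono)
qed

lemma q_le_s_index: "q_index N i \<le> s_index N (Suc i)"
  by (simp add: q_index_def s_index_def)

lemma s_le_q_index: "s_index N i \<le> q_index N i"
  by (simp add: q_index_def s_index_def)

lemma index_le_end: "i \<le> m \<Longrightarrow> s_index N (Suc i) \<le> s_index N (Suc m)" "i \<le> m \<Longrightarrow> q_index N i \<le> s_index N (Suc m)"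
  by (auto simp: q_index_def s_index_def intro!: mult_le_mono1 order_trans[OF mult_le_mono1[of "2 * i" "2 * m" N]])

lemma parts_integrable:
  "(\<lambda>t. pos_part (a t)) absolutely_integrable_on {0..T}"
  "(\<lambda>t. neg_part (a t)) absolutely_integrable_on {0..T}"
proof -
  show "(\<lambda>t. pos_part (a t)) absolutely_integrable_on {0..T}"
    unfolding pos_part_def using a_int by (intro absolutely_integrable_max_1) auto
  have "(\<lambda>t. - a t) absolutely_integrable_on {0..T}"
    using absolutely_integrable_scaleR_left[OF a_int, of "- 1"] by simp
  then show "(\<lambda>t. neg_part (a t)) absolutely_integrable_on {0..T}"
    unfolding neg_part_def by (intro absolutely_integrable_max_1) auto
qed

lemma weight_abs_integrable: "weight lam mu absolutely_integrable_on {0..T}"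
proof -
  have "(\<lambda>t. lam * pos_part (a t)) absolutely_integrable_on {0..T}"
    using absolutely_integrable_scaleR_left[OF parts_integrable(1), of lam] by simp
  moreover have "(\<lambda>t. mu * neg_part (a t)) absolutely_integrable_on {0..T}"
    using absolutely_integrable_scaleR_left[OF parts_integrable(2), of mu] by simp
  ultimately show ?thesis unfolding weight_def by (rule set_integral_diff(1))
qed

lemma integrable_sub:
  assumes "{x..y} \<subseteq> {0..T}"
  shows "(\<lambda>t. pos_part (a t)) integrable_on {x..y}" "(\<lambda>t. neg_part (a t)) integrable_on {x..y}"
    "weight lam mu integrable_on {x..y}"
  using parts_integrable weight_abs_integrable[of lam mu] assms
  by (meson absolutely_integrable_on_subinterval set_lebesgue_integral_eq_integral(1))+

lemma integral_weight:
  assumes "{x..y} \<subseteq> {0..T}"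
  shows "integral {x..y} (weight lam mu) =
     lam * integral {x..y} (\<lambda>t. pos_part (a t)) - mu * integral {x..y} (\<lambda>t. neg_part (a t))"
proof -
  have "integral {x..y} (weight lam mu) =
    integral {x..y} (\<lambda>t. lam * pos_part (a t)) - integral {x..y} (\<lambda>t. mu * neg_part (a t))"
    unfolding weight_def using integrable_sub[OF assms]
    by (intro integral_diff integrable_on_mult_right)
  then show ?thesis by simp
qed

lemma parts_nonneg: "0 \<le> pos_part x" "0 \<le> neg_part x" by (auto simp: pos_part_def neg_part_def)

lemma integral_pos_interval:
  assumes i: "i \<in> {1..m}" and xy: "{x..y} \<subseteq> {\<sigma> i..\<tau> i}"
  shows "integral {x..y} (\<lambda>t. neg_part (a t)) = 0"
    "integral {x..y} (weight lam mu) = lam * integral {x..y} (\<lambda>t. pos_part (a t))"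
    "0 \<le> integral {x..y} (\<lambda>t. pos_part (a t))"
proof -
  have sub: "{\<sigma> i..\<tau> i} \<subseteq> {0..T}" using interval_bounds(2)[OF i] by auto
  have "AE t in lebesgue_on {\<sigma> i..\<tau> i}. neg_part (a t) = 0"
    using a_succ[OF i] unfolding succ_zero_on_def
    by (elim conjE) (erule AE_mp, rule AE_I2, simp add: neg_part_def)
  then show *: "integral {x..y} (\<lambda>t. neg_part (a t)) = 0" using xy by (rule integral_eq_0_of_AE)
  have xyT: "{x..y} \<subseteq> {0..T}" using xy sub by (rule order_trans)
  show "integral {x..y} (weight lam mu) = lam * integral {x..y} (\<lambda>t. pos_part (a t))"
    using integral_weight[OF xyT] * by simp
  show "0 \<le> integral {x..y} (\<lambda>t. pos_part (a t))"
    by (rule integral_nonneg[OF integrable_sub(1)[OF xyT]]) (rule parts_nonneg)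
qed

lemma integral_neg_interval:
  assumes i: "i \<le> m" and xy: "{x..y} \<subseteq> {\<tau> i..\<sigma> (Suc i)}"
  shows "integral {x..y} (weight lam mu) = - mu * integral {x..y} (\<lambda>t. neg_part (a t))"
    "0 \<le> integral {x..y} (\<lambda>t. neg_part (a t))"
proof -
  have sub: "{\<tau> i..\<sigma> (Suc i)} \<subseteq> {0..T}" using interval_bounds(1)[OF i] by auto
  have xyT: "{x..y} \<subseteq> {0..T}" using xy sub by (rule order_trans)
  show "0 \<le> integral {x..y} (\<lambda>t. neg_part (a t))"
    by (rule integral_nonneg[OF integrable_sub(2)[OF xyT]]) (rule parts_nonneg)
  show "integral {x..y} (weight lam mu) = - mu * integral {x..y} (\<lambda>t. neg_part (a t))"
  proof (cases "\<tau> i < \<sigma> (Suc i)")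
    case True
    then have "prec_zero_on a {\<tau> i..\<sigma> (Suc i)}" using a_prec[of i] i by auto
    then have "AE t in lebesgue_on {\<tau> i..\<sigma> (Suc i)}. pos_part (a t) = 0"
      unfolding prec_zero_on_def succ_zero_on_def
      by (elim conjE) (erule AE_mp, rule AE_I2, simp add: pos_part_def)
    then have "integral {x..y} (\<lambda>t. pos_part (a t)) = 0" using xy by (rule integral_eq_0_of_AE)
    then show ?thesis using integral_weight[OF xyT] by simp
  next
    case False
    \<comment> \<open>On a degenerate interval \<open>a_prec\<close> says nothing, but then all the
      integrals vanish.\<close>
    have "y \<le> x"
    proof (rule ccontr)
      assume "\<not> y \<le> x"
      then have "x \<in> {\<tau> i..\<sigma> (Suc i)}" "y \<in> {\<tau> i..\<sigma> (Suc i)}" using xy by auto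
      with False \<open>\<not> y \<le> x\<close> show False by auto
    qed
    then have "integral {x..y} f = 0" for f :: "real \<Rightarrow> real"
      by (cases "x = y") auto
    then show ?thesis by simp
  qed
qed

lemma integral_pos_part_pos:
  assumes i: "i \<in> {1..m}" shows "0 < integral {\<sigma> i..\<tau> i} (\<lambda>t. pos_part (a t))"
proof -
  have sub: "{\<sigma> i..\<tau> i} \<subseteq> {0..T}" using interval_bounds(2)[OF i] by auto
  have f: "a absolutely_integrable_on {\<sigma> i..\<tau> i}"
    using a_int sub by (rule absolutely_integrable_on_subinterval)
  have "0 < integral {\<sigma> i..\<tau> i} a" by (rule integral_pos_of_succ_zero_on[OF a_succ[OF i] f])
  also have "\<dots> \<le> integral {\<sigma> i..\<tau> i} (\<lambda>t. pos_part (a t))"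
    using f integrable_sub(1)[OF sub]
    by (intro integral_le) (auto simp: pos_part_def dest: set_lebesgue_integral_eq_integral(1))
  finally show ?thesis .
qed

lemma integral_neg_part_pos:
  assumes i: "i \<le> m" "\<tau> i < \<sigma> (Suc i)" shows "0 < integral {\<tau> i..\<sigma> (Suc i)} (\<lambda>t. neg_part (a t))"
proof -
  have sub: "{\<tau> i..\<sigma> (Suc i)} \<subseteq> {0..T}" using interval_bounds(1)[OF i(1)] by auto
  have "(\<lambda>t. - a t) absolutely_integrable_on {0..T}"
    using absolutely_integrable_scaleR_left[OF a_int, of "- 1"] by simp
  then have f: "(\<lambda>t. - a t) absolutely_integrable_on {\<tau> i..\<sigma> (Suc i)}"
    using sub by (rule absolutely_integrable_on_subinterval)
  have "succ_zero_on (\<lambda>t. - a t) {\<tau> i..\<sigma> (Suc i)}" using a_prec[of i] i by (simp add: prec_zero_on_def)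
  then have "0 < integral {\<tau> i..\<sigma> (Suc i)} (\<lambda>t. - a t)" by (rule integral_pos_of_succ_zero_on[OF _ f])
  also have "\<dots> \<le> integral {\<tau> i..\<sigma> (Suc i)} (\<lambda>t. neg_part (a t))"
    by (rule integral_le[OF set_lebesgue_integral_eq_integral(1)[OF f] integrable_sub(2)[OF sub]])
       (simp add: neg_part_def)
  finally show ?thesis .
qed

text \<open>For \<open>m \<ge> 2\<close> there is an inner negativity interval. For
  \<open>m = 1\<close> without any, the positivity interval is all of \<open>[0,T]\<close> and the
  negative part would have integral 0: this is where \<open>a_neg\<close> enters.\<close>

lemma some_negative_interval: "\<exists>i\<le>m. \<tau> i < \<sigma> (Suc i)"
proof (rule ccontr)
  assume no: "\<not> ?thesis"
  have "m = 1"
  proof (rule ccontr)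
    assume "m \<noteq> 1"
    then have "1 \<in> {1..<m}" using m by auto
    from \<tau>_less_\<sigma>[OF this] no m show False by auto
  qed
  then have "\<sigma> 1 = 0" "\<tau> 1 = T" using no ends by (force, force)
  moreover have "1 \<in> {1..m}" using m by auto
  ultimately have "integral {0..T} (\<lambda>t. neg_part (a t)) = 0"
    using integral_pos_interval(1)[of 1 0 T] by auto
  moreover have "(LINT t:{0..T}|lebesgue. neg_part (a t)) = integral {0..T} (\<lambda>t. neg_part (a t))"
    using parts_integrable(2) by (rule set_lebesgue_integral_eq_integral(2))
  ultimately show False using a_neg by simp
qed

lemma kicks_grid: "0 < N \<Longrightarrow> kicks G (grid N)"
  by unfold_locales (auto simp: G_nonneg G_nonpos grid_mono)

lemma cell_in_block:
  assumes N: "0 < N"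
  shows "i \<in> {1..m} \<Longrightarrow> s_index N i \<le> k \<Longrightarrow> k < q_index N i \<Longrightarrow> {grid N k..grid N (Suc k)} \<subseteq> {\<sigma> i..\<tau> i}"
    "i \<le> m \<Longrightarrow> q_index N i \<le> k \<Longrightarrow> k < s_index N (Suc i) \<Longrightarrow> {grid N k..grid N (Suc k)} \<subseteq> {\<tau> i..\<sigma> (Suc i)}"
proof -
  note mono = monoD[OF grid_mono[OF N]]
  show "{grid N k..grid N (Suc k)} \<subseteq> {\<sigma> i..\<tau> i}"
    if "i \<in> {1..m}" "s_index N i \<le> k" "k < q_index N i"
    using mono[OF that(2)] mono[of "Suc k" "q_index N i"] grid_s[OF N that(1)] grid_nodes(1)[OF N, of i] that by auto
  show "{grid N k..grid N (Suc k)} \<subseteq> {\<tau> i..\<sigma> (Suc i)}"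
    if "i \<le> m" "q_index N i \<le> k" "k < s_index N (Suc i)"
    using mono[OF that(2)] mono[of "Suc k" "s_index N (Suc i)"] grid_nodes[OF N, of i] that by auto
qed

lemma kick_pos:
  assumes "0 < N" "i \<in> {1..m}" "s_index N i \<le> k" "k < q_index N i" "0 \<le> lam"
  shows "0 \<le> kick lam mu N k"
  unfolding kick_def using integral_pos_interval(2,3)[OF assms(2) cell_in_block(1)[OF assms(1-4)]] assms(5) by simp

lemma sum_kick:
  assumes N: "0 < N" and jl: "j \<le> l" "l \<le> s_index N (Suc m)"
  shows "(\<Sum>k\<in>{j..<l}. kick lam mu N k) = integral {grid N j..grid N l} (weight lam mu)"
proof -
  note mono = monoD[OF grid_mono[OF N]]
  have "{grid N j..grid N l} \<subseteq> {0..T}"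
    using mono[of 0 j] mono[OF jl(2)] grid_0[OF N] grid_end[OF N] by auto
  then show ?thesis
    unfolding kick_def using jl by (intro sum_cell_integrals grid_mono N integrable_sub(3))
qed

end

section \<open>The thresholds for \<lambda> and \<mu>\<close>

context indefinite_weight
begin

text \<open>The kicks on the inner part add up to at least \<open>lam * W\<close>, while
  \<open>hump_kick_le\<close> bounds \<open>c\<close> times their sum by
  \<open>2 * \<rho> / d\<close>. This holds for every \<open>mu\<close>, and the grid enters only
  through \<open>N0\<close>.\<close>

lemma no_hump_interval:
  assumes i: "i \<in> {1..m}"
  shows "\<exists>lam0 N0. 0 < lam0 \<and> (\<forall>lam>lam0. \<forall>N\<ge>N0. 0 < N \<longrightarrow> (\<forall>mu u v \<rho>.
     kicks.orbit G (grid N) (kick lam mu N) u v \<longrightarrow> \<rho> \<in> {1, 2} \<longrightarrow>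
     (\<forall>k\<in>{s_index N i..q_index N i}. 0 \<le> u k \<and> u k \<le> \<rho>) \<longrightarrow>
     (\<forall>k\<in>{s_index N i..q_index N i}. u k \<noteq> \<rho>)))"
proof -
  let ?P = "\<lambda>t. pos_part (a t)"
  have sub: "{\<sigma> i..\<tau> i} \<subseteq> {0..T}" and st: "\<sigma> i < \<tau> i" using interval_bounds(2)[OF i] by auto
  obtain d where d: "0 < d" "4 * d < \<tau> i - \<sigma> i" "0 < integral {\<sigma> i + 2 * d..\<tau> i - 2 * d} ?P"
    using shrink_interval_integral_pos[OF integrable_sub(1)[OF sub] st integral_pos_part_pos[OF i]] by blast
  define W where "W = integral {\<sigma> i + 2 * d..\<tau> i - 2 * d} ?P"
  have W: "0 < W" using d by (simp add: W_def)
  \<comment> \<open>A hump of height at least 1 stays above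
    \<open>d / (\<tau> i - \<sigma> i)\<close> on the inner part.\<close>
  obtain c where c: "0 < c" "\<And>y. d / (\<tau> i - \<sigma> i) \<le> y \<Longrightarrow> y \<le> 2 \<Longrightarrow> c \<le> g y"
    using exists_positive_lower_bound[OF g_cont g_pos, of "d / (\<tau> i - \<sigma> i)" 2] d st by (auto simp: divide_le_eq)
  \<comment> \<open>From \<open>c * (lam * W) \<le> 2 * \<rho> / d\<close> with
    \<open>\<rho> \<le> 2\<close>.\<close>
  define lam0 where "lam0 = 4 / (d * c * W)"
  have lam0: "0 < lam0" using d c W by (simp add: lam0_def)
  \<comment> \<open>Cells of length at most \<open>T / N\<close> are then at most \<open>d\<close>
    long, as \<open>inner_nodes\<close> requires.\<close>
  obtain N0 where N0: "T / d \<le> real N0" using real_arch_simple by blast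
  have main: "\<forall>k\<in>{s_index N i..q_index N i}. u k \<noteq> \<rho>"
    if lam: "lam0 < lam" and N: "N0 \<le> N" "0 < N" and o: "kicks.orbit G (grid N) (kick lam mu N) u v"
      and rho: "\<rho> \<in> {1, 2}" and u: "\<And>k. k \<in> {s_index N i..q_index N i} \<Longrightarrow> 0 \<le> u k \<and> u k \<le> \<rho>"
    for lam N mu u v \<rho>
  proof
    fix p assume p: "p \<in> {s_index N i..q_index N i}"
    let ?s = "s_index N i" and ?q = "q_index N i"
    interpret kicks G "grid N" "kick lam mu N" by (rule kicks_grid[OF N(2)])
    note mono = monoD[OF grid_mono[OF N(2)]]
    have ends: "grid N ?s = \<sigma> i" "grid N ?q = \<tau> i" using grid_s[OF N(2) i] grid_nodes(1)[OF N(2), of i] i by auto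
    have qe: "?q \<le> s_index N (Suc m)" using index_le_end(2)[of i N] i by auto
    have step: "grid N (Suc k) - grid N k \<le> d" if "?s \<le> k" "k < ?q" for k
    proof -
      have "grid N (Suc k) - grid N k \<le> T / real N" using that qe by (intro grid_step N) auto
      also have "\<dots> \<le> d"
      proof -
        have "T / d \<le> real N" using N0 N by linarith
        then show ?thesis using d(1) N(2) by (simp add: field_simps)
      qed
      finally show ?thesis .
    qed
    obtain k1 k2 where k: "?s \<le> k1" "k1 \<le> k2" "k2 < ?q" "d \<le> grid N k1 - \<sigma> i" "grid N k1 \<le> \<sigma> i + 2 * d"
      "d \<le> \<tau> i - grid N k2" "\<tau> i - 2 * d \<le> grid N (Suc k2)"
      using inner_nodes[OF grid_mono[OF N(2)] s_le_q_index ends step d(1,2)] by blast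
    show "u p \<noteq> \<rho>"
    proof
      assume up: "u p = \<rho>"
      have "c * (\<Sum>j\<in>{k1..k2}. kick lam mu N j) \<le> 2 * \<rho> / d"
      proof (rule hump_kick_le[OF o, of ?s ?q])
        show "0 \<le> kick lam mu N j" if "?s \<le> j" "j < ?q" for j
          using that lam lam0 by (intro kick_pos[OF N(2) i]) auto
        show "c \<le> G y" if y: "\<rho> * d / (grid N ?q - grid N ?s) \<le> y" "y \<le> \<rho>" for y
        proof -
          have "d / (\<tau> i - \<sigma> i) \<le> \<rho> * d / (\<tau> i - \<sigma> i)" using rho d st by (intro divide_right_mono) auto
          then have "d / (\<tau> i - \<sigma> i) \<le> y" using y ends by simp
          moreover have "0 < d / (\<tau> i - \<sigma> i)" using d st by simp
          ultimately show ?thesis using c(2)[of y] y rho by (auto simp: G_eq)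
        qed
        show "s_index N i \<le> p" "p \<le> q_index N i" using p by auto
      qed (use up u k d ends in auto)
      moreover have "lam * W \<le> (\<Sum>j\<in>{k1..k2}. kick lam mu N j)"
      proof -
        have sub2: "{grid N k1..grid N (Suc k2)} \<subseteq> {\<sigma> i..\<tau> i}"
          using mono[OF k(1)] mono[of "Suc k2" ?q] k ends by auto
        have i1: "?P integrable_on {grid N k1..grid N (Suc k2)}"
          using sub2 sub by (intro integrable_sub(1)) auto
        have "W \<le> integral {grid N k1..grid N (Suc k2)} ?P"
          unfolding W_def
        proof (rule integral_subset_le[OF _ _ i1])
          show "{\<sigma> i + 2 * d..\<tau> i - 2 * d} \<subseteq> {grid N k1..grid N (Suc k2)}" using k by auto
          show "?P integrable_on {\<sigma> i + 2 * d..\<tau> i - 2 * d}"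
            using sub d(1) by (intro integrable_sub(1)) auto
        qed (simp add: parts_nonneg)
        then have "lam * W \<le> lam * integral {grid N k1..grid N (Suc k2)} ?P"
          using lam lam0 by (intro mult_left_mono) auto
        also have "\<dots> = integral {grid N k1..grid N (Suc k2)} (weight lam mu)"
          by (rule integral_pos_interval(2)[OF i sub2, symmetric])
        also have "\<dots> = (\<Sum>j\<in>{k1..<Suc k2}. kick lam mu N j)"
          using k qe by (intro sum_kick[OF N(2), symmetric]) auto
        finally show ?thesis by (simp add: atLeastLessThanSuc_atLeastAtMost)
      qed
      ultimately have "c * (lam * W) \<le> 2 * \<rho> / d"
        using c(1) by (meson less_imp_le mult_left_mono order_trans)
      also have "\<dots> \<le> 4 / d" using rho d by (intro divide_right_mono) auto
      finally have "lam \<le> lam0" using d c W by (simp add: lam0_def field_simps)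
      with lam show False by simp
    qed
  qed
  show ?thesis
    using lam0 main by (intro exI[of _ lam0] exI[of _ N0]) blast
qed

lemma no_hump_eventually:
  "\<exists>lam0 N0. 0 < lam0 \<and> (\<forall>lam>lam0. \<forall>N\<ge>N0. 0 < N \<longrightarrow> (\<forall>i\<in>{1..m}. \<forall>mu u v \<rho>.
     kicks.orbit G (grid N) (kick lam mu N) u v \<longrightarrow> \<rho> \<in> {1, 2} \<longrightarrow>
     (\<forall>k\<in>{s_index N i..q_index N i}. 0 \<le> u k \<and> u k \<le> \<rho>) \<longrightarrow>
     (\<forall>k\<in>{s_index N i..q_index N i}. u k \<noteq> \<rho>)))"
proof -
  define safe where "safe i lam N \<longleftrightarrow> (\<forall>mu u v \<rho>.
     kicks.orbit G (grid N) (kick lam mu N) u v \<longrightarrow> \<rho> \<in> {1, 2} \<longrightarrow>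
     (\<forall>k\<in>{s_index N i..q_index N i}. 0 \<le> u k \<and> u k \<le> \<rho>) \<longrightarrow>
     (\<forall>k\<in>{s_index N i..q_index N i}. u k \<noteq> \<rho>))" for i lam N
  have "\<forall>i\<in>{1..m}. \<exists>l n. 0 < l \<and> (\<forall>lam>l. \<forall>N\<ge>n. 0 < N \<longrightarrow> safe i lam N)"
    unfolding safe_def by (rule ballI, rule no_hump_interval)
  then obtain l where "\<forall>i\<in>{1..m}. \<exists>n. 0 < l i \<and> (\<forall>lam>l i. \<forall>N\<ge>n. 0 < N \<longrightarrow> safe i lam N)"
    by (drule_tac bchoice) (erule exE)
  then obtain n where "\<forall>i\<in>{1..m}. 0 < l i \<and> (\<forall>lam>l i. \<forall>N\<ge>n i. 0 < N \<longrightarrow> safe i lam N)"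
    by (drule_tac bchoice) (erule exE)
  then have l: "0 < l i" and safe: "l i < lam \<Longrightarrow> n i \<le> N \<Longrightarrow> 0 < N \<Longrightarrow> safe i lam N" if "i \<in> {1..m}" for i lam N
    using that by auto
  \<comment> \<open>Sums serve as common upper bounds for finitely many nonnegative
    thresholds.\<close>
  define lam0 where "lam0 = (\<Sum>i\<in>{1..m}. l i)"
  define N0 where "N0 = (\<Sum>i\<in>{1..m}. n i)"
  have le: "l i \<le> lam0" "n i \<le> N0" if "i \<in> {1..m}" for i
  proof -
    show "l i \<le> lam0" unfolding lam0_def using that less_imp_le[OF l] by (intro member_le_sum) auto
    show "n i \<le> N0" unfolding N0_def using that by (intro member_le_sum) auto
  qed
  have "0 < lam0" unfolding lam0_def using l m by (intro sum_pos) auto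
  moreover have "safe i lam N" if "lam0 < lam" "N0 \<le> N" "0 < N" "i \<in> {1..m}" for lam N i
    using that le[OF that(4)] by (intro safe) auto
  ultimately show ?thesis
    unfolding safe_def[symmetric] by blast
qed

text \<open>\<open>\<lambda>\<close> only has to exclude humps of height \<open>1\<close> and \<open>2\<close>; the levels \<open>r1, r2, R\<close> depend
  on \<open>\<lambda>\<close>, and \<open>\<mu>\<close> is chosen last.\<close>

lemma kicked_shooting_eventually:
  "\<exists>lam0>0. \<forall>lam>lam0. \<exists>H r1 r2 R L \<gamma> mu0 N0. 0 < mu0 \<and> (0::nat) < N0 \<and> (\<forall>mu>mu0. \<forall>N\<ge>N0.
     kicked_shooting G (grid N) (kick lam mu N) m (s_index N) (q_index N) T H r1 r2 R L \<gamma>)"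
proof -
  let ?P = "\<lambda>t. pos_part (a t)" and ?Q = "\<lambda>t. neg_part (a t)"
  obtain lam0 N0 where lam0: "0 < lam0" and hump: "\<forall>lam>lam0. \<forall>N\<ge>N0. 0 < N \<longrightarrow> (\<forall>i\<in>{1..m}. \<forall>mu u v \<rho>.
     kicks.orbit G (grid N) (kick lam mu N) u v \<longrightarrow> \<rho> \<in> {1, 2} \<longrightarrow>
     (\<forall>k\<in>{s_index N i..q_index N i}. 0 \<le> u k \<and> u k \<le> \<rho>) \<longrightarrow>
     (\<forall>k\<in>{s_index N i..q_index N i}. u k \<noteq> \<rho>))"
    using no_hump_eventually by (elim exE conjE) (rule that)
  show ?thesis
  proof (rule exI[of _ lam0], intro conjI allI impI lam0)
    fix lam assume lam: "lam0 < lam"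
    \<comment> \<open>Bounds the total kick on each positivity interval; the summand 1 makes it
      positive at once.\<close>
    define H where "H = lam * integral {0..T} ?P + 1"
    have P0: "0 \<le> integral {0..T} ?P"
      by (rule integral_nonneg[OF integrable_sub(1)]) (auto simp: parts_nonneg)
    have H: "0 < H" using P0 lam lam0 by (simp add: H_def add_nonneg_pos)
    \<comment> \<open>With \<open>g y \<le> e * x\<close> up to the level \<open>x\<close>, a
      positivity interval changes the slope by at most
      \<open>H * (e * x) = x / (8 * T)\<close>.\<close>
    define e where "e = 1 / (8 * T * H)"
    have e: "0 < e" and He: "H * (e * x) = x / (8 * T)" for x using H T_pos by (simp_all add: e_def)
    obtain r where r: "0 < r" "\<And>s. 0 < s \<Longrightarrow> s < r \<Longrightarrow> \<bar>g s\<bar> \<le> e * s" using sublinear_at_0[OF g_lim_0 e] by blast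
    obtain R where R: "2 < R" "\<And>s. 0 \<le> s \<Longrightarrow> s \<le> R \<Longrightarrow> g s \<le> e * R" using sublinear_at_top[OF g_cont g_lim_inf e] by blast
    \<comment> \<open>Both small levels lie below 1 and within the range \<open>s < r\<close> of the
      estimate at 0.\<close>
    define r2 where "r2 = min r 1 / 2"
    define r1 where "r1 = r2 / 2"
    have levels: "0 < r1" "r1 < r2" "r2 < 1" "2 < R" "r2 < r" using r(1) R(1) by (auto simp: r1_def r2_def)
    have small: "H * G y \<le> x / (8 * T)" if x: "x \<in> {r1, r2, R}" and y: "y \<le> x" for x y
    proof -
      have x0: "0 < x" using x levels by auto
      have "G y \<le> e * x"
      proof (cases "y \<le> 0")
        case True
        then show ?thesis using e x0 by (simp add: G_nonpos)
      next
        case False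
        show ?thesis
        proof (cases "x = R")
          case True
          then show ?thesis using R(2)[of y] False y by (simp add: G_eq)
        next
          case xR: False
          then have "y < r" using x y levels by auto
          then have "g y \<le> e * y" using r(2)[of y] False by auto
          also have "\<dots> \<le> e * x" using y e by (intro mult_left_mono) auto
          finally show ?thesis using False by (simp add: G_eq)
        qed
      qed
      then have "H * G y \<le> H * (e * x)" using H by (intro mult_left_mono) auto
      then show ?thesis by (simp only: He)
    qed
    obtain \<gamma> where \<gamma>: "0 < \<gamma>" "\<And>y. r1 / 4 \<le> y \<Longrightarrow> y \<le> R \<Longrightarrow> \<gamma> \<le> g y"
      using exists_positive_lower_bound[OF g_cont g_pos, of "r1 / 4" R] levels by auto
    \<comment> \<open>The sum dominates each single \<open>R / (\<tau> i - \<sigma> i)\<close>, and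
      the summand 1 makes the inequality strict.\<close>
    define L where "L = R / (8 * T) + (\<Sum>i\<in>{1..m}. R / (\<tau> i - \<sigma> i)) + 1"
    have L: "R / (8 * T) + R / (\<tau> i - \<sigma> i) < L" if "i \<in> {1..m}" for i
    proof -
      have "R / (\<tau> i - \<sigma> i) \<le> (\<Sum>i\<in>{1..m}. R / (\<tau> i - \<sigma> i))"
        using that R(1) \<sigma>_less_\<tau> by (intro member_le_sum divide_nonneg_pos) auto
      then show ?thesis by (simp add: L_def)
    qed
    have L0: "0 < L"
    proof -
      have "0 \<le> (\<Sum>i\<in>{1..m}. R / (\<tau> i - \<sigma> i))" using R(1) \<sigma>_less_\<tau> by (intro sum_nonneg divide_nonneg_pos) auto
      moreover have "0 \<le> R / (8 * T)" using R(1) T_pos by simp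
      ultimately show ?thesis by (simp add: L_def)
    qed
    define W where "W i = integral {\<tau> i..\<sigma> (Suc i)} ?Q" for i
    have W: "0 \<le> W i" if "i \<le> m" for i unfolding W_def using that by (intro integral_neg_interval(2)) auto
    \<comment> \<open>For a degenerate interval \<open>W i = 0\<close>, and the term is 0 by the
      convention on division; the others force \<open>\<gamma> * (mu * W i)\<close> above
      \<open>2 * L\<close>.\<close>
    define mu0 where "mu0 = (\<Sum>i\<le>m. 2 * L / (\<gamma> * W i)) + 1"
    have term0: "0 \<le> 2 * L / (\<gamma> * W i)" if "i \<le> m" for i using L0 \<gamma>(1) W[OF that] by simp
    have mu0: "0 < mu0" unfolding mu0_def
      by (intro add_nonneg_pos sum_nonneg term0) auto
    have steep: "2 * L < \<gamma> * (mu * W i)" if "mu0 < mu" "i \<le> m" "\<tau> i < \<sigma> (Suc i)" for mu i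
    proof -
      have Wi: "0 < W i" unfolding W_def using that by (intro integral_neg_part_pos) auto
      have "2 * L / (\<gamma> * W i) \<le> (\<Sum>i\<le>m. 2 * L / (\<gamma> * W i))"
        using that term0 by (intro member_le_sum) auto
      then have "2 * L / (\<gamma> * W i) < mu" using that by (simp add: mu0_def)
      then show ?thesis using Wi \<gamma>(1) by (simp add: field_simps)
    qed
    have ks: "kicked_shooting G (grid N) (kick lam mu N) m (s_index N) (q_index N) T H r1 r2 R L \<gamma>"
      if mu: "mu0 < mu" and N: "N0 + 1 \<le> N" for mu N
    proof -
      have N0: "0 < N" using N by simp
      note mono = monoD[OF grid_mono[OF N0]]
      interpret kicks G "grid N" "kick lam mu N" by (rule kicks_grid[OF N0])
      show ?thesis
      proof unfold_locales
        show "q_index N 0 = 0" by (simp add: q_index_def)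
        show "s_index N i \<le> q_index N i" for i by (rule s_le_q_index)
        show "q_index N i \<le> s_index N (Suc i)" for i by (rule q_le_s_index)
        show "grid N (s_index N i) < grid N (q_index N i)" if "i \<in> {1..m}" for i
          using grid_s[OF N0 that] grid_nodes(1)[OF N0, of i] \<sigma>_less_\<tau>[OF that] that by auto
        show "0 \<le> kick lam mu N k" if "i \<in> {1..m}" "s_index N i \<le> k" "k < q_index N i" for i k
          using lam lam0 by (intro kick_pos[OF N0 that]) auto
        show "(\<Sum>k\<in>{s_index N i..<q_index N i}. kick lam mu N k) \<le> H" if i: "i \<in> {1..m}" for i
        proof -
          have b: "0 \<le> \<sigma> i" "\<tau> i \<le> T" using interval_bounds(2)[OF i] by auto
          have "(\<Sum>k\<in>{s_index N i..<q_index N i}. kick lam mu N k) = integral {\<sigma> i..\<tau> i} (weight lam mu)"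
            using sum_kick[OF N0 s_le_q_index index_le_end(2), of i] grid_s[OF N0 i] grid_nodes(1)[OF N0, of i] i by simp
          also have "\<dots> = lam * integral {\<sigma> i..\<tau> i} ?P" by (rule integral_pos_interval(2)[OF i order_refl])
          also have "\<dots> \<le> lam * integral {0..T} ?P"
            using b lam lam0 by (intro mult_left_mono integral_subset_le integrable_sub(1)) (auto simp: parts_nonneg)
          finally show ?thesis by (simp add: H_def)
        qed
        show "kick lam mu N k \<le> 0" if "i \<le> m" "q_index N i \<le> k" "k < s_index N (Suc i)" for i k
          unfolding kick_def using integral_neg_interval[OF that(1) cell_in_block(2)[OF N0 that]] mu mu0
          by (simp add: mult_nonneg_nonneg)
        show "kick lam mu N k = 0"
          if "i \<le> m" "grid N (q_index N i) = grid N (s_index N (Suc i))" "q_index N i \<le> k" "k < s_index N (Suc i)" for i k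
        proof -
          have "grid N k = grid N (Suc k)"
            using mono[OF that(3)] mono[of k "Suc k"] mono[of "Suc k" "s_index N (Suc i)"] that by auto
          then show ?thesis by (simp add: kick_def)
        qed
        show "2 * L < \<gamma> * (\<Sum>k\<in>{q_index N i..<s_index N (Suc i)}. - kick lam mu N k)"
          if i: "i \<le> m" and lt: "grid N (q_index N i) < grid N (s_index N (Suc i))" for i
        proof -
          have "(\<Sum>k\<in>{q_index N i..<s_index N (Suc i)}. kick lam mu N k) = integral {\<tau> i..\<sigma> (Suc i)} (weight lam mu)"
            using sum_kick[OF N0 q_le_s_index index_le_end(1), of i] grid_nodes[OF N0 i] i by simp
          also have "\<dots> = - mu * W i" unfolding W_def by (rule integral_neg_interval(1)[OF i order_refl])
          finally show ?thesis using steep[OF mu i] lt grid_nodes[OF N0 i] by (simp add: sum_negf)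
        qed
        show "grid N (q_index N i) < grid N (s_index N (Suc i))" if "1 \<le> i" "i < m" for i
          using grid_nodes[OF N0, of i] \<tau>_less_\<sigma>[of i] that by auto
        show "\<exists>i\<le>m. grid N (q_index N i) < grid N (s_index N (Suc i))"
          using some_negative_interval grid_nodes[OF N0] by auto
        show "\<gamma> \<le> G y" if "r1 / 4 \<le> y" "y \<le> R" for y
          using \<gamma>(2)[OF that] that levels by (simp add: G_eq)
        show "R / (8 * T) + R / (grid N (q_index N i) - grid N (s_index N i)) < L" if "i \<in> {1..m}" for i
          using L[OF that] grid_s[OF N0 that] grid_nodes(1)[OF N0, of i] that by auto
        show "\<forall>k\<in>{s_index N i..q_index N i}. u k \<noteq> \<rho>"
          if "orbit u v" "i \<in> {1..m}" "\<rho> \<in> {1, 2}" "\<And>k. k \<in> {s_index N i..q_index N i} \<Longrightarrow> 0 \<le> u k \<and> u k \<le> \<rho>" for u v i \<rho>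
        proof -
          have "N0 \<le> N" using N by simp
          from hump[rule_format, OF lam this N0 that(2,1,3)] that(4) show ?thesis by blast
        qed
      qed (use G_cont m T_pos H levels small grid_0[OF N0] grid_end[OF N0] in auto)
    qed
    show "\<exists>H r1 r2 R L \<gamma> mu0 N0. 0 < mu0 \<and> (0::nat) < N0 \<and> (\<forall>mu>mu0. \<forall>N\<ge>N0.
     kicked_shooting G (grid N) (kick lam mu N) m (s_index N) (q_index N) T H r1 r2 R L \<gamma>)"
    proof (rule exI[of _ H], rule exI[of _ r1], rule exI[of _ r2], rule exI[of _ R], rule exI[of _ L],
        rule exI[of _ \<gamma>], rule exI[of _ mu0], rule exI[of _ "N0 + 1"], intro conjI allI impI)
      show "0 < mu0" by (rule mu0)
      show "0 < N0 + 1" by simp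
    qed (rule ks)
  qed
qed

end

section \<open>Counting the solutions\<close>

text \<open>The counterpart of \<open>pattern_range\<close> for functions on an interval, in a form
  that passes to limits of orbits and still tells the patterns apart.\<close>

definition in_pattern :: "real \<Rightarrow> real \<Rightarrow> nat \<Rightarrow> (real \<Rightarrow> real) \<Rightarrow> real set \<Rightarrow> bool" where
  "in_pattern r1 r2 j f I \<longleftrightarrow> (if j = 0 then \<forall>x\<in>I. f x \<le> r1
     else if j = 1 then (\<forall>x\<in>I. f x \<le> 1) \<and> (\<exists>x\<in>I. r2 \<le> f x) else \<exists>x\<in>I. 2 \<le> f x)"

lemma nonzero_pattern_large:
  "in_pattern r1 r2 j f I \<Longrightarrow> j \<noteq> 0 \<Longrightarrow> r2 < 1 \<Longrightarrow> \<exists>x\<in>I. r2 \<le> f x"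
  unfolding in_pattern_def by (force split: if_splits)

lemma in_pattern_unique:
  assumes "in_pattern r1 r2 j f I" "in_pattern r1 r2 l f I" "r1 < r2" "r2 < 1" "j < 3" "l < 3"
  shows "j = l"
proof -
  have "\<not> j < l" if P: "in_pattern r1 r2 j f I" "in_pattern r1 r2 l f I" and "l < 3" for j l
  proof
    assume jl: "j < l"
    show False
    proof (cases "j = 0")
      case True
      then have "\<forall>x\<in>I. f x \<le> r1" using P(1) by (simp add: in_pattern_def)
      moreover have "\<exists>x\<in>I. r2 \<le> f x" using nonzero_pattern_large[OF P(2)] jl assms(4) by simp
      ultimately show False using assms(3) by fastforce
    next
      case False
      then have "j = 1" "l = 2" using jl \<open>l < 3\<close> by auto
      then have "\<forall>x\<in>I. f x \<le> 1" "\<exists>x\<in>I. 2 \<le> f x" using P by (simp_all add: in_pattern_def)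
      then show False by fastforce
    qed
  qed
  from this[OF assms(1,2,6)] this[OF assms(2,1,5)] show ?thesis by simp
qed

text \<open>The maximum of \<open>f\<close> over the whole interval is compared with the orbit at
  one of its large nodes, so these nodes need not converge.\<close>

lemma limit_of_maxima:
  fixes u t :: "nat \<Rightarrow> nat \<Rightarrow> real" and f :: "real \<Rightarrow> real"
  assumes I: "a \<le> b" "continuous_on {a..b} f"
    and A: "\<And>n k. k \<in> A n \<Longrightarrow> t n k \<in> {a..b}"
    and close: "\<And>e. 0 < e \<Longrightarrow> \<forall>\<^sub>F n in sequentially. \<forall>k\<in>A n. \<bar>u n k - f (t n k)\<bar> < e"
    and large: "\<And>n. \<exists>k\<in>A n. c \<le> u n k"
  shows "\<exists>x\<in>{a..b}. c \<le> f x"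
proof -
  obtain p where p: "p \<in> {a..b}" "\<And>x. x \<in> {a..b} \<Longrightarrow> f x \<le> f p"
    using continuous_attains_sup[of "{a..b}" f] I by auto
  have "c \<le> f p"
  proof (rule field_le_epsilon)
    fix e :: real assume "0 < e"
    then obtain n where n: "\<forall>k\<in>A n. \<bar>u n k - f (t n k)\<bar> < e"
      using close[of e] by (auto simp: eventually_sequentially)
    obtain k where k: "k \<in> A n" "c \<le> u n k" using large by blast
    have "f (t n k) \<le> f p" using A[OF k(1)] by (rule p(2))
    moreover have "\<bar>u n k - f (t n k)\<bar> < e" using n k(1) by blast
    ultimately show "c \<le> f p + e" using k(2) by linarith
  qed
  with p(1) show ?thesis by blast
qed

text \<open>The point \<open>x\<close> is approached through nodes of its own block, since the bound
  \<open>c\<close> holds only there.\<close>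

lemma limit_of_node_bounds:
  fixes u t :: "nat \<Rightarrow> nat \<Rightarrow> real" and f :: "real \<Rightarrow> real"
  assumes f: "continuous_on {a..b} f"
    and t: "\<And>n. mono (t n)" "\<And>n. s n \<le> q n" "\<And>n. t n (s n) = a" "\<And>n. t n (q n) = b"
    and mesh: "\<And>e. 0 < e \<Longrightarrow> \<forall>\<^sub>F n in sequentially. \<forall>k. s n \<le> k \<and> k < q n \<longrightarrow> t n (Suc k) - t n k < e"
    and close: "\<And>e. 0 < e \<Longrightarrow> \<forall>\<^sub>F n in sequentially. \<forall>k\<in>{s n..q n}. \<bar>u n k - f (t n k)\<bar> < e"
    and le: "\<And>n k. k \<in> {s n..q n} \<Longrightarrow> u n k \<le> c" and x: "x \<in> {a..b}"
  shows "f x \<le> c"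
proof -
  \<comment> \<open>Indices are shifted by \<open>s n\<close> and times by \<open>a\<close>, as
    \<open>nodes_near\<close> is about grids that start at 0.\<close>
  have "\<exists>k. (\<forall>n. k n \<le> q n - s n \<and> t n (s n + k n) - a \<le> x - a) \<and> (\<lambda>n. t n (s n + k n) - a) \<longlonglongrightarrow> x - a"
  proof (rule nodes_near[of "\<lambda>n k. t n (s n + k) - a" "\<lambda>n. q n - s n" "b - a"])
    show "mono (\<lambda>k. t n (s n + k) - a)" for n using t(1)[of n] by (auto simp: mono_def)
    show "\<forall>\<^sub>F n in sequentially. \<forall>k<q n - s n. t n (s n + Suc k) - a - (t n (s n + k) - a) < e" if "0 < e" for e
      using mesh[OF that] by eventually_elim auto
  qed (use t x in auto)
  then obtain k where k: "\<And>n. k n \<le> q n - s n" "(\<lambda>n. t n (s n + k n) - a) \<longlonglongrightarrow> x - a" by blast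
  define l where "l n = s n + k n" for n
  have l: "l n \<in> {s n..q n}" for n using k(1)[of n] t(2)[of n] by (auto simp: l_def)
  have "(\<lambda>n. t n (l n)) \<longlonglongrightarrow> x" using tendsto_add[OF k(2) tendsto_const[of a]] by (simp add: l_def)
  moreover have "t n (l n) \<in> {a..b}" for n using monoD[OF t(1)[of n]] l[of n] t(3,4)[of n] by (metis atLeastAtMost_iff)
  ultimately have lim: "(\<lambda>n. f (t n (l n))) \<longlonglongrightarrow> f x"
    by (intro continuous_on_tendsto_compose[OF f _ x]) auto
  show ?thesis
  proof (rule field_le_epsilon)
    fix e :: real assume e: "0 < e"
    have "\<forall>\<^sub>F n in sequentially. f (t n (l n)) \<le> c + e"
      using close[OF e]
    proof eventually_elim
      case (elim n)
      then have "\<bar>u n (l n) - f (t n (l n))\<bar> < e" using l by blast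
      with le[OF l[of n]] show ?case by linarith
    qed
    then show "f x \<le> c + e" by (intro tendsto_upperbound[OF lim]) auto
  qed
qed

context indefinite_weight
begin

definition positive_solution :: "bool \<Rightarrow> (real \<Rightarrow> real) \<Rightarrow> (real \<Rightarrow> real) \<Rightarrow> bool" where
  "positive_solution neumann h u = (if neumann then positive_neumann_solution T h g u else positive_dirichlet_solution T h g u)"

text \<open>The limit of \<open>g s / s\<close> gives the bound near 0, boundedness of
  \<open>g\<close> on \<open>[0, M]\<close> gives it away from 0. In
  \<open>zero_solution_unique\<close> it plays the part of a Lipschitz condition at 0.\<close>

lemma linear_bound:
  obtains C where "0 \<le> C" "\<And>s. 0 \<le> s \<Longrightarrow> s \<le> M \<Longrightarrow> g s \<le> C * s"
proof -
  obtain r where r: "0 < r" "\<And>s. 0 < s \<Longrightarrow> s < r \<Longrightarrow> \<bar>g s\<bar> \<le> 1 * s" using sublinear_at_0[OF g_lim_0, of 1] by auto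
  have "compact (g ` {0..M})" by (intro compact_continuous_image continuous_on_subset[OF g_cont]) auto
  then obtain B where B: "\<forall>z\<in>g ` {0..M}. norm z \<le> B" by (metis bounded_iff compact_imp_bounded)
  define C where "C = max 1 (\<bar>B\<bar> / r)"
  have "g s \<le> C * s" if s: "0 \<le> s" "s \<le> M" for s
  proof -
    consider "s = 0" | "0 < s" "s < r" | "r \<le> s" using s(1) by linarith
    then show ?thesis
    proof cases
      case 1
      then show ?thesis by (simp add: g_0)
    next
      case 2
      have "g s \<le> 1 * s" using r(2)[OF 2] by simp
      also have "\<dots> \<le> C * s" using s(1) by (intro mult_right_mono) (auto simp: C_def)
      finally show ?thesis .
    next
      case 3
      have "g s \<le> \<bar>B\<bar>" using B s by force
      also have "\<dots> = \<bar>B\<bar> / r * r" using r(1) by simp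
      also have "\<dots> \<le> C * s" using 3 r(1) by (intro mult_mono) (auto simp: C_def)
      finally show ?thesis .
    qed
  qed
  then show ?thesis by (intro that[of C]) (auto simp: C_def)
qed

text \<open>At an interior zero a nonnegative \<open>f\<close> has slope 0; at an end point the
  Neumann condition gives slope 0. With value and slope 0 at one point \<open>f\<close> would vanish
  identically.\<close>

lemma positive_solution_of_integral_equation:
  assumes fw: "continuous_on {0..T} f" "continuous_on {0..T} w"
    and w: "\<And>x. x \<in> {0..T} \<Longrightarrow> w x = w 0 - integral {0..x} (\<lambda>s. weight lam mu s * G (f s))"
    and f: "\<And>x. x \<in> {0..T} \<Longrightarrow> f x = f 0 + integral {0..x} w"
    and nonneg: "\<And>x. x \<in> {0..T} \<Longrightarrow> 0 \<le> f x"
    and bc: "if neumann then w 0 = 0 \<and> w T = 0 else f 0 = 0 \<and> f T = 0"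
    and nontriv: "\<exists>x\<in>{0..T}. f x \<noteq> 0"
  shows "positive_solution neumann (weight lam mu) f"
proof -
  let ?h = "weight lam mu"
  have gf: "continuous_on {0..T} (\<lambda>s. g (f s))"
    by (rule continuous_on_compose2[OF g_cont fw(1)]) (use nonneg in auto)
  have "(\<lambda>s. g (f s) * ?h s) absolutely_integrable_on {0..T}"
  proof (rule absolutely_integrable_bounded_measurable_product_real[OF _ _ _ weight_abs_integrable])
    show "(\<lambda>s. g (f s)) \<in> borel_measurable (lebesgue_on {0..T})"
      by (rule continuous_imp_measurable_on_sets_lebesgue[OF gf]) auto
    show "bounded ((\<lambda>s. g (f s)) ` {0..T})"
      by (intro compact_imp_bounded compact_continuous_image gf) auto
  qed auto
  then have hg: "(\<lambda>s. ?h s * g (f s)) absolutely_integrable_on {0..T}" by (simp add: mult.commute)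
  have w': "w x = w 0 - integral {0..x} (\<lambda>s. ?h s * g (f s))" if "x \<in> {0..T}" for x
  proof -
    have "integral {0..x} (\<lambda>s. ?h s * G (f s)) = integral {0..x} (\<lambda>s. ?h s * g (f s))"
      using that by (intro integral_cong) (simp add: G_eq nonneg)
    with w[OF that] show ?thesis by simp
  qed
  have sol: "caratheodory_solution T ?h g f w"
    by (rule caratheodory_solution_integral_equation[OF hg w' f fw(2) nonneg])
  obtain M where M: "\<And>x. x \<in> {0..T} \<Longrightarrow> f x \<le> M"
    using continuous_attains_sup[OF _ _ fw(1)] T_pos by force
  obtain C where C: "0 \<le> C" "\<And>s. 0 \<le> s \<Longrightarrow> s \<le> M \<Longrightarrow> g s \<le> C * s" using linear_bound[of M] by blast
  have not_both: "\<not> (f z = 0 \<and> w z = 0)" if z: "z \<in> {0..T}" for z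
  proof
    assume fwz: "f z = 0 \<and> w z = 0"
    have "f x = 0" if "x \<in> {0..T}" for x
    proof (rule zero_solution_unique[OF T_pos _ _ w' f fw _ C(1) z _ _ that])
      show "(\<lambda>s. \<bar>?h s\<bar>) integrable_on {0..T}"
        using weight_abs_integrable[of lam mu] by (simp add: absolutely_integrable_on_def)
      show "(\<lambda>s. ?h s * g (f s)) integrable_on {0..T}" using hg by (rule set_lebesgue_integral_eq_integral(1))
      show "\<bar>g (f s)\<bar> \<le> C * \<bar>f s\<bar>" if "s \<in> {0..T}" for s
        using C(2)[OF nonneg[OF that] M[OF that]] nonneg[OF that] g_nonneg[of "f s"] by simp
    qed (use fwz in auto)
    with nontriv show False by blast
  qed
  have interior: "0 < f z" if z: "0 < z" "z < T" for z
  proof (rule ccontr)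
    assume "\<not> 0 < f z"
    then have fz: "f z = 0" using nonneg[of z] z by simp
    have "(f has_real_derivative w z) (at z within {0..T})"
      using sol z unfolding caratheodory_solution_def by auto
    from zero_slope_at_interior_zero[OF this z fz nonneg] not_both[of z] fz z show False by auto
  qed
  show ?thesis
  proof (cases neumann)
    case True
    have "0 < f z" if "z \<in> {0..T}" for z
    proof (cases "z = 0 \<or> z = T")
      case True
      then have "f z \<noteq> 0" using not_both[OF that] bc \<open>neumann\<close> by auto
      with nonneg[OF that] show ?thesis by simp
    next
      case False
      with that show ?thesis by (intro interior) auto
    qed
    with sol bc True show ?thesis unfolding positive_solution_def positive_neumann_solution_def by auto
  next
    case False
    with sol bc interior show ?thesis unfolding positive_solution_def positive_dirichlet_solution_def by auto
  qed
qed

text \<open>Each fine grid has an orbit with pattern \<open>p\<close>; a limit along refined grids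
  solves the problem and inherits the closed conditions of the pattern.\<close>

lemma solution_with_pattern:
  assumes ks: "\<And>N. N0 \<le> N \<Longrightarrow> kicked_shooting G (grid N) (kick lam mu N) m (s_index N) (q_index N) T H r1 r2 R L \<gamma>"
    and N0: "0 < N0" and p: "\<exists>i\<in>{1..m}. p i \<noteq> 0"
  shows "\<exists>f. positive_solution neumann (weight lam mu) f \<and> (\<forall>i\<in>{1..m}. in_pattern r1 r2 (p i) f {\<sigma> i..\<tau> i})"
proof -
  \<comment> \<open>The shift by \<open>N0\<close> makes all grids admissible and still sends the
    mesh to 0.\<close>
  define N where "N n = n + N0" for n
  have N: "0 < N n" "N0 \<le> N n" for n using N0 by (auto simp: N_def)
  define K where "K n = s_index (N n) (Suc m)" for n
  define E where "E = R + L + 1"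
  \<comment> \<open>Values and slopes are packed into one pair so that a single use of
    \<open>choice\<close> picks them for every \<open>n\<close>.\<close>
  have ex: "\<forall>n. \<exists>x. \<exists>u v c. x = (u, v) \<and> 0 \<le> c \<and> c \<le> E \<and> kicks.orbit G (grid (N n)) (kick lam mu (N n)) u v \<and>
     (u 0, v 0) = (if neumann then (c, 0) else (0, c)) \<and> (if neumann then v (K n) else u (K n)) = 0 \<and>
     (\<forall>i\<in>{1..m}. Max (u ` {s_index (N n) i..q_index (N n) i}) \<in> pattern_range r1 r2 R (p i)) \<and>
     (\<forall>k\<le>K n. 0 \<le> u k \<and> u k \<le> R)"
  proof
    fix n
    \<comment> \<open>The boundary condition is chosen only at this interpretation: the constants
      serve both problems alike.\<close>
    interpret ks: kicked_shooting G "grid (N n)" "kick lam mu (N n)" m "s_index (N n)" "q_index (N n)" neumann T H r1 r2 R L \<gamma>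
      by (rule ks[OF N(2)])
    show "\<exists>x. \<exists>u v c. x = (u, v) \<and> 0 \<le> c \<and> c \<le> E \<and> kicks.orbit G (grid (N n)) (kick lam mu (N n)) u v \<and>
     (u 0, v 0) = (if neumann then (c, 0) else (0, c)) \<and> (if neumann then v (K n) else u (K n)) = 0 \<and>
     (\<forall>i\<in>{1..m}. Max (u ` {s_index (N n) i..q_index (N n) i}) \<in> pattern_range r1 r2 R (p i)) \<and>
     (\<forall>k\<le>K n. 0 \<le> u k \<and> u k \<le> R)"
      using ks.kicked_pattern[of p] unfolding ks.start_def ks.final_def K_def E_def by blast
  qed
  obtain U where "\<forall>n. \<exists>u v c. U n = (u, v) \<and> 0 \<le> c \<and> c \<le> E \<and> kicks.orbit G (grid (N n)) (kick lam mu (N n)) u v \<and>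
     (u 0, v 0) = (if neumann then (c, 0) else (0, c)) \<and> (if neumann then v (K n) else u (K n)) = 0 \<and>
     (\<forall>i\<in>{1..m}. Max (u ` {s_index (N n) i..q_index (N n) i}) \<in> pattern_range r1 r2 R (p i)) \<and>
     (\<forall>k\<le>K n. 0 \<le> u k \<and> u k \<le> R)"
    using choice[OF ex] by (rule exE)
  note U = this[rule_format]
  define u v where "u n = fst (U n)" and "v n = snd (U n)" for n
  have orbit: "kicks.orbit G (grid (N n)) (kick lam mu (N n)) (u n) (v n)"
    and init: "if neumann then v n 0 = 0 else u n 0 = 0" and fin: "if neumann then v n (K n) = 0 else u n (K n) = 0"
    and v0: "\<bar>v n 0\<bar> \<le> E"
    and pat: "\<And>i. i \<in> {1..m} \<Longrightarrow> Max (u n ` {s_index (N n) i..q_index (N n) i}) \<in> pattern_range r1 r2 R (p i)"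
    and bd: "\<And>k. k \<le> K n \<Longrightarrow> 0 \<le> u n k \<and> u n k \<le> R" for n
  proof -
    obtain c where c: "0 \<le> c" "c \<le> E" "(u n 0, v n 0) = (if neumann then (c, 0) else (0, c))"
      and "kicks.orbit G (grid (N n)) (kick lam mu (N n)) (u n) (v n)"
      "(if neumann then v n (K n) else u n (K n)) = 0"
      "\<forall>i\<in>{1..m}. Max (u n ` {s_index (N n) i..q_index (N n) i}) \<in> pattern_range r1 r2 R (p i)"
      "\<forall>k\<le>K n. 0 \<le> u n k \<and> u n k \<le> R"
      using U[of n] unfolding u_def v_def by (elim exE conjE) (simp only: fst_conv snd_conv that)
    then show "kicks.orbit G (grid (N n)) (kick lam mu (N n)) (u n) (v n)"
      "\<And>i. i \<in> {1..m} \<Longrightarrow> Max (u n ` {s_index (N n) i..q_index (N n) i}) \<in> pattern_range r1 r2 R (p i)"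
      "\<And>k. k \<le> K n \<Longrightarrow> 0 \<le> u n k \<and> u n k \<le> R"
      "if neumann then v n (K n) = 0 else u n (K n) = 0"
      by (simp_all split: if_splits)
    show "if neumann then v n 0 = 0 else u n 0 = 0" "\<bar>v n 0\<bar> \<le> E" using c by (simp_all split: if_splits)
  qed
  have levels: "0 < r1" "r1 < r2" "r2 < 1" "2 < R"
    using ks[OF order_refl] unfolding kicked_shooting_def kicked_shooting_axioms_def by auto
  have mesh: "\<forall>\<^sub>F n in sequentially. \<forall>k<K n. grid (N n) (Suc k) - grid (N n) k < e" if "0 < e" for e
  proof -
    have "(\<lambda>n. T / real (N n)) \<longlonglongrightarrow> 0"
      unfolding N_def by (rule LIMSEQ_ignore_initial_segment) (rule lim_const_over_n)
    then have "\<forall>\<^sub>F n in sequentially. T / real (N n) < e" using that by (rule order_tendstoD(2))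
    then show ?thesis
    proof eventually_elim
      case (elim n)
      then show ?case using grid_step[OF N(1)] unfolding K_def by (meson le_less_trans)
    qed
  qed
  have u_Suc: "u n (Suc k) = u n k + (grid (N n) (Suc k) - grid (N n) k) * v n (Suc k)"
    and v_Suc: "v n (Suc k) = v n k - integral {grid (N n) k..grid (N n) (Suc k)} (weight lam mu) * G (u n k)" for n k
    using orbit[of n] kicks.orbit_def[OF kicks_grid[OF N(1)]] unfolding kick_def by auto
  have t_end: "grid (N n) (K n) = T" for n unfolding K_def by (rule grid_end[OF N(1)])
  obtain \<phi> f w where \<phi>: "strict_mono \<phi>" and fw: "continuous_on {0..T} f" "continuous_on {0..T} w"
    and w: "\<And>x. x \<in> {0..T} \<Longrightarrow> w x = w 0 - integral {0..x} (\<lambda>s. weight lam mu s * G (f s))"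
    and f: "\<And>x. x \<in> {0..T} \<Longrightarrow> f x = f 0 + integral {0..x} w"
    and close: "\<And>e. 0 < e \<Longrightarrow> \<forall>\<^sub>F n in sequentially. \<forall>k\<le>K (\<phi> n).
       \<bar>u (\<phi> n) k - f (grid (N (\<phi> n)) k)\<bar> < e \<and> \<bar>v (\<phi> n) k - w (grid (N (\<phi> n)) k)\<bar> < e"
  proof (rule kicked_limit[where t = "\<lambda>n. grid (N n)" and K = K and u = u and v = v and h = "weight lam mu"
        and G = G and T = T and R = R and C = E])
    fix \<phi> f w
    assume "strict_mono \<phi>" "continuous_on {0..T} f" "continuous_on {0..T} w"
      "\<And>x. x \<in> {0..T} \<Longrightarrow> w x = w 0 - integral {0..x} (\<lambda>s. weight lam mu s * G (f s))"
      "\<And>x. x \<in> {0..T} \<Longrightarrow> f x = f 0 + integral {0..x} w"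
      "\<And>e. 0 < e \<Longrightarrow> \<forall>\<^sub>F n in sequentially. \<forall>k\<le>K (\<phi> n).
       \<bar>u (\<phi> n) k - f (grid (N (\<phi> n)) k)\<bar> < e \<and> \<bar>v (\<phi> n) k - w (grid (N (\<phi> n)) k)\<bar> < e"
    then show thesis by (rule that)
  qed (rule T_pos weight_abs_integrable G_cont grid_mono[OF N(1)] grid_0[OF N(1)] t_end mesh bd v0 v_Suc u_Suc
      | assumption)+
  have zero_lim: "x = 0" if "\<And>e. 0 < e \<Longrightarrow> \<bar>x\<bar> < e" for x :: real
    using that[of "\<bar>x\<bar>"] by (cases "x = 0") auto
  \<comment> \<open>The orbits satisfy both conditions exactly, at the nodes 0 and
    \<open>K n\<close>, so the boundary values of the limit are smaller than every
    \<open>e\<close>.\<close>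
  have limits: "if neumann then w 0 = 0 \<and> w T = 0 else f 0 = 0 \<and> f T = 0"
  proof -
    have "(if neumann then \<bar>w 0\<bar> < e \<and> \<bar>w T\<bar> < e else \<bar>f 0\<bar> < e \<and> \<bar>f T\<bar> < e)" if e: "0 < e" for e
    proof -
      obtain n where n: "\<forall>k\<le>K (\<phi> n). \<bar>u (\<phi> n) k - f (grid (N (\<phi> n)) k)\<bar> < e \<and> \<bar>v (\<phi> n) k - w (grid (N (\<phi> n)) k)\<bar> < e"
        using close[OF e] by (auto simp: eventually_sequentially)
      have "grid (N (\<phi> n)) (K (\<phi> n)) = T" unfolding K_def by (rule grid_end[OF N(1)])
      then show ?thesis
        using n[rule_format, of 0] n[rule_format, of "K (\<phi> n)"] grid_0[OF N(1)] init[of "\<phi> n"] fin[of "\<phi> n"]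
        by (auto split: if_splits)
    qed
    then show ?thesis using zero_lim by (cases neumann) simp_all
  qed
  have mesh_\<phi>: "\<forall>\<^sub>F n in sequentially. \<forall>k<K (\<phi> n). grid (N (\<phi> n)) (Suc k) - grid (N (\<phi> n)) k < e" if "0 < e" for e
    using eventually_subseq[OF \<phi> mesh[OF that]] .
  have nonneg: "0 \<le> f x" if x: "x \<in> {0..T}" for x
  proof -
    \<comment> \<open>A lower bound for \<open>f\<close> is an upper bound for \<open>- f\<close>,
      here with the whole grid as the block.\<close>
    have "- f x \<le> 0"
    proof (rule limit_of_node_bounds[where f = "\<lambda>x. - f x" and u = "\<lambda>n k. - u (\<phi> n) k" and t = "\<lambda>n. grid (N (\<phi> n))"
          and s = "\<lambda>_. 0" and q = "\<lambda>n. K (\<phi> n)" and a = 0 and b = T])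
      show "continuous_on {0..T} (\<lambda>x. - f x)" by (intro continuous_intros fw)
      show "\<forall>\<^sub>F n in sequentially. \<forall>k\<in>{0..K (\<phi> n)}. \<bar>- u (\<phi> n) k - - f (grid (N (\<phi> n)) k)\<bar> < e" if "0 < e" for e
        using close[OF that] by eventually_elim (force simp: abs_minus_commute)
      show "\<forall>\<^sub>F n in sequentially. \<forall>k. 0 \<le> k \<and> k < K (\<phi> n) \<longrightarrow> grid (N (\<phi> n)) (Suc k) - grid (N (\<phi> n)) k < e" if "0 < e" for e
        using mesh_\<phi>[OF that] by eventually_elim auto
    qed (use x bd grid_mono[OF N(1)] grid_0[OF N(1)] grid_end[OF N(1)] in \<open>auto simp: K_def\<close>)
    then show ?thesis by simp
  qed
  have pattern: "in_pattern r1 r2 (p i) f {\<sigma> i..\<tau> i}" if i: "i \<in> {1..m}" for i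
  proof -
    let ?s = "\<lambda>n. s_index (N (\<phi> n)) i" and ?q = "\<lambda>n. q_index (N (\<phi> n)) i"
    have fi: "continuous_on {\<sigma> i..\<tau> i} f"
      using interval_bounds(2)[OF i] by (intro continuous_on_subset[OF fw(1)]) auto
    have qK: "?q n \<le> K (\<phi> n)" for n unfolding K_def using i by (intro index_le_end(2)) auto
    have st: "grid (N (\<phi> n)) (?s n) = \<sigma> i" "grid (N (\<phi> n)) (?q n) = \<tau> i" for n
      using grid_s[OF N(1) i] grid_nodes(1)[OF N(1), of i] i by auto
    have cl: "\<forall>\<^sub>F n in sequentially. \<forall>k\<in>{?s n..?q n}. \<bar>u (\<phi> n) k - f (grid (N (\<phi> n)) k)\<bar> < e" if "0 < e" for e
      using close[OF that]
    proof eventually_elim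
      case (elim n)
      then show ?case using qK[of n] by auto
    qed
    have ms: "\<forall>\<^sub>F n in sequentially. \<forall>k. ?s n \<le> k \<and> k < ?q n \<longrightarrow> grid (N (\<phi> n)) (Suc k) - grid (N (\<phi> n)) k < e" if "0 < e" for e
      using mesh_\<phi>[OF that]
    proof eventually_elim
      case (elim n)
      then show ?case using qK[of n] by auto
    qed
    have le: "f x \<le> c" if "\<And>n k. k \<in> {?s n..?q n} \<Longrightarrow> u (\<phi> n) k \<le> c" "x \<in> {\<sigma> i..\<tau> i}" for c x
      by (rule limit_of_node_bounds[OF fi grid_mono[OF N(1)] s_le_q_index st ms cl that])
    have ge: "\<exists>x\<in>{\<sigma> i..\<tau> i}. c \<le> f x" if "\<And>n. \<exists>k\<in>{?s n..?q n}. c \<le> u (\<phi> n) k" for c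
    proof (rule limit_of_maxima[OF _ fi _ cl that])
      show "\<sigma> i \<le> \<tau> i" using interval_bounds(2)[OF i] by auto
      show "grid (N (\<phi> n)) k \<in> {\<sigma> i..\<tau> i}" if "k \<in> {?s n..?q n}" for n k
        using monoD[OF grid_mono[OF N(1)[of "\<phi> n"]], of "?s n" k] monoD[OF grid_mono[OF N(1)[of "\<phi> n"]], of k "?q n"] st[of n] that by auto
    qed
    have Max: "Max (u (\<phi> n) ` {?s n..?q n}) \<in> pattern_range r1 r2 R (p i)" for n using pat[OF i] .
    have upper: "u (\<phi> n) k \<le> Max (u (\<phi> n) ` {?s n..?q n})" if "k \<in> {?s n..?q n}" for n k
      using that by (intro Max_ge) auto
    have attained: "\<exists>k\<in>{?s n..?q n}. u (\<phi> n) k = Max (u (\<phi> n) ` {?s n..?q n})" for n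
    proof -
      have "Max (u (\<phi> n) ` {?s n..?q n}) \<in> u (\<phi> n) ` {?s n..?q n}"
        using s_le_q_index by (intro Max_in) auto
      then show ?thesis by (metis (no_types, lifting) imageE)
    qed
    consider "p i = 0" | "p i = 1" | "p i \<noteq> 0" "p i \<noteq> 1" by blast
    then show ?thesis
    proof cases
      case 1
      then have M: "Max (u (\<phi> n) ` {?s n..?q n}) \<le> r1" for n using Max[of n] by (simp add: pattern_range_def)
      have "f x \<le> r1" if "x \<in> {\<sigma> i..\<tau> i}" for x
        by (rule le[OF order_trans[OF upper M] that])
      then show ?thesis using 1 by (simp add: in_pattern_def)
    next
      case 2
      then have M: "r2 \<le> Max (u (\<phi> n) ` {?s n..?q n})" "Max (u (\<phi> n) ` {?s n..?q n}) \<le> 1" for n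
        using Max[of n] by (simp_all add: pattern_range_def)
      have "\<exists>x\<in>{\<sigma> i..\<tau> i}. r2 \<le> f x" using attained M(1) by (intro ge) metis
      moreover have "f x \<le> 1" if "x \<in> {\<sigma> i..\<tau> i}" for x
        by (rule le[OF order_trans[OF upper M(2)] that])
      ultimately show ?thesis using 2 by (simp add: in_pattern_def)
    next
      case 3
      then have M: "2 \<le> Max (u (\<phi> n) ` {?s n..?q n})" for n
        using Max[of n] by (simp add: pattern_range_def)
      have "\<exists>x\<in>{\<sigma> i..\<tau> i}. 2 \<le> f x" using attained M by (intro ge) metis
      then show ?thesis using 3 by (simp add: in_pattern_def)
    qed
  qed
  \<comment> \<open>A nonzero entry of the pattern keeps the maximum of \<open>f\<close> at or above
    \<open>r2\<close>, so the limit is not the trivial solution.\<close>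
  obtain i where i: "i \<in> {1..m}" "p i \<noteq> 0" using p by blast
  from nonzero_pattern_large[OF pattern[OF i(1)] i(2) levels(3)] obtain x where "x \<in> {\<sigma> i..\<tau> i}" "r2 \<le> f x" by blast
  then have "\<exists>x\<in>{0..T}. f x \<noteq> 0" using interval_bounds(2)[OF i(1)] levels by (intro bexI[of _ x]) auto
  from positive_solution_of_integral_equation[OF fw w f nonneg limits this] pattern show ?thesis by blast
qed

lemma many_positive_solutions:
  "\<exists>lam0>0. \<forall>lam>lam0. \<exists>mu0>0. \<forall>mu>mu0.
     at_least_solutions (3 ^ m - 1) T (positive_solution neumann (weight lam mu))"
proof -
  obtain lam0 where lam0: "0 < lam0" and ev: "\<forall>lam>lam0.
    \<exists>H r1 r2 R L \<gamma> mu0 N0. 0 < mu0 \<and> (0::nat) < N0 \<and> (\<forall>mu>mu0. \<forall>N\<ge>N0.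
     kicked_shooting G (grid N) (kick lam mu N) m (s_index N) (q_index N) T H r1 r2 R L \<gamma>)"
    using kicked_shooting_eventually by (elim exE conjE) (rule that)
  show ?thesis
  proof (rule exI[of _ lam0], intro conjI allI impI lam0)
    fix lam assume "lam0 < lam"
    from ev[rule_format, OF this] obtain H r1 r2 R L \<gamma> mu0 N0 where mu0: "0 < mu0" and N0: "(0::nat) < N0" and
      ks: "\<forall>mu>mu0. \<forall>N\<ge>N0.
        kicked_shooting G (grid N) (kick lam mu N) m (s_index N) (q_index N) T H r1 r2 R L \<gamma>"
      by (elim exE conjE) (rule that)
    show "\<exists>mu0>0. \<forall>mu>mu0. at_least_solutions (3 ^ m - 1) T (positive_solution neumann (weight lam mu))"
    proof (rule exI[of _ mu0], intro conjI allI impI mu0)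
      fix mu assume mu: "mu0 < mu"
      note ks = ks[rule_format, OF mu]
      have levels: "r1 < r2" "r2 < 1"
        using ks[OF order_refl] unfolding kicked_shooting_def kicked_shooting_axioms_def by auto
      \<comment> \<open>Extensional functions, so that distinct patterns differ somewhere on
        \<open>{1..m}\<close> and are counted by \<open>card_PiE\<close>.\<close>
      define patterns where "patterns = ({1..m} \<rightarrow>\<^sub>E {..<3::nat}) - {\<lambda>i\<in>{1..m}. 0}"
      have fin: "finite patterns" unfolding patterns_def by (intro finite_Diff finite_PiE) auto
      have "(\<lambda>i\<in>{1..m}. 0) \<in> {1..m} \<rightarrow>\<^sub>E {..<3::nat}" by auto
      then have card: "card patterns = 3 ^ m - 1"
        unfolding patterns_def by (subst card_Diff_singleton) (auto simp: card_PiE)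
      have "\<exists>i\<in>{1..m}. p i \<noteq> 0" if "p \<in> patterns" for p
      proof (rule ccontr)
        assume "\<not> ?thesis"
        then have "p = (\<lambda>i\<in>{1..m}. 0)" using that by (intro PiE_ext[of p "{1..m}" "\<lambda>_. {..<3}"]) (auto simp: patterns_def)
        with that show False by (simp add: patterns_def)
      qed
      then have "\<forall>p\<in>patterns. \<exists>f. positive_solution neumann (weight lam mu) f \<and>
         (\<forall>i\<in>{1..m}. in_pattern r1 r2 (p i) f {\<sigma> i..\<tau> i})"
        using solution_with_pattern[OF ks N0] by blast
      from bchoice[OF this] obtain F where F: "\<And>p. p \<in> patterns \<Longrightarrow> positive_solution neumann (weight lam mu) (F p)"
        "\<And>p i. p \<in> patterns \<Longrightarrow> i \<in> {1..m} \<Longrightarrow> in_pattern r1 r2 (p i) (F p) {\<sigma> i..\<tau> i}" by blast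
      \<comment> \<open>The pattern can be read off from the values on \<open>[0,T]\<close>; this
        makes \<open>F\<close> and the restriction to \<open>[0,T]\<close> injective at
        once.\<close>
      have inj: "p = p'" if pp: "p \<in> patterns" "p' \<in> patterns" and eq: "restrict (F p) {0..T} = restrict (F p') {0..T}" for p p'
      proof -
        have "p i = p' i" if i: "i \<in> {1..m}" for i
        proof (rule in_pattern_unique[OF F(2)[OF pp(1) i] _ levels])
          have "F p x = F p' x" if "x \<in> {\<sigma> i..\<tau> i}" for x
            using fun_cong[OF eq, of x] that interval_bounds(2)[OF i] by auto
          then show "in_pattern r1 r2 (p' i) (F p) {\<sigma> i..\<tau> i}"
            using F(2)[OF pp(2) i] by (simp add: in_pattern_def)
          show "p i < 3" "p' i < 3" using pp i by (auto simp: patterns_def PiE_iff)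
        qed
        then show ?thesis using pp by (intro PiE_ext[of p "{1..m}" "\<lambda>_. {..<3}"]) (auto simp: patterns_def)
      qed
      have "card (F ` patterns) = 3 ^ m - 1"
        using card_image[of F patterns] inj card by (metis inj_onI)
      moreover have "inj_on (\<lambda>u. restrict u {0..T}) (F ` patterns)"
        using inj by (intro inj_onI) blast
      ultimately show "at_least_solutions (3 ^ m - 1) T (positive_solution neumann (weight lam mu))"
        unfolding at_least_solutions_def using fin F(1) by (intro exI[of _ "F ` patterns"]) auto
    qed
  qed
qed

end

theorem theorem7p1:
  fixes g a :: "real \<Rightarrow> real" and T :: real and m :: nat and \<sigma> \<tau> :: "nat \<Rightarrow> real"
  assumes g_cont: "continuous_on {0..} g"
    and g_range: "g \<in> {0..} \<rightarrow> {0..}"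
    and g_0: "g 0 = 0"
    and g_pos: "\<And>s. s > 0 \<Longrightarrow> g s > 0"
    and g_lim_0: "((\<lambda>s. g s / s) \<longlongrightarrow> 0) (at_right 0)"
    and g_lim_inf: "((\<lambda>s. g s / s) \<longlongrightarrow> 0) at_top"
    and T_pos: "T > 0"
    and a_int: "a absolutely_integrable_on {0..T}"
    and a_neg: "(LINT t:{0..T}|lebesgue. neg_part (a t)) \<noteq> 0"
    and m: "m \<ge> 1"
    and ends: "\<tau> 0 = 0" "\<sigma> (m + 1) = T" "\<tau> 0 \<le> \<sigma> 1" "\<tau> m \<le> \<sigma> (m + 1)"
    and \<sigma>_less_\<tau>: "\<And>i. i \<in> {1..m} \<Longrightarrow> \<sigma> i < \<tau> i"
    and \<tau>_less_\<sigma>: "\<And>i. i \<in> {1..<m} \<Longrightarrow> \<tau> i < \<sigma> (i + 1)"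
    and a_succ: "\<And>i. i \<in> {1..m} \<Longrightarrow> succ_zero_on a {\<sigma> i..\<tau> i}"
    and a_prec: "\<And>i. i \<in> {0..m} \<Longrightarrow> \<tau> i < \<sigma> (i + 1) \<Longrightarrow> prec_zero_on a {\<tau> i..\<sigma> (i + 1)}"
  shows
    "(\<exists>lam0>0. \<forall>lam>lam0. \<exists>mu0>0. \<forall>mu>mu0.
        at_least_solutions (3 ^ m - 1) T
          (positive_neumann_solution T (\<lambda>t. lam * pos_part (a t) - mu * neg_part (a t)) g)) \<and>
     (\<exists>lam0>0. \<forall>lam>lam0. \<exists>mu0>0. \<forall>mu>mu0.
        at_least_solutions (3 ^ m - 1) T
          (positive_dirichlet_solution T (\<lambda>t. lam * pos_part (a t) - mu * neg_part (a t)) g))"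
proof -
  interpret indefinite_weight g a T m \<sigma> \<tau>
    by unfold_locales (fact assms)+
  have w: "weight lam mu = (\<lambda>t. lam * pos_part (a t) - mu * neg_part (a t))" for lam mu
    by (rule ext) (simp add: weight_def)
  have "positive_solution True h = positive_neumann_solution T h g"
    "positive_solution False h = positive_dirichlet_solution T h g" for h
    by (rule ext, simp add: positive_solution_def)+
  with many_positive_solutions[of True] many_positive_solutions[of False] show ?thesis
    by (simp add: w)
qed

end
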